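(* For integers $a\ge2$, even $d\ge2$, and $k\ge1$, the function $\tau\mapsto W_{a,d}(e^{2\pi i\tau},k)$ on the upper half-plane is not a meromorphic modular function on any finite-index subgroup of $\mathrm{SL}_2(\mathbb Z)$ with meromorphic behaviour at the cusps.
   Context: $\Phi(q)=\prod_{n\ge1}(1-q^n)$. For $0<|q|<1$, $$W_{a,d}(q,k)=\frac1d\sum_{z^d=1}\frac{\sum_{m\ge0}z^mq^{am+1}\Phi(q^{am+1})^k}{\sum_{m\ge0}z^mq^{a(m+1)}\Phi(q^{a(m+1)})^k},$$ a meromorphic function of $q$ on $0<|q|<1$. A meromorphic modular function on a subgroup is a (weight-zero) meromorphic function on the upper half-plane invariant under that subgroup. *)

theory Defs
  imports "HOL-Complex_Analysis.Complex_Analysis" "HOL-Algebra.Coset"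
begin

definition Phi :: "complex \<Rightarrow> complex" where
  "Phi q = (\<Prod>n. 1 - q ^ Suc n)"

definition W :: "nat \<Rightarrow> nat \<Rightarrow> complex \<Rightarrow> nat \<Rightarrow> complex" where
  "W a d q k =
     1 / of_nat d *
       (\<Sum>z | z ^ d = 1.
          (\<Sum>m. z ^ m * q ^ (a * m + 1) * Phi (q ^ (a * m + 1)) ^ k) /
          (\<Sum>m. z ^ m * q ^ (a * (m + 1)) * Phi (q ^ (a * (m + 1))) ^ k))"

definition SL2Z :: "(int ^ 2 ^ 2) monoid" where
  "SL2Z = \<lparr>carrier = {A. det A = 1}, mult = (**), one = mat 1\<rparr>"

lemma group_SL2Z: "group SL2Z"
proof (rule groupI)
  fix A assume "A \<in> carrier SL2Z"
  then have *: "A$1$1 * A$2$2 - A$1$2 * A$2$1 = 1"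
    by (simp add: SL2Z_def det_2)
  let ?B = "vector [vector [A$2$2, - A$1$2], vector [- A$2$1, A$1$1]] :: int^2^2"
  have "det ?B = 1" "?B ** A = mat 1"
    using * by (simp_all add: det_2 vec_eq_iff forall_2 matrix_matrix_mult_def mat_def sum_2 algebra_simps)
  then show "\<exists>B\<in>carrier SL2Z. B \<otimes>\<^bsub>SL2Z\<^esub> A = \<one>\<^bsub>SL2Z\<^esub>"
    by (intro bexI[of _ ?B]) (auto simp: SL2Z_def)
qed (auto simp: SL2Z_def det_mul matrix_mul_assoc)

definition moebius_act :: "int ^ 2 ^ 2 \<Rightarrow> complex \<Rightarrow> complex" where
  "moebius_act A \<tau> =
     (of_int (A$1$1) * \<tau> + of_int (A$1$2)) / (of_int (A$2$1) * \<tau> + of_int (A$2$2))"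

abbreviation upper_half_plane :: "complex set" where
  "upper_half_plane \<equiv> {\<tau>. Im \<tau> > 0}"

text \<open>
  A function that is \<open>meromorphic_on\<close> a set may take arbitrary values on a sparse subset
  (in particular at its poles), so equality of meromorphic functions is equality on a
  cosparse set.

  The cusps are the points \<open>A \<infinity>\<close> for \<open>A\<close> in \<open>SL2Z\<close>. Meromorphy at \<open>A \<infinity>\<close> means
  that, near \<open>\<i>\<infinity>\<close>, the function \<open>f (A \<tau>)\<close> is a function of the local parameter
  \<open>exp (2 \<pi> \<i> \<tau> / N)\<close>, for some \<open>N \<ge> 1\<close>, that is meromorphic at \<open>0\<close>.
  If \<open>f\<close> is invariant under a finite-index subgroup, this does not depend on which
  period \<open>N\<close> of \<open>f (A \<tau>)\<close> is used.
\<close>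

definition meromorphic_at_cusps :: "(complex \<Rightarrow> complex) \<Rightarrow> bool" where
  "meromorphic_at_cusps f \<longleftrightarrow>
     (\<forall>A\<in>carrier SL2Z. \<exists>N::nat. N \<ge> 1 \<and>
        (\<exists>F. F meromorphic_on {0} \<and>
           (\<exists>C>0. \<forall>\<^sub>\<approx>\<tau>\<in>{\<tau>. Im \<tau> > C}.
              f (moebius_act A \<tau>) = F (exp (2 * of_real pi * \<i> * \<tau> / of_nat N)))))"

definition meromorphic_modular_function :: "(int ^ 2 ^ 2) set \<Rightarrow> (complex \<Rightarrow> complex) \<Rightarrow> bool" where
  "meromorphic_modular_function \<Gamma> f \<longleftrightarrow>
     f meromorphic_on upper_half_plane \<and>
     (\<forall>A\<in>\<Gamma>. \<forall>\<^sub>\<approx>\<tau>\<in>upper_half_plane. f (moebius_act A \<tau>) = f \<tau>)"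

end

theory Submission
  imports Defs "HOL-Probability.Distributions" "HOL-Real_Asymp.Real_Asymp"
begin

text \<open>
  Only the cusp \<open>0\<close> is needed. Put \<open>q = exp (- \<epsilon>)\<close> and let \<open>\<epsilon>\<close> tend to \<open>0\<close> along a ray whose argument
  is close to \<open>\<pi> / 2\<close>; this is an approach of \<open>- 1 / \<tau>\<close> to the cusp. With \<open>g t = exp (- t) Phi (exp (- t))^k\<close> and
  \<open>z = exp (2 \<pi> \<i> \<theta>)\<close>, the numerator and the denominator belonging to \<open>z\<close> are the sums of \<open>z^m g ((a m + \<rho>) \<epsilon>)\<close>
  for \<open>\<rho> = 1\<close> and \<open>\<rho> = a\<close>. By the residue theorem such a sum is the difference of two integrals along rays
  above and below the real axis. Since \<open>g t\<close> behaves like \<open>exp (- k \<pi>^2 / (6 t))\<close> up to slowly varying factors, the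
  integral over the upper ray has a saddle point, and on a ray this close to the imaginary direction it dominates
  the other one for every \<open>\<theta> < 1\<close>. Its dependence on \<open>\<rho>\<close> is a phase, so the quotient tends to
  \<open>exp (2 \<pi> \<i> \<theta> (a - 1) / a)\<close> and \<open>W\<close> tends to the average \<open>L\<close> of these phases, whose imaginary part is positive.
  Along the complex conjugate ray \<open>W\<close> tends to \<open>cnj L\<close>, whereas a function that is meromorphic at the cusp has
  a single limit there.
\<close>

section \<open>The logarithm of the Euler product\<close>

text \<open>For real \<epsilon> the value of \<open>W\<close> is real, because z and its conjugate
  contribute conjugate terms; so the approach has to be oblique. Write A = k pi^2 / 6. With
  \<epsilon> at angle pi / 2 - 2 \<delta> and the upper ray at angle pi / 2 - \<delta>, the
  exponents from exp (- A / t) and from the summation kernel have the same phase, so along that ray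
  their sum is - X (e^s + e^(-s)) times a constant phase. The upper integral then has size about exp
  (- 2 X sin \<delta>), where X = sqrt \<theta> r and r is of order |\<epsilon>|^(-1/2). The lower
  one is at most about exp (- sqrt (2 (1 - \<theta>) cos (2 \<delta>)) r), and comparing the two
  rates gives exactly 2 sin^2 \<delta> < 1 - \<theta>. Since \<theta> \<le> 1 - 1 / d for d-th roots
  of unity, one small \<delta> serves all of them. The value \<theta> = 0 is separate: the kernel
  does not decay upwards, there is no saddle, and the upper integral itself converges to a nonzero
  number. For \<theta> > 0 what is frozen at the saddle does not depend on \<rho> and cancels in the
  quotient; the remainder of the logarithm enters only through a Lipschitz bound in ln |t|, the
  coordinate in which the saddle shrinks to a point.\<close>

definition log_Phi :: "complex \<Rightarrow> complex" where
  "log_Phi t = (\<Sum>n. - 1 / (of_nat (Suc n) * (exp (of_nat (Suc n) * t) - 1)))"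

lemma norm_exp_minus_one_ge:
  assumes "Re w > 0"
  shows "norm (exp w - 1) \<ge> Re w"
proof -
  have "Re w \<le> exp (Re w) - 1"
    using exp_ge_add_one_self[of "Re w"] by linarith
  also have "\<dots> = norm (exp w) - norm (1::complex)"
    by simp
  also have "\<dots> \<le> norm (exp w - 1)"
    by (rule norm_triangle_ineq2)
  finally show ?thesis .
qed

lemma norm_log_Phi_term_le:
  assumes "0 < r" "r \<le> Re t"
  shows "norm (- 1 / (of_nat (Suc n) * (exp (of_nat (Suc n) * t) - 1)) :: complex)
    \<le> 1 / r * (1 / (of_nat n + 1) ^ 2)"
proof -
  have "(real n + 1) * r \<le> (real n + 1) * Re t"
    using assms by (intro mult_left_mono) auto
  also have "\<dots> = Re (of_nat (Suc n) * t)"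
    by simp
  also have "\<dots> \<le> norm (exp (of_nat (Suc n) * t) - 1)"
    using assms by (intro norm_exp_minus_one_ge) (auto intro!: mult_pos_pos add_pos_nonneg)
  finally have *: "(real n + 1) * r \<le> norm (exp (of_nat (Suc n) * t) - 1)" .
  have "norm (- 1 / (of_nat (Suc n) * (exp (of_nat (Suc n) * t) - 1)) :: complex)
      = 1 / ((real n + 1) * norm (exp (of_nat (Suc n) * t) - 1))"
    by (simp add: norm_divide norm_mult del: of_nat_Suc) 
  also have "\<dots> \<le> 1 / ((real n + 1) * ((real n + 1) * r))"
    proof (intro divide_left_mono mult_left_mono *)
    have "0 < (real n + 1) * r"
      using assms(1) by (intro mult_pos_pos) auto
    moreover from this * have "0 < norm (exp (of_nat (Suc n) * t) - 1)"
      by linarith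
    moreover have "0 < real n + 1"
      by simp
    ultimately show "0 < (real n + 1) * norm (exp (of_nat (Suc n) * t) - 1) * ((real n + 1) * ((real n + 1) * r))"
      using assms(1) by auto
  qed auto
  finally show ?thesis
    by (simp add: power2_eq_square field_simps)
qed

lemma summable_inverse_Suc_square: "summable (\<lambda>n. c * (1 / (of_nat n + 1) ^ 2 :: real))"
  using inverse_squares_sums by (intro summable_mult) (auto simp: sums_iff add.commute)

lemma summable_log_Phi:
  assumes "Re t > 0"
  shows "summable (\<lambda>n. - 1 / (of_nat (Suc n) * (exp (of_nat (Suc n) * t) - 1)) :: complex)"
  using norm_log_Phi_term_le[OF assms order_refl]
  by (intro summable_comparison_test'[OF summable_inverse_Suc_square[of "1 / Re t"], of 0]) auto

lemma holomorphic_log_Phi: "log_Phi holomorphic_on {t. Re t > 0}"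
proof (rule holomorphic_uniform_sequence)
  show "open {t. Re t > 0}"
    by (rule open_halfspace_Re_gt)
  show "(\<lambda>t. \<Sum>n<N. - 1 / (of_nat (Suc n) * (exp (of_nat (Suc n) * t) - 1))) holomorphic_on {t. Re t > 0}" for N
  proof (intro holomorphic_intros)
    fix n and t :: complex assume "t \<in> {t. Re t > 0}"
    then have "0 < Re (of_nat (Suc n) * t)"
      by (auto intro!: mult_pos_pos add_pos_nonneg)
    with norm_exp_minus_one_ge[OF this]
    show "of_nat (Suc n) * (exp (of_nat (Suc n) * t) - 1) \<noteq> 0"
      by (auto simp del: of_nat_Suc)
  qed
  fix t :: complex assume t: "t \<in> {t. Re t > 0}"
  have sub: "Re t / 2 \<le> Re s" if "s \<in> cball t (Re t / 2)" for s
    using that abs_Re_le_cmod[of "t - s"] by (auto simp: dist_norm)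
  have "uniform_limit (cball t (Re t / 2))
     (\<lambda>N t. \<Sum>n<N. - 1 / (of_nat (Suc n) * (exp (of_nat (Suc n) * t) - 1))) log_Phi sequentially"
    unfolding log_Phi_def
    by (rule Weierstrass_m_test[OF norm_log_Phi_term_le[of "Re t / 2"] summable_inverse_Suc_square])
       (use sub t in auto)
  then show "\<exists>d>0. cball t d \<subseteq> {t. Re t > 0} \<and> uniform_limit (cball t d)
     (\<lambda>N t. \<Sum>n<N. - 1 / (of_nat (Suc n) * (exp (of_nat (Suc n) * t) - 1))) log_Phi sequentially"
    using t sub by (intro exI[of _ "Re t / 2"]) fastforce
qed

text \<open>Expanding every \<open>Ln (1 - q ^ Suc j)\<close> in its power series and exchanging the
  two summations turns the logarithm of the product into the Lambert series \<open>log_Phi\<close>.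
  The exchange is Tannery's theorem for the truncation in j, with a majorant of order 1 / (n + 1)^2
  independent of the truncation.\<close>

lemma Phi_exp_minus:
  assumes t: "Re t > 0"
  shows "Phi (exp (- t)) = exp (log_Phi t)"
proof -
  define q where "q = exp (- t)"
  have q: "norm q < 1" "q \<noteq> 0"
    using t by (auto simp: q_def)
  have q1: "norm (q ^ Suc n) < 1" for n
    using q power_less_one_iff[of "norm q" "Suc n"] by (simp add: norm_power del: power_Suc)
  \<comment> \<open>\<open>S J n\<close> is the n-th Lambert term with its geometric series cut off
    after J terms. Summed over n it is the logarithm of the J-th partial product; for fixed n it
    tends to the full Lambert term.\<close>
  define S where "S J n = - 1 / of_nat (Suc n) * (\<Sum>j<J. (q ^ Suc n) ^ Suc j)" for J n
  have tele: "(\<Sum>j<J. x ^ Suc j) = (x - x ^ Suc J) / (1 - x)" if "x \<noteq> 1" for x :: complex and J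
    using that by (simp add: sum_gp_strict right_diff_distrib flip: sum_distrib_left)
  have Ln: "(\<lambda>n. - ((q ^ Suc j) ^ Suc n) / of_nat (Suc n)) sums Ln (1 - q ^ Suc j)" for j
    using Ln_series'[of "- (q ^ Suc j)"] q1[of j]
      sums_Suc_iff[of "\<lambda>n. - ((q ^ Suc j) ^ n) / of_nat n" "Ln (1 - q ^ Suc j)"]
    by (simp del: power_Suc of_nat_Suc)
  have LnS: "(\<lambda>n. S J n) sums (\<Sum>j<J. Ln (1 - q ^ Suc j))" for J
  proof -
    have "(\<lambda>n. \<Sum>j<J. - ((q ^ Suc j) ^ Suc n) / of_nat (Suc n)) sums (\<Sum>j<J. Ln (1 - q ^ Suc j))"
      by (intro sums_sum Ln)
    also have "(\<lambda>n. \<Sum>j<J. - ((q ^ Suc j) ^ Suc n) / of_nat (Suc n)) = S J"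
      by (simp add: S_def fun_eq_iff sum_distrib_left power_mult[symmetric] mult.commute del: power_Suc of_nat_Suc)
    finally show ?thesis .
  qed
  have lim: "(\<lambda>J. S J n) \<longlonglongrightarrow> - 1 / (of_nat (Suc n) * (exp (of_nat (Suc n) * t) - 1))" for n
  proof -
    define x where "x = q ^ Suc n"
    have x: "norm x < 1" "x \<noteq> 0" "x \<noteq> 1"
      using q1[of n] q by (auto simp: x_def simp del: power_Suc)
    have ex: "exp (of_nat (Suc n) * t) = 1 / x"
      by (simp add: x_def q_def exp_minus power_one_over exp_of_nat_mult inverse_eq_divide del: of_nat_Suc power_Suc)
    have "(\<lambda>J. x ^ Suc J) \<longlonglongrightarrow> 0"
      using x by (intro LIMSEQ_Suc LIMSEQ_power_zero)
    then have "(\<lambda>J. - 1 / of_nat (Suc n) * ((x - x ^ Suc J) / (1 - x))) \<longlonglongrightarrow> - 1 / of_nat (Suc n) * ((x - 0) / (1 - x))"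
      using x by (intro tendsto_intros) auto
    also have "- 1 / of_nat (Suc n) * ((x - 0) / (1 - x)) = - 1 / (of_nat (Suc n) * (1 / x - 1))"
      using x by (simp add: divide_simps del: of_nat_Suc)
    finally show ?thesis
      unfolding S_def ex using tele[OF x(3)] by (simp add: x_def del: of_nat_Suc power_Suc)
  qed
  have bound: "norm (S J n) \<le> 1 / Re t * (1 / (of_nat n + 1) ^ 2)" for J n
  proof -
    define r where "r = exp (- Re t) ^ Suc n"
    have r: "0 < r" "r < 1"
      using t by (auto simp: r_def power_less_one_iff simp del: power_Suc)
    have nr: "norm (q ^ Suc n) = r"
      by (simp add: r_def q_def norm_power del: power_Suc)
    have le: "norm (S J n) \<le> 1 / (real n + 1) * (\<Sum>j<J. r ^ Suc j)"
      unfolding S_def norm_mult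
    proof (intro mult_mono order_trans[OF norm_sum] sum_mono)
      show "norm (- 1 / of_nat (Suc n) :: complex) \<le> 1 / (real n + 1)"
        by (simp add: norm_divide del: of_nat_Suc) (simp add: add.commute)
      show "norm ((q ^ Suc n) ^ Suc j) \<le> r ^ Suc j" for j
        by (simp only: norm_power[of "q ^ Suc n"] nr)
    qed (auto simp: sum_nonneg)
    have "(\<Sum>j<J. r ^ Suc j) = (r - r ^ Suc J) / (1 - r)"
      using r by (simp add: sum_gp_strict right_diff_distrib flip: sum_distrib_left)
    also have "\<dots> \<le> r / (1 - r)"
      using r by (intro divide_right_mono) auto
    also have "r / (1 - r) = 1 / (exp ((real n + 1) * Re t) - 1)"
    proof -
      have "exp ((real n + 1) * Re t) = 1 / r"
        using exp_of_nat_mult[of "Suc n" "Re t"]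
        by (simp add: r_def exp_minus power_one_over inverse_eq_divide add.commute del: power_Suc)
      moreover have "1 / r - 1 = (1 - r) / r"
        using r by (simp add: field_simps)
      ultimately show ?thesis by simp
    qed
    also have "\<dots> \<le> 1 / ((real n + 1) * Re t)"
    proof -
      have "(real n + 1) * Re t > 0"
        using t by auto
      moreover have "(real n + 1) * Re t \<le> exp ((real n + 1) * Re t) - 1"
        using exp_ge_add_one_self[of "(real n + 1) * Re t"] by linarith
      ultimately show ?thesis
        by (intro frac_le) auto
    qed
    finally have "1 / (real n + 1) * (\<Sum>j<J. r ^ Suc j) \<le> 1 / (real n + 1) * (1 / ((real n + 1) * Re t))"
      by (intro mult_left_mono) auto
    also have "\<dots> = 1 / Re t * (1 / (of_nat n + 1) ^ 2)"
      by (simp add: power2_eq_square)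
    finally show ?thesis
      using le by simp
  qed
  have "(\<lambda>J. suminf (S J)) \<longlonglongrightarrow> log_Phi t"
    unfolding log_Phi_def
    by (rule tannerys_theorem[OF lim _ summable_inverse_Suc_square[of "1 / Re t"], THEN conjunct2, THEN conjunct2])
       (use bound in \<open>auto intro!: always_eventually\<close>)
  then have "(\<lambda>j. Ln (1 - q ^ Suc j)) sums log_Phi t"
    unfolding sums_unique[OF LnS, symmetric] by (simp add: sums_def)
  then have "(\<Prod>j. exp (Ln (1 - q ^ Suc j))) = exp (log_Phi t)"
    by (subst prodinf_exp) (auto simp: sums_iff)
  moreover have "exp (Ln (1 - q ^ Suc j)) = 1 - q ^ Suc j" for j
    using q1[of j] by (intro exp_Ln) (auto simp del: power_Suc)
  ultimately show ?thesis
    by (simp add: Phi_def q_def)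
qed

section \<open>Slow variation of the remainder term\<close>

text \<open>The Planck function with its pole at 0 removed. The poles 1 / (n t), weighted by 1 / n
  as in the Lambert series, sum to the main term pi^2 / (6 t).\<close>

definition planck :: "complex \<Rightarrow> complex" where
  "planck w = 1 / (exp w - 1) - 1 / w"

definition planck_deriv :: "complex \<Rightarrow> complex" where
  "planck_deriv w = 1 / w ^ 2 - exp w / (exp w - 1) ^ 2"

lemma has_field_derivative_planck:
  assumes "Re w > 0"
  shows "(planck has_field_derivative planck_deriv w) (at w)"
proof -
  have "w \<noteq> 0" "exp w \<noteq> 1"
    using assms norm_exp_minus_one_ge[OF assms] by auto
  then show ?thesis
    unfolding planck_def planck_deriv_def
    by (auto intro!: derivative_eq_intros simp: power2_eq_square field_simps)
qed

text \<open>The left side is 1 / (4 sinh^2 (y / 2)). The constant 2 is generous and follows from the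
  quadratic Taylor bound alone: with \<open>s\<close> the excess of \<open>exp y\<close> over that
  polynomial, the cleared difference has only nonnegative coefficients in y and s.\<close>

lemma exp_over_square_le:
  assumes "y > (0::real)"
  shows "exp y / (exp y - 1) ^ 2 \<le> 2 / y ^ 2"
proof -
  have 1: "exp y \<ge> 1 + y + y ^ 2 / 2"
    using exp_lower_Taylor_quadratic[of y] assms by simp
  have e1: "exp y > 1" using assms by simp
  have "y ^ 2 * exp y \<le> 2 * (exp y - 1) ^ 2"
  proof -
    define s where "s = exp y - 1 - y - y ^ 2 / 2"
    have s: "s \<ge> 0" "exp y = 1 + y + y ^ 2 / 2 + s"
      using 1 by (auto simp: s_def)
    have "2 * (exp y - 1) ^ 2 - y ^ 2 * exp y = 
       y ^ 2 + y ^ 3 + 2 * s ^ 2 + 4 * y * s + y ^ 2 * s"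
      unfolding s(2) by (simp add: power2_eq_square power3_eq_cube algebra_simps)
    also have "\<dots> \<ge> 0"
      using s(1) assms by (intro add_nonneg_nonneg) auto
    finally show ?thesis by simp
  qed
  then show ?thesis
    using assms e1 by (simp add: divide_simps mult.commute)
qed

lemma norm_planck_deriv_le:
  assumes c: "c > 0" "Re w \<ge> c * norm w" and w: "w \<noteq> 0"
  shows "norm (planck_deriv w) \<le> (1 + 2 / c ^ 2) / norm w ^ 2"
proof -
  have pos: "0 < c * norm w"
    using c w by simp
  then have Re: "Re w > 0"
    using c(2) by linarith
  have "exp (Re w) - 1 \<le> norm (exp w - 1)"
    using norm_triangle_ineq2[of "exp w" 1] by simp
  then have "norm (exp w / (exp w - 1) ^ 2) \<le> exp (Re w) / (exp (Re w) - 1) ^ 2"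
    using Re unfolding norm_divide norm_power
    by (intro frac_le power_mono) auto
  also have "\<dots> \<le> 2 / Re w ^ 2"
    by (rule exp_over_square_le[OF Re])
  also have "\<dots> \<le> 2 / (c * norm w) ^ 2"
    using c pos by (intro divide_left_mono power_mono mult_pos_pos) (auto simp: Re)
  also have "\<dots> = 2 / c ^ 2 / norm w ^ 2"
    by (simp add: power_mult_distrib)
  finally have "norm (planck_deriv w) \<le> norm (1 / w ^ 2) + 2 / c ^ 2 / norm w ^ 2"
    unfolding planck_deriv_def using norm_triangle_ineq4[of "1 / w ^ 2" "exp w / (exp w - 1) ^ 2"]
    by linarith
  then show ?thesis
    by (simp add: norm_divide norm_power add_divide_distrib)
qed

text \<open>The origin is a removable singularity: if \<open>B\<close> extends (exp w - 1) / w, then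
  \<open>planck\<close> is the difference quotient of \<open>1 / B\<close> at 0. The radius 6 is
  below 2 pi, the modulus of the nearest nonzero zeros of exp w - 1, so \<open>B\<close> does not
  vanish on \<open>S\<close>.\<close>

lemma planck_deriv_bounded_near_0:
  "\<exists>C. \<forall>w. 0 < norm w \<longrightarrow> norm w \<le> 1 \<longrightarrow> norm (planck_deriv w) \<le> C"
proof -
  define S where "S = ball (0::complex) 6"
  define B where "B = (\<lambda>w. if w = 0 then deriv exp 0 else (exp w - exp 0) / (w - 0) :: complex)"
  have d1: "deriv exp (0::complex) = 1"
    by (rule DERIV_imp_deriv) (auto intro!: derivative_eq_intros)
  have "B holomorphic_on S"
    unfolding B_def by (rule pole_lemma_open) (auto simp: S_def intro: holomorphic_intros)
  moreover have B0: "B w \<noteq> 0" if "w \<in> S" for w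
  proof
    assume "B w = 0"
    then have "w \<noteq> 0" "exp w = 1"
      by (auto simp: B_def d1 split: if_splits)
    then obtain n :: int where n: "Re w = 0" "Im w = of_int (2 * n) * pi"
      by (auto simp: exp_eq_1)
    with \<open>w \<noteq> 0\<close> have "n \<noteq> 0"
      by (auto simp: complex_eq_iff)
    then have "1 \<le> \<bar>real_of_int n\<bar>"
      by linarith
    then have "6 \<le> \<bar>real_of_int (2 * n) * pi\<bar>"
      using pi_gt3 mult_mono[of 1 "\<bar>real_of_int n\<bar>" 6 "2 * pi"] by (simp add: abs_mult)
    also have "\<dots> \<le> norm w"
      using abs_Im_le_cmod[of w] n by simp
    finally show False
      using that by (simp add: S_def)
  qed
  ultimately have "(\<lambda>w. 1 / B w) holomorphic_on S"
    by (intro holomorphic_intros)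
  define P where "P = (\<lambda>w. if w = 0 then deriv (\<lambda>w. 1 / B w) 0 else (1 / B w - 1 / B 0) / (w - 0))"
  have P: "P holomorphic_on S"
    unfolding P_def by (rule pole_lemma_open) (use \<open>(\<lambda>w. 1 / B w) holomorphic_on S\<close> in \<open>auto simp: S_def\<close>)
  have P_eq: "P w = planck w" if "w \<in> S - {0}" for w
    using that B0[of w] by (auto simp: P_def B_def planck_def d1 divide_simps)
  have "continuous_on (cball 0 1) (deriv P)"
    using P by (intro holomorphic_on_imp_continuous_on holomorphic_on_subset[OF holomorphic_deriv]) (auto simp: S_def)
  then have "bounded (deriv P ` cball 0 1)"
    by (intro compact_imp_bounded compact_continuous_image) auto
  then obtain C where C: "\<forall>w\<in>cball 0 1. norm (deriv P w) \<le> C"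
    by (auto simp: bounded_iff)
  have "deriv P w = planck_deriv w" if "0 < norm w" "norm w \<le> 1" for w
  proof -
    have w: "w \<in> S - {0}" "open (S - {0})"
      using that by (auto simp: S_def)
    have e: "exp w \<noteq> 1"
      using B0[of w] w by (auto simp: B_def)
    have "(planck has_field_derivative planck_deriv w) (at w)"
      using w e unfolding planck_def planck_deriv_def
      by (auto intro!: derivative_eq_intros simp: power2_eq_square field_simps)
    then have "(P has_field_derivative planck_deriv w) (at w)"
      by (rule has_field_derivative_transform_within_open[OF _ w(2,1)]) (simp add: P_eq)
    then show ?thesis by (rule DERIV_imp_deriv)
  qed
  moreover have "norm (deriv P w) \<le> C" if "norm w \<le> 1" for w
    using C that by simp
  ultimately have "\<forall>w. 0 < norm w \<longrightarrow> norm w \<le> 1 \<longrightarrow> norm (planck_deriv w) \<le> C"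
    by metis
  then show ?thesis ..
qed

text \<open>Boundedness near 0 and quadratic decay in the sector are merged into one Lorentzian,
  because sums of a Lorentzian over equally spaced points compare with an integral whatever the
  spacing.\<close>

lemma planck_deriv_sector_bound:
  assumes "c > 0"
  obtains C where "C \<ge> 0"
    "\<And>w. w \<noteq> 0 \<Longrightarrow> Re w \<ge> c * norm w \<Longrightarrow> norm (planck_deriv w) \<le> C / (1 + norm w ^ 2)"
proof -
  obtain C0 where C0: "\<And>w. 0 < norm w \<Longrightarrow> norm w \<le> 1 \<Longrightarrow> norm (planck_deriv w) \<le> C0"
    using planck_deriv_bounded_near_0 by blast
  define C1 where "C1 = 1 + 2 / c ^ 2"
  define C where "C = 2 * max C0 C1"
  have C1: "C1 \<ge> 0" by (auto simp: C1_def)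
  show thesis
  proof (rule that)
    show "C \<ge> 0" using C1 by (auto simp: C_def)
    fix w :: complex assume w: "w \<noteq> 0" "Re w \<ge> c * norm w"
    define r where "r = norm w"
    have r: "r > 0" using w by (simp add: r_def)
    show "norm (planck_deriv w) \<le> C / (1 + norm w ^ 2)"
    proof (cases "r \<le> 1")
      case True
      then have "r ^ 2 \<le> 1" using r by (simp add: power_le_one)
      have "norm (planck_deriv w) \<le> max C0 C1"
        using C0[of w] True r by (auto simp: r_def)
      also have "\<dots> \<le> C / (1 + r ^ 2)"
      proof -
        have "max C0 C1 * (1 + r ^ 2) \<le> max C0 C1 * 2"
          using \<open>r ^ 2 \<le> 1\<close> C1 by (intro mult_left_mono) auto
        then show ?thesis
          by (subst pos_le_divide_eq) (auto simp: C_def add_pos_nonneg mult.commute)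
      qed
      finally show ?thesis by (simp add: r_def)
    next
      case False
      then have "r ^ 2 \<ge> 1" using r by simp
      have "norm (planck_deriv w) \<le> C1 / r ^ 2"
        using norm_planck_deriv_le[OF assms w(2,1)] by (simp add: C1_def r_def)
      also have "\<dots> \<le> C / (1 + r ^ 2)"
      proof -
        have "C1 * (1 + r ^ 2) \<le> C1 * (2 * r ^ 2)"
          using \<open>r ^ 2 \<ge> 1\<close> C1 by (intro mult_left_mono) auto
        also have "\<dots> \<le> C * r ^ 2"
          by (simp add: C_def mult_right_mono)
        finally show ?thesis
          using r by (simp add: divide_simps add_pos_nonneg mult.commute)
      qed
      finally show ?thesis by (simp add: r_def)
    qed
  qed
qed

text \<open>This is the right-endpoint Riemann sum, with mesh \<open>r\<close>, of the decreasing
  function 1 / (1 + x^2). What matters is that the bound is uniform in \<open>r\<close>.\<close>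

lemma sum_Lorentz_le:
  assumes "r > (0::real)"
  shows "(\<Sum>n<N. r / (1 + (real (Suc n) * r) ^ 2)) \<le> pi / 2"
proof -
  have "r / (1 + (real (Suc n) * r) ^ 2) \<le> arctan (real (Suc n) * r) - arctan (real n * r)" for n
  proof -
    have "\<exists>z::real. real n * r < z \<and> z < real (Suc n) * r \<and>
       arctan (real (Suc n) * r) - arctan (real n * r) = (real (Suc n) * r - real n * r) * inverse (1 + z ^ 2)"
      using assms by (intro MVT2) (auto intro!: derivative_eq_intros simp: divide_inverse)
    then obtain z where z: "real n * r < z" "z < real (Suc n) * r"
       "arctan (real (Suc n) * r) - arctan (real n * r) = (real (Suc n) * r - real n * r) * inverse (1 + z ^ 2)"
      by blast
    have "0 \<le> real n * r" using assms by simp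
    then have "z > 0" using z(1) by linarith
    then have "r / (1 + (real (Suc n) * r) ^ 2) \<le> r / (1 + z ^ 2)"
      using z assms by (intro divide_left_mono add_left_mono power_mono mult_pos_pos)
        (auto intro!: add_pos_nonneg)
    also have "\<dots> = arctan (real (Suc n) * r) - arctan (real n * r)"
      unfolding z(3) by (simp add: algebra_simps divide_inverse)
    finally show ?thesis .
  qed
  then have "(\<Sum>n<N. r / (1 + (real (Suc n) * r) ^ 2))
      \<le> (\<Sum>n<N. arctan (real (Suc n) * r) - arctan (real n * r))"
    by (intro sum_mono)
  also have "\<dots> = arctan (real N * r)"
    by (simp add: sum_lessThan_telescope[of "\<lambda>n. arctan (real n * r)"] del: of_nat_Suc)
  also have "\<dots> \<le> pi / 2"
    using arctan_ubound[of "real N * r"] by simp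
  finally show ?thesis .
qed

text \<open>By the transformation law of Dedekind's eta function this equals ln (2 pi / t) / 2 + t /
  24 up to an exponentially small term as t tends to 0 in a sector. Here it is studied through its
  series in \<open>planck\<close>, which yields slow variation in ln |t| directly.\<close>

definition log_Phi_rem :: "complex \<Rightarrow> complex" where
  "log_Phi_rem t = log_Phi t + of_real (pi ^ 2 / 6) / t"

lemma log_Phi_rem_sums:
  assumes "Re t > 0"
  shows "(\<lambda>n. - planck (of_nat (Suc n) * t) / of_nat (Suc n)) sums log_Phi_rem t"
proof -
  have "(\<lambda>n. of_real (1 / (of_nat n + 1) ^ 2) :: complex) sums of_real (pi ^ 2 / 6)"
    using inverse_squares_sums by (subst sums_of_real_iff) (simp add: add.commute)
  then have "(\<lambda>n. of_real (1 / (of_nat n + 1) ^ 2) / t) sums (of_real (pi ^ 2 / 6) / t)"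
    by (rule sums_divide)
  moreover have "(\<lambda>n. - 1 / (of_nat (Suc n) * (exp (of_nat (Suc n) * t) - 1)) :: complex) sums log_Phi t"
    unfolding log_Phi_def by (rule summable_sums[OF summable_log_Phi[OF assms]])
  ultimately have "(\<lambda>n. - 1 / (of_nat (Suc n) * (exp (of_nat (Suc n) * t) - 1)) +
       of_real (1 / (of_nat n + 1) ^ 2) / t) sums log_Phi_rem t"
    unfolding log_Phi_rem_def by (intro sums_add)
  moreover have "- 1 / (of_nat (Suc n) * (exp (of_nat (Suc n) * t) - 1)) +
       of_real (1 / (of_nat n + 1) ^ 2) / t = - planck (of_nat (Suc n) * t) / of_nat (Suc n)" for n
    by (simp add: planck_def power2_eq_square diff_divide_distrib add.commute[of 1] mult_ac)
  ultimately show ?thesis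
    by simp
qed

text \<open>Differentiating the n-th term \<open>planck (n e^v w) / n\<close> in v produces a factor
  n that cancels the 1 / n. What remains is a Lorentzian sum with mesh e^v, bounded independently of
  v, so the partial sums are uniformly Lipschitz and so is their limit.\<close>

lemma log_Phi_rem_slowly_varying:
  assumes "c > 0"
  obtains C where "C \<ge> 0"
    "\<And>w x y. norm w = 1 \<Longrightarrow> Re w \<ge> c \<Longrightarrow>
       norm (log_Phi_rem (exp (of_real x) * w) - log_Phi_rem (exp (of_real y) * w)) \<le> C * \<bar>x - y\<bar>"
proof -
  obtain C where C: "C \<ge> 0"
    "\<And>w. w \<noteq> 0 \<Longrightarrow> Re w \<ge> c * norm w \<Longrightarrow> norm (planck_deriv w) \<le> C / (1 + norm w ^ 2)"
    using planck_deriv_sector_bound[OF assms] by blast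
  show thesis
  proof (rule that)
    show "C * (pi / 2) \<ge> 0" using C by simp
    fix w :: complex and x y :: real
    assume w: "norm w = 1" "Re w \<ge> c"
    have Re_pos: "Re (exp (of_real v) * w) > 0" for v :: real
      using w assms by (simp add: Re_exp exp_of_real)
    define g where "g N v = (\<Sum>n<N. - planck (of_nat (Suc n) * (exp (of_real v) * w)) / of_nat (Suc n))" for N and v :: real
    let ?D = "\<lambda>N v. \<Sum>n<N. - planck_deriv (of_nat (Suc n) * (exp (of_real v) * w)) * (exp (of_real v) * w)"
    have deriv: "(g N has_vector_derivative ?D N v) (at v)" for N v
      unfolding g_def
    proof (intro has_vector_derivative_sum)
      fix n
      have "((\<lambda>z. - planck (of_nat (Suc n) * (exp z * w)) / of_nat (Suc n)) has_field_derivative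
         - planck_deriv (of_nat (Suc n) * (exp (of_real v) * w)) * (exp (of_real v) * w)) (at (of_real v))"
      proof -
        have "Re (of_nat (Suc n) * (exp (of_real v) * w)) > 0"
          using Re_pos[of v] by (auto intro!: mult_pos_pos add_pos_nonneg simp: exp_of_real)
        from has_field_derivative_planck[OF this]
        show ?thesis
          by (auto intro!: derivative_eq_intros DERIV_chain2[where f = planck] simp del: of_nat_Suc)
      qed
      from has_vector_derivative_real_field[OF this]
      show "((\<lambda>v. - planck (of_nat (Suc n) * (exp (of_real v) * w)) / of_nat (Suc n)) has_vector_derivative
         - planck_deriv (of_nat (Suc n) * (exp (of_real v) * w)) * (exp (of_real v) * w)) (at v)"
        by (simp add: o_def)
    qed
    have bound: "norm (?D N v) \<le> C * (pi / 2)" for N v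
    proof -
      have "norm (- planck_deriv (of_nat (Suc n) * (exp (of_real v) * w)) * (exp (of_real v) * w))
         \<le> C * (exp v / (1 + (real (Suc n) * exp v) ^ 2))" for n
      proof -
        define u where "u = of_nat (Suc n) * (exp (of_real v) * w)"
        have nu: "norm u = real (Suc n) * exp v"
          using w by (simp add: u_def norm_mult exp_of_real del: of_nat_Suc)
        have "Re u = (real (Suc n) * exp v) * Re w"
          by (simp add: u_def exp_of_real)
        also have "\<dots> \<ge> (real (Suc n) * exp v) * c"
          using w by (intro mult_left_mono) auto
        finally have "norm (planck_deriv u) \<le> C / (1 + norm u ^ 2)"
          using nu by (intro C(2)) (auto simp: mult_ac simp del: of_nat_Suc)
        then have "norm (planck_deriv u) * exp v \<le> C / (1 + norm u ^ 2) * exp v"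
          by (intro mult_right_mono) auto
        then show ?thesis
          using w nu by (simp add: u_def norm_mult exp_of_real del: of_nat_Suc)
      qed
      then have "norm (?D N v)
        \<le> (\<Sum>n<N. C * (exp v / (1 + (real (Suc n) * exp v) ^ 2)))"
        by (intro order_trans[OF norm_sum] sum_mono)
      also have "\<dots> \<le> C * (pi / 2)"
        unfolding sum_distrib_left[symmetric] using C(1) sum_Lorentz_le[of "exp v" N]
        by (intro mult_left_mono) auto
      finally show ?thesis .
    qed
    have lip: "norm (g N x - g N y) \<le> C * (pi / 2) * \<bar>x - y\<bar>" for N
    proof -
      have "norm (g N x - g N y) \<le> C * (pi / 2) * norm (x - y)"
      proof (rule differentiable_bound[of UNIV "g N" "\<lambda>v h. h *\<^sub>R ?D N v"])
        show "(g N has_derivative (\<lambda>h. h *\<^sub>R ?D N v)) (at v within UNIV)" for v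
          using deriv[of N v] by (simp add: has_vector_derivative_def)
        show "onorm (\<lambda>h. h *\<^sub>R ?D N v) \<le> C * (pi / 2)" for v
          by (intro onorm_le) (metis bound norm_scaleR mult.commute mult_right_mono norm_ge_zero real_norm_def)
      qed auto
      then show ?thesis by simp
    qed
    have "(\<lambda>N. g N v) \<longlonglongrightarrow> log_Phi_rem (exp (of_real v) * w)" for v
      using log_Phi_rem_sums[OF Re_pos[of v]] unfolding g_def sums_def .
    then have "(\<lambda>N. norm (g N x - g N y)) \<longlonglongrightarrow> norm (log_Phi_rem (exp (of_real x) * w) - log_Phi_rem (exp (of_real y) * w))"
      by (intro tendsto_intros)
    then show "norm (log_Phi_rem (exp (of_real x) * w) - log_Phi_rem (exp (of_real y) * w)) \<le> C * (pi / 2) * \<bar>x - y\<bar>"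
      by (rule Lim_bounded) (use lip in auto)
  qed
qed

section \<open>Decay in sectors\<close>

definition damped_Phi :: "nat \<Rightarrow> complex \<Rightarrow> complex" where
  "damped_Phi k t = exp (- t) * Phi (exp (- t)) ^ k"

lemma damped_Phi_eq_log_Phi:
  assumes "Re t > 0"
  shows "damped_Phi k t = exp (- t + of_nat k * log_Phi t)"
  unfolding damped_Phi_def Phi_exp_minus[OF assms] by (simp only: exp_add exp_of_nat_mult)

lemma damped_Phi_eq:
  assumes "Re t > 0"
  shows "damped_Phi k t = exp (- t - of_real (real k * pi ^ 2 / 6) / t + of_nat k * log_Phi_rem t)"
  unfolding damped_Phi_eq_log_Phi[OF assms] log_Phi_rem_def
  by (rule arg_cong[of _ _ exp]) (simp add: algebra_simps)

lemma holomorphic_damped_Phi: "damped_Phi k holomorphic_on {t. Re t > 0}"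
proof -
  have "(\<lambda>t. exp (- t + of_nat k * log_Phi t)) holomorphic_on {t. Re t > 0}"
    by (intro holomorphic_intros holomorphic_log_Phi)
  then show ?thesis
    by (rule holomorphic_transform) (simp add: damped_Phi_eq_log_Phi)
qed

lemma damped_Phi_pos:
  assumes "x > 0"
  shows "damped_Phi k (of_real x) \<in> \<real>" "Re (damped_Phi k (of_real x)) > 0"
proof -
  have eq: "- 1 / (of_nat (Suc n) * (exp (of_nat (Suc n) * of_real x) - 1))
      = (of_real (- 1 / (real (Suc n) * (exp (real (Suc n) * x) - 1))) :: complex)" for n
    by (simp add: exp_of_real [symmetric] del: of_nat_Suc)
  have "summable (\<lambda>n. - 1 / (of_nat (Suc n) * (exp (of_nat (Suc n) * of_real x) - 1)) :: complex)"
    using assms by (intro summable_log_Phi) simp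
  then have "log_Phi (of_real x) = of_real (\<Sum>n. - 1 / (real (Suc n) * (exp (real (Suc n) * x) - 1)))"
    unfolding log_Phi_def eq by (subst suminf_of_real) (simp_all only: summable_of_real_iff)
  then obtain y where y: "log_Phi (of_real x) = of_real y"
    by blast
  have "damped_Phi k (of_real x) = of_real (exp (- x + real k * y))"
    using assms by (subst damped_Phi_eq_log_Phi) (simp_all add: y exp_of_real [symmetric])
  then show "damped_Phi k (of_real x) \<in> \<real>" "Re (damped_Phi k (of_real x)) > 0"
    by simp_all
qed

text \<open>The inequality ln x \<le> x - 1 at x = r e / p bounds ln r, and the same bound at 1 / r
  takes care of - ln r. It serves to absorb the logarithmic growth of the remainder into the
  exponential decay.\<close>

lemma abs_ln_le:
  fixes p e :: real
  assumes "p \<ge> 0" "e > 0"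
  obtains M where "M \<ge> 0" "\<And>r. r > 0 \<Longrightarrow> p * \<bar>ln r\<bar> \<le> M + e * (r + 1 / r)"
proof (cases "p = 0")
  case True
  then show ?thesis using assms by (intro that[of 0]) auto
next
  case False
  with assms have p: "p > 0" by simp
  have *: "p * ln r \<le> e * r + p * \<bar>ln (p / e)\<bar>" if "r > 0" for r
  proof -
    have "ln r = ln (r * (e / p)) + ln (p / e)"
      using that p assms by (simp add: ln_mult ln_div)
    also have "\<dots> \<le> r * (e / p) + \<bar>ln (p / e)\<bar>"
      using that p assms ln_le_minus_one[of "r * (e / p)"] by simp
    finally have "p * ln r \<le> p * (r * (e / p) + \<bar>ln (p / e)\<bar>)"
      using p by (intro mult_left_mono) auto
    also have "\<dots> = e * r + p * \<bar>ln (p / e)\<bar>"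
      using p by (simp add: ring_distribs)
    finally show ?thesis .
  qed
  show ?thesis
  proof (rule that)
    show "p * \<bar>ln (p / e)\<bar> \<ge> 0" using p by simp
    fix r :: real assume r: "r > 0"
    have "e * r \<ge> 0" "e / r \<ge> 0" using r assms by auto
    then show "p * \<bar>ln r\<bar> \<le> p * \<bar>ln (p / e)\<bar> + e * (r + 1 / r)"
      using *[of r] *[of "1 / r"] r
      by (cases "ln r \<ge> 0") (simp_all add: ln_div distrib_left)
  qed
qed

lemma sector_polar:
  assumes "t \<noteq> 0" "Re t \<ge> c * norm t"
  defines "w \<equiv> t / of_real (norm t)"
  shows "norm w = 1" "Re w \<ge> c" "t = exp (of_real (ln (norm t))) * w"
proof -
  have n: "norm t > 0" using assms by simp
  then show "norm w = 1" "Re w \<ge> c"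
    using assms by (simp_all add: norm_divide Re_divide_of_real pos_le_divide_eq)
  have "exp (of_real (ln (norm t))) = (of_real (norm t) :: complex)"
    using n by (simp add: exp_of_real)
  then show "t = exp (of_real (ln (norm t))) * w"
    using n by (simp add: w_def)
qed

text \<open>The unit arc inside the sector is compact, so the remainder is bounded there; slow
  variation transports this bound along each ray to modulus |t| at a cost proportional to the
  distance |ln |t||.\<close>

lemma log_Phi_rem_sector_bound:
  assumes "c > 0"
  obtains C where "C \<ge> 0"
    "\<And>t. t \<noteq> 0 \<Longrightarrow> Re t \<ge> c * norm t \<Longrightarrow> norm (log_Phi_rem t) \<le> C * (1 + \<bar>ln (norm t)\<bar>)"
proof -
  obtain C where C: "C \<ge> 0"
    "\<And>w x y. norm w = 1 \<Longrightarrow> Re w \<ge> c \<Longrightarrow>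
       norm (log_Phi_rem (exp (of_real x) * w) - log_Phi_rem (exp (of_real y) * w)) \<le> C * \<bar>x - y\<bar>"
    using log_Phi_rem_slowly_varying[OF assms] by blast
  define S where "S = {w. norm w = 1 \<and> Re w \<ge> c}"
  have "S = sphere 0 1 \<inter> {w. Re w \<ge> c}"
    by (auto simp: S_def)
  then have "compact S"
    by (metis compact_Int_closed compact_sphere closed_halfspace_Re_ge)
  moreover have "continuous_on S log_Phi_rem"
    unfolding log_Phi_rem_def using assms
    by (intro continuous_intros holomorphic_on_imp_continuous_on holomorphic_on_subset[OF holomorphic_log_Phi])
       (auto simp: S_def)
  ultimately have "bounded (log_Phi_rem ` S)"
    by (intro compact_imp_bounded compact_continuous_image)
  then obtain B where B: "\<forall>w\<in>S. norm (log_Phi_rem w) \<le> B"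
    by (auto simp: bounded_iff)
  define D where "D = max C (max B 0)"
  show thesis
  proof (rule that[of D])
    show "D \<ge> 0" by (simp add: D_def)
    fix t :: complex assume t: "t \<noteq> 0" "Re t \<ge> c * norm t"
    define w where "w = t / of_real (norm t)"
    note w = sector_polar[OF t, folded w_def]
    have "norm (log_Phi_rem t) \<le> norm (log_Phi_rem t - log_Phi_rem w) + norm (log_Phi_rem w)"
      using norm_triangle_sub[of "log_Phi_rem t" "log_Phi_rem w"] by simp
    also have "norm (log_Phi_rem t - log_Phi_rem w) \<le> C * \<bar>ln (norm t)\<bar>"
      using C(2)[OF w(1,2), of "ln (norm t)" 0] w(3) by simp
    also have "norm (log_Phi_rem w) \<le> B"
      using B w by (auto simp: S_def)
    also have "C * \<bar>ln (norm t)\<bar> + B \<le> D * \<bar>ln (norm t)\<bar> + D"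
      by (intro add_mono mult_right_mono) (auto simp: D_def)
    finally show "norm (log_Phi_rem t) \<le> D * (1 + \<bar>ln (norm t)\<bar>)"
      by (simp add: ring_distribs)
  qed
qed

lemma damped_Phi_exponent_ge_1:
  assumes "k \<ge> 1"
  shows "1 \<le> real k * pi ^ 2 / 6"
proof -
  have "3 ^ 2 \<le> pi ^ 2" using pi_gt3 by (intro power_mono) auto
  then show ?thesis
    using assms mult_mono[of 1 "real k" 6 "pi ^ 2"] by simp
qed

text \<open>The factor exp (- t) gives the decay at infinity and exp (- A / t), with A \<ge> 1, the
  decay at 0; in the sector the exponents have real parts comparable to their moduli.\<close>

lemma damped_Phi_sector_bound:
  assumes "c > 0" "k \<ge> 1"
  obtains K e where "K > 0" "e > 0"
    "\<And>t. t \<noteq> 0 \<Longrightarrow> Re t \<ge> c * norm t \<Longrightarrow> norm (damped_Phi k t) \<le> K * exp (- e * (norm t + 1 / norm t))"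
proof -
  obtain C where C: "C \<ge> 0"
    "\<And>t. t \<noteq> 0 \<Longrightarrow> Re t \<ge> c * norm t \<Longrightarrow> norm (log_Phi_rem t) \<le> C * (1 + \<bar>ln (norm t)\<bar>)"
    using log_Phi_rem_sector_bound[OF assms(1)] by blast
  \<comment> \<open>Half of the rate c pays for the logarithm in the remainder, the other half
    survives.\<close>
  define e where "e = c / 2"
  have e: "e > 0" using assms by (simp add: e_def)
  obtain M where M: "M \<ge> 0" "\<And>r. r > 0 \<Longrightarrow> real k * C * \<bar>ln r\<bar> \<le> M + e * (r + 1 / r)"
    using abs_ln_le[of "real k * C" e] C e by auto
  define K where "K = exp (real k * C + M)"
  show thesis
  proof (rule that[of K e])
    show "K > 0" by (simp add: K_def)
    show "e > 0" by fact
    fix t :: complex assume t: "t \<noteq> 0" "Re t \<ge> c * norm t"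
    define r where "r = norm t"
    have r: "r > 0" using t by (simp add: r_def)
    have "c * r > 0" using r assms by simp
    with t have Re: "Re t > 0" by (simp add: r_def)
    have "Re (of_real (real k * pi ^ 2 / 6) / t) = (real k * pi ^ 2 / 6) * (Re t / r ^ 2)"
      by (simp add: Re_divide' r_def)
    also have "\<dots> \<ge> 1 * (c * r / r ^ 2)"
      using t r assms by (intro mult_mono divide_right_mono damped_Phi_exponent_ge_1) (auto simp: r_def)
    finally have A: "c / r \<le> Re (of_real (real k * pi ^ 2 / 6) / t)"
      using r by (simp add: power2_eq_square)
    have "real k * Re (log_Phi_rem t) \<le> real k * (C * (1 + \<bar>ln r\<bar>))"
      using C(2)[OF t] complex_Re_le_cmod[of "log_Phi_rem t"] by (intro mult_left_mono) (auto simp: r_def)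
    also have "\<dots> \<le> real k * C + M + e * (r + 1 / r)"
      using M(2)[OF r] by (simp add: algebra_simps)
    finally have B: "real k * Re (log_Phi_rem t) \<le> real k * C + M + e * (r + 1 / r)" .
    have "norm (damped_Phi k t) = exp (- Re t - Re (of_real (real k * pi ^ 2 / 6) / t) + real k * Re (log_Phi_rem t))"
      unfolding damped_Phi_eq[OF Re] norm_exp_eq_Re by simp
    also have "\<dots> \<le> exp (- (c * r) - c / r + (real k * C + M + e * (r + 1 / r)))"
      using t A B by (subst exp_le_cancel_iff) (simp add: r_def)
    also have "- (c * r) - c / r + (real k * C + M + e * (r + 1 / r)) = real k * C + M - e * (r + 1 / r)"
    proof -
      have "c = 2 * e" by (simp add: e_def)
      then show ?thesis by (simp add: ring_distribs)
    qed
    also have "exp \<dots> = K * exp (- e * (norm t + 1 / norm t))"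
      by (simp add: K_def r_def mult_exp_exp)
    finally show "norm (damped_Phi k t) \<le> K * exp (- e * (norm t + 1 / norm t))" .
  qed
qed

section \<open>Integrals along rays\<close>

text \<open>The parameter is the logarithm of the modulus up to a shift, so both ends of the ray lie
  at infinity and dilations become translations. The parametrisation is its own derivative, which
  explains the factor \<open>ray p v\<close> in \<open>ray_integral\<close>.\<close>

definition ray :: "complex \<Rightarrow> real \<Rightarrow> complex" where
  "ray p v = of_real (exp v) * p"

definition ray_integral :: "complex \<Rightarrow> (complex \<Rightarrow> complex) \<Rightarrow> complex" where
  "ray_integral p f = (\<integral>v. f (ray p v) * ray p v \<partial>lborel)"

lemma norm_ray [simp]: "norm (ray p v) = exp v * norm p"
  by (simp add: ray_def norm_mult)

lemma has_vector_derivative_ray: "(ray p has_vector_derivative ray p v) (at v within S)"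
  unfolding ray_def by (auto intro!: derivative_eq_intros has_vector_derivative_mult_left has_vector_derivative_of_real simp flip: has_real_derivative_iff_has_vector_derivative)

lemma continuous_on_ray [continuous_intros]: "continuous_on S (ray p)"
  unfolding ray_def by (intro continuous_intros)

text \<open>The endpoints are arbitrary sequences because the residue argument prescribes its own
  cuts: the outer ones have to pass midway between two poles.\<close>

lemma ray_tendsto_primitive:
  fixes f P :: "complex \<Rightarrow> complex"
  assumes deriv: "\<And>v. (P has_field_derivative f (ray p v)) (at (ray p v))"
    and cont: "continuous_on UNIV (\<lambda>v. f (ray p v))"
    and int: "integrable lborel (\<lambda>v. f (ray p v) * ray p v)"
    and a: "filterlim a at_bot sequentially" and b: "filterlim b at_top sequentially"
  shows "(\<lambda>n. P (ray p (b n)) - P (ray p (a n))) \<longlonglongrightarrow> ray_integral p f"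
proof -
  let ?f = "\<lambda>v. f (ray p v) * ray p v"
  have "(\<lambda>n. \<integral>v. indicator {a n..b n} v *\<^sub>R ?f v \<partial>lborel) \<longlonglongrightarrow> (\<integral>v. ?f v \<partial>lborel)"
  proof (rule integral_dominated_convergence[where w = "\<lambda>v. norm (?f v)"])
    show "?f \<in> borel_measurable lborel"
      using int by auto
    then show "(\<lambda>v. indicator {a n..b n} v *\<^sub>R ?f v) \<in> borel_measurable lborel" for n
      by measurable
    show "AE v in lborel. (\<lambda>n. indicator {a n..b n} v *\<^sub>R ?f v) \<longlonglongrightarrow> ?f v"
    proof (intro AE_I2 tendsto_eventually)
      fix v
      have "eventually (\<lambda>n. a n \<le> v) sequentially" "eventually (\<lambda>n. v \<le> b n) sequentially"
        using a b by (auto simp: filterlim_at_bot filterlim_at_top)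
      then show "eventually (\<lambda>n. indicator {a n..b n} v *\<^sub>R ?f v = ?f v) sequentially"
        by eventually_elim simp
    qed
    show "AE v in lborel. norm (indicator {a n..b n} v *\<^sub>R ?f v) \<le> norm (?f v)" for n
      by (intro AE_I2) (auto simp: indicator_def)
  qed (use int in auto)
  moreover have "eventually (\<lambda>n. a n \<le> b n) sequentially"
  proof -
    have "eventually (\<lambda>n. a n \<le> 0) sequentially" "eventually (\<lambda>n. 0 \<le> b n) sequentially"
      using a b by (auto simp: filterlim_at_bot filterlim_at_top)
    then show ?thesis by eventually_elim simp
  qed
  then have "eventually (\<lambda>n. (\<integral>v. indicator {a n..b n} v *\<^sub>R ?f v \<partial>lborel)
      = P (ray p (b n)) - P (ray p (a n))) sequentially"
  proof eventually_elim
    case (elim n)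
    show ?case
    proof (rule integral_FTC_Icc[OF elim])
      show "((\<lambda>v. P (ray p v)) has_vector_derivative ?f v) (at v within {a n..b n})" for v
        using field_vector_diff_chain_within[OF has_vector_derivative_ray has_field_derivative_at_within[OF deriv]]
        by (simp add: o_def mult.commute)
      show "continuous_on {a n..b n} ?f"
        by (intro continuous_intros continuous_on_subset[OF cont]) auto
    qed
  qed
  ultimately show ?thesis
    unfolding ray_integral_def by (rule Lim_transform_eventually)
qed

section \<open>Positivity and Gaussian majorants in the logarithmic coordinate\<close>

lemma lborel_integral_pos:
  fixes f :: "real \<Rightarrow> real"
  assumes "integrable lborel f" "\<And>x. f x > 0"
  shows "(\<integral>x. f x \<partial>lborel) > 0"
proof -
  have "(\<integral>x. f x \<partial>lborel) \<noteq> 0"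
  proof
    assume "(\<integral>x. f x \<partial>lborel) = 0"
    then have "AE x in lborel. f x = 0"
      using assms by (subst (asm) integral_nonneg_eq_0_iff_AE) (auto intro: less_imp_le)
    then have "AE x :: real in lborel. False"
      by eventually_elim (use assms(2) in \<open>simp add: less_le\<close>)
    then show False
      by (simp add: eventually_False trivial_limit_def[symmetric] ae_filter_eq_bot_iff)
  qed
  moreover have "(\<integral>x. f x \<partial>lborel) \<ge> 0"
    using assms(2) by (intro integral_nonneg_AE) (auto intro: less_imp_le)
  ultimately show ?thesis by simp
qed

text \<open>Completing the square against half of the quadratic term leaves exp (- e v^2 / 2), a
  multiple of the normal density with variance 1 / e.\<close>

lemma integrable_exp_abs_square:
  fixes m e :: real
  assumes "e > 0"
  shows "integrable lborel (\<lambda>v. exp (m * \<bar>v\<bar> - e * v ^ 2))"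
proof -
  define s where "s = 1 / sqrt e"
  have s: "s > 0" "s ^ 2 = 1 / e" using assms by (simp_all add: s_def power_divide)
  have "integrable lborel (\<lambda>v. exp (m ^ 2 / (2 * e)) * (sqrt (2 * pi * s ^ 2) * normal_density 0 s v))"
    using s by (intro integrable_mult_right integrable_normal_density)
  then show ?thesis
  proof (rule Bochner_Integration.integrable_bound)
    show "(\<lambda>v. exp (m * \<bar>v\<bar> - e * v ^ 2)) \<in> borel_measurable lborel"
      by measurable
    show "AE v in lborel. norm (exp (m * \<bar>v\<bar> - e * v ^ 2)) \<le>
       norm (exp (m ^ 2 / (2 * e)) * (sqrt (2 * pi * s ^ 2) * normal_density 0 s v))"
    proof (intro AE_I2)
      fix v :: real
      have "0 \<le> (e * \<bar>v\<bar> - m) ^ 2 / (2 * e)"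
        using assms by simp
      also have "\<dots> = e * v ^ 2 / 2 - m * \<bar>v\<bar> + m ^ 2 / (2 * e)"
        using assms by (simp add: power2_diff power_mult_distrib field_simps power2_eq_square)
      finally have le: "m * \<bar>v\<bar> - e * v ^ 2 \<le> m ^ 2 / (2 * e) - e * v ^ 2 / 2"
        by (simp add: field_simps)
      have "sqrt (2 * pi * s ^ 2) * normal_density 0 s v = exp (- (e * v ^ 2 / 2))"
        using s assms by (simp add: normal_density_def)
      then show "norm (exp (m * \<bar>v\<bar> - e * v ^ 2)) \<le>
         norm (exp (m ^ 2 / (2 * e)) * (sqrt (2 * pi * s ^ 2) * normal_density 0 s v))"
        using le by (simp add: mult_exp_exp)
    qed
  qed
qed

text \<open>The fourth-order Taylor remainder is nonnegative for either sign of the argument, and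
  the odd terms cancel between v and - v. This turns decay in r + 1 / r into Gaussian decay in ln
  r.\<close>

lemma exp_plus_inverse_ge: "exp v + 1 / exp v \<ge> 2 + (v::real) ^ 2"
proof -
  have "exp w \<ge> 1 + w + w ^ 2 / 2 + w ^ 3 / 6" for w :: real
  proof -
    obtain t where t: "\<bar>t\<bar> \<le> \<bar>w\<bar>" "exp w = (\<Sum>m<4. w ^ m / fact m) + exp t / fact 4 * w ^ 4"
      using Maclaurin_exp_le[of w 4] by blast
    have "exp t / fact 4 * w ^ 4 \<ge> 0"
      by (intro mult_nonneg_nonneg) auto
    then show ?thesis
      unfolding t(2) by (simp add: eval_nat_numeral fact_numeral)
  qed
  from this[of v] this[of "- v"] show ?thesis
    by (simp add: exp_minus inverse_eq_divide)
qed

lemma exp_minus_add_inverse_le: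
  fixes e r :: real
  assumes "e \<ge> 0" "c > 0"
  shows "exp (- e * (exp v * c + 1 / (exp v * c))) \<le> exp (- e * (v + ln c) ^ 2)"
proof -
  have "exp v * c = exp (v + ln c)"
    using assms by (simp add: exp_add)
  moreover have "e * (v + ln c) ^ 2 \<le> e * (exp (v + ln c) + 1 / exp (v + ln c))"
    using exp_plus_inverse_ge[of "v + ln c"] assms by (intro mult_left_mono) auto
  ultimately show ?thesis
    by simp
qed

text \<open>In the logarithmic coordinate the two-sided decay is Gaussian and beats exp (m |v|),
  which allows for the growth of the summation kernel near 0, as well as the factor |ray p
  v|.\<close>

lemma integrable_ray:
  fixes f :: "complex \<Rightarrow> complex"
  assumes cont: "continuous_on UNIV (\<lambda>v. f (ray p v))"
    and bound: "\<And>v. norm (f (ray p v)) \<le> K * (exp (m * \<bar>v\<bar>) * exp (- e * (exp v * c + 1 / (exp v * c))))"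
    and e: "e > 0" "c > 0"
  shows "integrable lborel (\<lambda>v. f (ray p v) * ray p v)"
proof -
  define m' where "m' = \<bar>m\<bar> + 1 + 2 * e * \<bar>ln c\<bar>"
  have "K \<ge> 0"
    using order_trans[OF norm_ge_zero bound[of 0]] by (simp add: zero_le_mult_iff)
  have "integrable lborel (\<lambda>v. K * norm p * exp (m' * \<bar>v\<bar> - e * v ^ 2))"
    using e by (intro integrable_mult_right integrable_exp_abs_square)
  then show ?thesis
  proof (rule Bochner_Integration.integrable_bound)
    have "continuous_on UNIV (\<lambda>v. f (ray p v) * ray p v)"
      by (intro continuous_intros cont)
    then show "(\<lambda>v. f (ray p v) * ray p v) \<in> borel_measurable lborel"
      by (simp add: borel_measurable_continuous_onI)
    show "AE v in lborel. norm (f (ray p v) * ray p v) \<le> norm (K * norm p * exp (m' * \<bar>v\<bar> - e * v ^ 2))"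
    proof (intro AE_I2)
      fix v :: real
      have "exp (- e * (exp v * c + 1 / (exp v * c))) \<le> exp (- e * (v + ln c) ^ 2)"
        using e by (intro exp_minus_add_inverse_le) auto
      also have "\<dots> \<le> exp (2 * e * \<bar>ln c\<bar> * \<bar>v\<bar> - e * v ^ 2)"
      proof -
        have "e * (- (v * ln c)) \<le> e * \<bar>v * ln c\<bar>"
          using e by (intro mult_left_mono) auto
        moreover have "e * (ln c) ^ 2 \<ge> 0"
          using e by simp
        ultimately show ?thesis
          by (simp add: power2_sum algebra_simps abs_mult)
      qed
      finally have "norm (f (ray p v)) \<le> K * (exp (m * \<bar>v\<bar>) * exp (2 * e * \<bar>ln c\<bar> * \<bar>v\<bar> - e * v ^ 2))"
        using \<open>K \<ge> 0\<close> by (intro order_trans[OF bound] mult_left_mono) auto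
      then have "norm (f (ray p v) * ray p v) \<le>
          K * (exp (m * \<bar>v\<bar>) * exp (2 * e * \<bar>ln c\<bar> * \<bar>v\<bar> - e * v ^ 2)) * (exp v * norm p)"
        unfolding norm_mult[of _ "ray p v"] norm_ray by (intro mult_right_mono) auto
      also have "\<dots> = K * norm p * exp (m * \<bar>v\<bar> + v + 2 * e * \<bar>ln c\<bar> * \<bar>v\<bar> - e * v ^ 2)"
        by (simp add: exp_add exp_diff)
      also have "\<dots> \<le> K * norm p * exp (m' * \<bar>v\<bar> - e * v ^ 2)"
      proof (intro mult_left_mono)
        have "m * \<bar>v\<bar> \<le> \<bar>m\<bar> * \<bar>v\<bar>"
          by (intro mult_right_mono) auto
        then show "exp (m * \<bar>v\<bar> + v + 2 * e * \<bar>ln c\<bar> * \<bar>v\<bar> - e * v ^ 2) \<le> exp (m' * \<bar>v\<bar> - e * v ^ 2)"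
          by (simp add: m'_def algebra_simps)
      qed (use \<open>K \<ge> 0\<close> in auto)
      also have "\<dots> \<le> norm \<dots>"
        by simp
      finally show "norm (f (ray p v) * ray p v) \<le> norm (K * norm p * exp (m' * \<bar>v\<bar> - e * v ^ 2))" .
    qed
  qed
qed

lemma norm_primitive_diff_le:
  fixes f P :: "complex \<Rightarrow> complex"
  assumes "\<And>s. s \<in> closed_segment a b \<Longrightarrow> (P has_field_derivative f s) (at s)"
    and "\<And>s. s \<in> closed_segment a b \<Longrightarrow> norm (f s) \<le> B"
  shows "norm (P a - P b) \<le> B * norm (a - b)"
  by (rule field_differentiable_bound[where S = "closed_segment a b" and f' = f])
     (use assms in \<open>auto intro: has_field_derivative_at_within\<close>)

text \<open>Both ray integrals are limits of differences of one primitive on the half-plane. Points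
  of the two rays with the same parameter are joined by a chord on which Re s \<ge> c e^v and |s|
  \<le> e^v; the decay of f makes the change of the primitive along it vanish at both ends.\<close>

lemma ray_integral_rotate:
  fixes f :: "complex \<Rightarrow> complex"
  assumes holo: "f holomorphic_on {t. Re t > 0}"
    and bound: "\<And>t. t \<noteq> 0 \<Longrightarrow> Re t \<ge> c * norm t \<Longrightarrow> norm (f t) \<le> K * exp (- e * (norm t + 1 / norm t))"
    and c: "c > 0" and e: "e > 0"
    and p: "norm p = 1" "Re p \<ge> c" and q: "norm q = 1" "Re q \<ge> c"
  shows "ray_integral p f = ray_integral q f"
proof -
  obtain P where P: "\<And>t. Re t > 0 \<Longrightarrow> (P has_field_derivative f t) (at t)"
    using holomorphic_convex_primitive'[OF convex_halfspace_Re_gt open_halfspace_Re_gt holo]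
    by (metis at_within_open mem_Collect_eq open_halfspace_Re_gt)
  have Re_ray: "Re (ray w v) \<ge> c * norm (ray w v)" "Re (ray w v) > 0" "ray w v \<noteq> 0"
    if "norm w = 1" "Re w \<ge> c" for w v
    using that c by (auto simp: ray_def norm_mult)
  have conv: "(\<lambda>n. P (ray w (real n)) - P (ray w (- real n))) \<longlonglongrightarrow> ray_integral w f"
    if w: "norm w = 1" "Re w \<ge> c" for w
  proof (rule ray_tendsto_primitive)
    show "(P has_field_derivative f (ray w v)) (at (ray w v))" for v
      by (rule P[OF Re_ray(2)[OF w]])
    show cont: "continuous_on UNIV (\<lambda>v. f (ray w v))"
      by (rule continuous_on_compose2[OF holomorphic_on_imp_continuous_on[OF holo] continuous_on_ray])
         (use Re_ray(2)[OF w] in auto)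
    show "integrable lborel (\<lambda>v. f (ray w v) * ray w v)"
      by (rule integrable_ray[OF cont, where K = K and m = 0 and e = e and c = 1])
         (use bound[OF Re_ray(3,1)[OF w]] w e in auto)
    show "filterlim real at_top sequentially" "filterlim (\<lambda>n. - real n) at_bot sequentially"
      by real_asymp+
  qed
  define D where "D v = P (ray p v) - P (ray q v)" for v
  have K: "K \<ge> 0"
    using order_trans[OF norm_ge_zero bound[of 1]] c p complex_Re_le_cmod[of p] by (simp add: zero_le_mult_iff)
  have D: "norm (D v) \<le> K * exp (- e * (c * exp v + exp (- v))) * (2 * exp v)" for v
  proof -
    have *: "Re s \<ge> c * exp v \<and> norm s \<le> exp v" if s: "s \<in> closed_segment (ray p v) (ray q v)" for s
    proof -
      obtain u where u: "0 \<le> u" "u \<le> 1" "s = (1 - u) *\<^sub>R ray p v + u *\<^sub>R ray q v"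
        using s unfolding in_segment by blast
      have "Re s = exp v * ((1 - u) * Re p + u * Re q)"
        by (simp add: u ray_def algebra_simps)
      also have "\<dots> \<ge> exp v * ((1 - u) * c + u * c)"
        using u p q by (intro mult_left_mono add_mono) auto
      finally have "Re s \<ge> c * exp v"
        by (simp add: algebra_simps)
      moreover have "norm s \<le> (1 - u) * exp v + u * exp v"
        unfolding u(3) using u p q by (intro order_trans[OF norm_triangle_ineq]) (simp add: norm_mult)
      ultimately show ?thesis
        by (simp add: algebra_simps)
    qed
    have "norm (D v) \<le> K * exp (- e * (c * exp v + exp (- v))) * norm (ray p v - ray q v)"
      unfolding D_def
    proof (rule norm_primitive_diff_le)
      fix s assume "s \<in> closed_segment (ray p v) (ray q v)"
      note s = *[OF this]
      have cv: "c * exp v > 0" using c by simp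
      then have s0: "Re s > 0" "s \<noteq> 0" using s by (auto intro: less_le_trans)
      then show "(P has_field_derivative f s) (at s)" by (intro P)
      have "c * norm s \<le> c * exp v"
        using s c by (intro mult_left_mono) auto
      then have "norm (f s) \<le> K * exp (- e * (norm s + 1 / norm s))"
        using s s0 by (intro bound) auto
      also have "\<dots> \<le> K * exp (- e * (c * exp v + exp (- v)))"
      proof -
        have "c * exp v \<le> norm s"
          using s complex_Re_le_cmod[of s] by linarith
        moreover have "exp (- v) \<le> 1 / norm s"
          using s s0 by (simp add: exp_minus divide_simps)
        ultimately show ?thesis
          using K e by (intro mult_left_mono) auto
      qed
      finally show "norm (f s) \<le> K * exp (- e * (c * exp v + exp (- v)))" .
    qed
    also have "\<dots> \<le> K * exp (- e * (c * exp v + exp (- v))) * (2 * exp v)"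
      using K norm_triangle_ineq4[of "ray p v" "ray q v"] p q by (intro mult_left_mono) auto
    finally show ?thesis .
  qed
  have lim1: "((\<lambda>v. K * exp (- e * (c * exp v + exp (- v))) * (2 * exp v)) \<longlongrightarrow> 0) at_top"
    using c e by real_asymp
  have lim2: "((\<lambda>v. K * exp (- e * (c * exp v + exp (- v))) * (2 * exp v)) \<longlongrightarrow> 0) at_bot"
    using c e by real_asymp
  have D_lim: "(D \<longlongrightarrow> 0) at_top" "(D \<longlongrightarrow> 0) at_bot"
    using Lim_null_comparison[OF _ lim1, of D] Lim_null_comparison[OF _ lim2, of D] D by auto
  have "(\<lambda>n. D (real n)) \<longlonglongrightarrow> 0" "(\<lambda>n. D (- real n)) \<longlonglongrightarrow> 0"
    by (rule filterlim_compose[OF D_lim(1)] filterlim_compose[OF D_lim(2)], real_asymp)+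
  then have "(\<lambda>n. D (real n) - D (- real n)) \<longlonglongrightarrow> 0 - 0"
    by (rule tendsto_diff)
  moreover have "(\<lambda>n. D (real n) - D (- real n)) \<longlonglongrightarrow> ray_integral p f - ray_integral q f"
    using tendsto_diff[OF conv[OF p] conv[OF q]] by (simp add: D_def algebra_simps)
  ultimately show ?thesis
    using LIMSEQ_unique by fastforce
qed

section \<open>The interpolating kernel\<close>

lemma sin_pi_ge:
  fixes y :: real
  assumes "0 \<le> y" "y \<le> 1"
  shows "sin (pi * y) \<ge> 2 * min y (1 - y)"
proof -
  have *: "sin (pi * y) \<ge> 2 * y" if y: "0 \<le> y" "y \<le> 1 / 2" for y :: real
  proof -
    have "concave_on {0..pi/2} sin"
      unfolding concave_on_def
    proof (rule f''_ge0_imp_convex)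
      show "DERIV (\<lambda>x. - sin x) x :> - cos x" for x :: real
        by (auto intro!: derivative_eq_intros)
      show "DERIV (\<lambda>x. - cos x) x :> sin x" for x :: real
        by (auto intro!: derivative_eq_intros)
      show "0 \<le> sin x" if "x \<in> {0..pi/2}" for x :: real
        using that pi_gt_zero by (intro sin_ge_zero) auto
    qed auto
    from concave_onD[OF this, of "2 * y" 0 "pi / 2"] y
    show ?thesis by (simp add: mult.commute)
  qed
  show ?thesis
  proof (cases "y \<le> 1 / 2")
    case True
    then show ?thesis using *[of y] assms by auto
  next
    case False
    have "sin (pi * (1 - y)) = sin (pi * y)"
      by (simp add: right_diff_distrib sin_diff)
    with False show ?thesis using *[of "1 - y"] assms by auto
  qed
qed

text \<open>Its poles are simple and lie at \<rho> + a n for integers n, with residue - a / (2 pi i)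
  times z^n where z = cis (2 pi \<theta>). It behaves like exp (- 2 pi \<theta> |Im u| / a) far
  above the axis and like exp (- 2 pi (1 - \<theta>) |Im u| / a) far below.\<close>

definition lattice_kernel :: "real \<Rightarrow> real \<Rightarrow> real \<Rightarrow> complex \<Rightarrow> complex" where
  "lattice_kernel \<theta> a \<rho> u =
     exp (2 * of_real pi * \<i> * of_real \<theta> * (u - of_real \<rho>) / of_real a) /
     (1 - exp (2 * of_real pi * \<i> * (u - of_real \<rho>) / of_real a))"

text \<open>This controls the kernel on vertical lines that pass between the poles, uniformly in the
  height. The product form also covers the poles themselves, where the quotient takes the default
  value 0.\<close>

lemma norm_lattice_kernel_sin_le:
  assumes "0 \<le> \<theta>" "\<theta> \<le> 1" "a > 0"
  shows "norm (lattice_kernel \<theta> a \<rho> u) * \<bar>sin (pi * (Re u - \<rho>) / a)\<bar> \<le> 1"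
proof -
  define y where "y = - (2 * pi * Im u / a)"
  define w where "w = exp (2 * of_real pi * \<i> * (u - of_real \<rho>) / of_real a)"
  define s where "s = sin (pi * (Re u - \<rho>) / a)"
  have num: "norm (exp (2 * of_real pi * \<i> * of_real \<theta> * (u - of_real \<rho>) / of_real a)) = exp (\<theta> * y)"
    by (simp add: y_def)
  have "exp (\<theta> * y) \<le> 1 + exp y"
  proof (cases "y \<ge> 0")
    case True
    then have "\<theta> * y \<le> 1 * y" using assms by (intro mult_right_mono) auto
    then have "exp (\<theta> * y) \<le> exp y" by simp
    then show ?thesis by linarith
  next
    case False
    then have "exp (\<theta> * y) \<le> 1" using assms by (simp add: mult_nonneg_nonpos)
    then show ?thesis by (simp add: add_increasing2)
  qed
  have s1: "s ^ 2 \<le> 1"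
    by (simp add: s_def abs_square_le_1)
  have Re_w: "Re w = exp y * (1 - 2 * s ^ 2)"
  proof -
    have "Re w = exp y * cos (2 * (pi * (Re u - \<rho>) / a))"
      by (simp add: w_def y_def Re_exp algebra_simps)
    then show ?thesis by (simp only: cos_double_sin s_def)
  qed
  have norm_w: "norm w = exp y"
    by (simp add: w_def y_def)
  \<comment> \<open>Split (1 + e^y)^2 as (1 - e^y)^2 + 4 e^y and use s^2 \<le> 1 on the first part
    only; the result is |1 - w|^2.\<close>
  have "((1 + exp y) * \<bar>s\<bar>) ^ 2 = (1 - exp y) ^ 2 * s ^ 2 + 4 * exp y * s ^ 2"
    by (simp add: power2_eq_square algebra_simps flip: abs_mult)
  also have "\<dots> \<le> (1 - exp y) ^ 2 * 1 + 4 * exp y * s ^ 2"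
    using s1 by (intro add_right_mono mult_left_mono) auto
  also have "\<dots> = 1 - 2 * Re w + norm w ^ 2"
    unfolding Re_w norm_w by (simp add: power2_eq_square algebra_simps)
  also have "\<dots> = norm (1 - w) ^ 2"
    unfolding cmod_power2 by (simp add: power2_eq_square algebra_simps)
  finally have "(1 + exp y) * \<bar>s\<bar> \<le> norm (1 - w)"
    by (rule power2_le_imp_le) simp
  moreover have "exp (\<theta> * y) * \<bar>s\<bar> \<le> (1 + exp y) * \<bar>s\<bar>"
    using \<open>exp (\<theta> * y) \<le> 1 + exp y\<close> by (intro mult_right_mono) auto
  ultimately have "exp (\<theta> * y) * \<bar>s\<bar> \<le> norm (1 - w)"
    by linarith
  then show ?thesis
    unfolding lattice_kernel_def norm_divide num w_def[symmetric] s_def[symmetric]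
    by (cases "w = 1") (auto simp: divide_simps)
qed

lemma lattice_kernel_pole_iff:
  assumes "a > 0"
  shows "exp (2 * of_real pi * \<i> * (u - of_real \<rho>) / of_real a) = 1 \<longleftrightarrow>
    (\<exists>n::int. u = of_real (\<rho> + a * of_int n))"
proof
  assume "exp (2 * of_real pi * \<i> * (u - of_real \<rho>) / of_real a) = 1"
  then obtain n :: int where "Re (2 * of_real pi * \<i> * (u - of_real \<rho>) / of_real a) = 0"
      "Im (2 * of_real pi * \<i> * (u - of_real \<rho>) / of_real a) = of_int (2 * n) * pi"
    unfolding exp_eq_1 by blast
  then have n: "2 * of_real pi * \<i> * (u - of_real \<rho>) / of_real a = of_int (2 * n) * of_real pi * \<i>"
    unfolding complex_eq_iff by simp
  then have "2 * of_real pi * \<i> * (u - of_real \<rho>) = 2 * of_real pi * \<i> * (of_real a * of_int n)"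
    using assms by (simp add: field_simps)
  then have "u - of_real \<rho> = of_real a * of_int n"
    by (subst (asm) mult_cancel_left) auto
  then have "u = of_real (\<rho> + a * of_int n)"
    by (simp add: algebra_simps)
  then show "\<exists>n::int. u = of_real (\<rho> + a * of_int n)" ..
next
  assume "\<exists>n::int. u = of_real (\<rho> + a * of_int n)"
  then obtain n :: int where "u = of_real (\<rho> + a * of_int n)" ..
  with assms have "2 * of_real pi * \<i> * (u - of_real \<rho>) / of_real a = 2 * of_int n * of_real pi * \<i>"
    by simp
  then show "exp (2 * of_real pi * \<i> * (u - of_real \<rho>) / of_real a) = 1"
    unfolding exp_eq_1 by (intro conjI exI[of _ n]) simp_all
qed

lemma residue_lattice_kernel:
  fixes m :: nat
  assumes "open S" "of_real (\<rho> + a * real m) \<in> S" "h holomorphic_on S" "a > 0"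
    and holo: "(\<lambda>u. h u * lattice_kernel \<theta> a \<rho> u) holomorphic_on S - {of_real (\<rho> + a * real m)}"
  shows "residue (\<lambda>u. h u * lattice_kernel \<theta> a \<rho> u) (of_real (\<rho> + a * real m)) =
    - of_real a / (2 * of_real pi * \<i>) * (cis (2 * pi * \<theta>) ^ m * h (of_real (\<rho> + a * real m)))"
proof (rule residue_simple'[OF assms(1,2) holo])
  define u0 :: complex where "u0 = of_real (\<rho> + a * real m)"
  define e where "e u = exp (2 * of_real pi * \<i> * (u - of_real \<rho>) / of_real a)" for u
  define b where "b u = exp (2 * of_real pi * \<i> * of_real \<theta> * (u - of_real \<rho>) / of_real a)" for u
  have e0: "e u0 = 1"
    unfolding e_def using lattice_kernel_pole_iff[OF \<open>a > 0\<close>, of u0 \<rho>]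
    by (auto simp: u0_def intro!: exI[of _ "int m"])
  have "(e has_field_derivative e u0 * (2 * of_real pi * \<i> / of_real a)) (at u0)"
    unfolding e_def using \<open>a > 0\<close> by (auto intro!: derivative_eq_intros)
  then have e_lim: "((\<lambda>u. (e u - 1) / (u - u0)) \<longlongrightarrow> 2 * of_real pi * \<i> / of_real a) (at u0)"
    by (simp add: has_field_derivative_iff e0)
  have "continuous_on S h"
    by (rule holomorphic_on_imp_continuous_on) fact
  then have h_lim: "(h \<longlongrightarrow> h u0) (at u0)"
    using assms(1,2) by (auto simp: continuous_on_eq_continuous_at isCont_def u0_def)
  have "isCont b u0"
    unfolding b_def by (intro continuous_intros) (use \<open>a > 0\<close> in auto)
  then have b_lim: "(b \<longlongrightarrow> b u0) (at u0)"
    by (simp add: isCont_def)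
  have "((\<lambda>u. - (h u * b u / ((e u - 1) / (u - u0)))) \<longlongrightarrow> - (h u0 * b u0 / (2 * of_real pi * \<i> / of_real a))) (at u0)"
    by (rule tendsto_minus tendsto_divide tendsto_mult h_lim b_lim e_lim)+ (use \<open>a > 0\<close> in auto)
  also have "b u0 = cis (2 * pi * \<theta>) ^ m"
    unfolding Complex.DeMoivre using \<open>a > 0\<close> by (simp add: b_def u0_def cis_conv_exp mult_ac)
  also have "- (h u0 * cis (2 * pi * \<theta>) ^ m / (2 * of_real pi * \<i> / of_real a)) =
     - of_real a / (2 * of_real pi * \<i>) * (cis (2 * pi * \<theta>) ^ m * h u0)"
    by simp
  also have "(\<lambda>u. - (h u * b u / ((e u - 1) / (u - u0)))) = (\<lambda>u. h u * lattice_kernel \<theta> a \<rho> u * (u - u0))"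
  proof
    fix u
    \<comment> \<open>The identity holds for every u: where \<open>e u = 1\<close>, in particular at
      \<open>u0\<close>, both sides are 0 through division by 0.\<close>
    show "- (h u * b u / ((e u - 1) / (u - u0))) = h u * lattice_kernel \<theta> a \<rho> u * (u - u0)"
      unfolding lattice_kernel_def e_def[symmetric] b_def[symmetric]
      by (cases "e u = 1") (simp_all add: divide_simps, simp_all add: algebra_simps)
  qed
  finally show "((\<lambda>u. h u * lattice_kernel \<theta> a \<rho> u * (u - of_real (\<rho> + a * real m))) \<longlongrightarrow>
     - of_real a / (2 * of_real pi * \<i>) * (cis (2 * pi * \<theta>) ^ m * h (of_real (\<rho> + a * real m)))) (at (of_real (\<rho> + a * real m)))"
    unfolding u0_def .
qed

lemma one_over_one_minus_exp_le:
  assumes "x > (0::real)"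
  shows "1 / (1 - exp (- x)) \<le> 1 + 1 / x"
proof -
  have "exp x \<ge> 1 + x"
    by (rule exp_ge_add_one_self)
  then have "exp (- x) \<le> 1 / (1 + x)"
    using assms by (simp add: exp_minus divide_simps)
  then have "x / (1 + x) \<le> 1 - exp (- x)"
    using assms by (simp add: field_simps)
  then have "1 / (1 - exp (- x)) \<le> 1 / (x / (1 + x))"
    using assms by (intro frac_le) auto
  also have "\<dots> = 1 + 1 / x"
    using assms by (simp add: field_simps)
  finally show ?thesis .
qed

text \<open>The numerator gives the exponential rate \<theta>. The denominator costs 1 / (1 -
  e^(-y)) \<le> 1 + 1 / y, which along a ray towards 0 grows only like 1 / |u|, that is like exp |v|
  in the logarithmic coordinate.\<close>

lemma norm_lattice_kernel_upper_le:
  assumes "Im u > 0" "a > 0"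
  shows "norm (lattice_kernel \<theta> a \<rho> u) \<le> exp (- (2 * pi * \<theta> * Im u / a)) * (1 + a / (2 * pi * Im u))"
proof -
  define y where "y = 2 * pi * Im u / a"
  have y: "y > 0" using assms by (simp add: y_def)
  define w where "w = exp (2 * of_real pi * \<i> * (u - of_real \<rho>) / of_real a)"
  have num: "norm (exp (2 * of_real pi * \<i> * of_real \<theta> * (u - of_real \<rho>) / of_real a)) = exp (- (\<theta> * y))"
    by (simp add: y_def)
  have "norm w = exp (- y)"
    by (simp add: w_def y_def)
  then have "1 - exp (- y) \<le> norm (1 - w)"
    using norm_triangle_ineq2[of 1 w] by simp
  moreover have "1 - exp (- y) > 0"
    using y by simp
  ultimately have "norm (lattice_kernel \<theta> a \<rho> u) \<le> exp (- (\<theta> * y)) / (1 - exp (- y))"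
    unfolding lattice_kernel_def norm_divide num w_def[symmetric] by (intro frac_le) auto
  also have "\<dots> = exp (- (\<theta> * y)) * (1 / (1 - exp (- y)))"
    by simp
  also have "\<dots> \<le> exp (- (\<theta> * y)) * (1 + 1 / y)"
    using one_over_one_minus_exp_le[OF y] by (intro mult_left_mono) auto
  finally show ?thesis
    by (simp add: y_def mult_ac)
qed

text \<open>Below the axis the exponential in the denominator dominates; dividing by it replaces the
  rate \<theta> by 1 - \<theta>.\<close>

lemma norm_lattice_kernel_lower_le:
  assumes "Im u < 0" "a > 0"
  shows "norm (lattice_kernel \<theta> a \<rho> u) \<le> exp (2 * pi * (1 - \<theta>) * Im u / a) * (1 - a / (2 * pi * Im u))"
proof -
  define y where "y = - 2 * pi * Im u / a"
  have y: "y > 0" using assms by (simp add: y_def mult_pos_neg divide_neg_pos)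
  define w where "w = exp (2 * of_real pi * \<i> * (u - of_real \<rho>) / of_real a)"
  have num: "norm (exp (2 * of_real pi * \<i> * of_real \<theta> * (u - of_real \<rho>) / of_real a)) = exp (\<theta> * y)"
    by (simp add: y_def)
  have "norm w = exp y"
    by (simp add: w_def y_def)
  then have "exp y - 1 \<le> norm (1 - w)"
    using norm_triangle_ineq2[of w 1] by (simp add: norm_minus_commute)
  moreover have "exp y - 1 > 0"
    using y by simp
  ultimately have "norm (lattice_kernel \<theta> a \<rho> u) \<le> exp (\<theta> * y) / (exp y - 1)"
    unfolding lattice_kernel_def norm_divide num w_def[symmetric] by (intro frac_le) auto
  also have "\<dots> = exp ((\<theta> - 1) * y) * (1 / (1 - exp (- y)))"
  proof -
    have "exp y - 1 = exp y * (1 - exp (- y))"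
      by (simp add: right_diff_distrib mult_exp_exp)
    moreover have "exp ((\<theta> - 1) * y) = exp (\<theta> * y) / exp y"
      by (simp add: left_diff_distrib exp_diff)
    ultimately show ?thesis by simp
  qed
  also have "\<dots> \<le> exp ((\<theta> - 1) * y) * (1 + 1 / y)"
    using one_over_one_minus_exp_le[OF y] by (intro mult_left_mono) auto
  also have "(\<theta> - 1) * y = 2 * pi * (1 - \<theta>) * Im u / a"
    using assms by (simp add: y_def field_simps)
  also have "1 + 1 / y = 1 - a / (2 * pi * Im u)"
    by (simp add: y_def)
  finally show ?thesis .
qed

section \<open>Summation over the lattice by residues\<close>

lemma lattice_kernel_holomorphic:
  assumes "a > 0" "\<And>n::int. of_real (\<rho> + a * of_int n) \<notin> S"
  shows "lattice_kernel \<theta> a \<rho> holomorphic_on S"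
proof -
  have "exp (2 * of_real pi * \<i> * (u - of_real \<rho>) / of_real a) \<noteq> 1" if "u \<in> S" for u
    using lattice_kernel_pole_iff[OF assms(1), of u \<rho>] that assms(2) by blast
  then show ?thesis
    unfolding lattice_kernel_def using assms(1) by (intro holomorphic_intros) auto
qed

lemma lattice_kernel_holomorphic_nonreal:
  assumes "a > 0" "\<And>u. u \<in> S \<Longrightarrow> Im u \<noteq> 0"
  shows "lattice_kernel \<theta> a \<rho> holomorphic_on S"
  using assms by (intro lattice_kernel_holomorphic) (auto dest: assms(2))

text \<open>The right side of the rectangle passes midway between the poles of index M - 1 and M,
  the left side between 0 and \<rho>, so exactly the indices m < M are enclosed.\<close>

lemma lattice_sum_rect:
  fixes a1 a3 :: complex and M :: nat
  assumes H: "open H" "convex H" "h holomorphic_on H" and box: "cbox a1 a3 \<subseteq> H"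
    and a1: "0 < Re a1" "Re a1 < \<rho>" "Im a1 < 0" and a3: "Re a3 = \<rho> + a * (real M - 1 / 2)" "Im a3 > 0"
    and a: "a > 0" "0 < \<rho>" "\<rho> \<le> a" and M: "Re a1 < Re a3"
  shows "contour_integral (rectpath a1 a3) (\<lambda>u. h u * lattice_kernel \<theta> a \<rho> u)
    = - of_real a * (\<Sum>m<M. cis (2 * pi * \<theta>) ^ m * h (of_real (\<rho> + a * real m)))"
proof -
  define \<kappa> where "\<kappa> u = h u * lattice_kernel \<theta> a \<rho> u" for u
  \<comment> \<open>Since \<rho> \<le> a, the pole of index -1 lies at \<rho> - a \<le> 0. The strip
    therefore excludes all negative indices as well as all indices from M on.\<close>
  define S where "S = H \<inter> {u. 0 < Re u} \<inter> {u. Re u < \<rho> + a * real M}"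
  define c where "c m = (of_real (\<rho> + a * real m) :: complex)" for m
  define pts where "pts = c ` {..<M}"
  have inj: "inj_on c A" for A
    using a by (auto simp: inj_on_def c_def)
  have S: "open S" "convex S"
    unfolding S_def using H
    by (auto intro!: open_Int convex_Int open_halfspace_Re_gt open_halfspace_Re_lt convex_halfspace_Re_gt convex_halfspace_Re_lt)
  have box_S: "cbox a1 a3 \<subseteq> S"
    using box a1 a3 a by (auto simp: S_def in_cbox_complex_iff algebra_simps)
  have pole: "m \<in> {..<M}" if "of_real (\<rho> + a * of_int n) \<in> S" "m = nat n" for n m
  proof -
    have n: "0 < \<rho> + a * of_int n" "\<rho> + a * of_int n < \<rho> + a * real M"
      using that by (auto simp: S_def)
    have "0 < a * (1 + of_int n)"
      using n(1) a by (simp add: algebra_simps)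
    then have "n \<ge> 0" using a by (simp add: zero_less_mult_iff)
    moreover have "real_of_int n < real M" using n(2) a by simp
    ultimately show ?thesis using that(2) by simp
  qed
  have nn: "n \<ge> 0" if "of_real (\<rho> + a * of_int n) \<in> S" for n :: int
  proof -
    have "0 < \<rho> + a * of_int n"
      using that by (auto simp: S_def)
    then have "0 < a * (1 + of_int n)"
      using a by (simp add: algebra_simps)
    then show ?thesis using a by (simp add: zero_less_mult_iff)
  qed
  have kern: "lattice_kernel \<theta> a \<rho> holomorphic_on S - pts"
  proof (rule lattice_kernel_holomorphic[OF a(1)], rule notI)
    fix n :: int assume *: "complex_of_real (\<rho> + a * of_int n) \<in> S - pts"
    then have "nat n \<in> {..<M}" "n \<ge> 0" using pole nn by auto
    then have "c (nat n) \<in> pts" by (auto simp: pts_def)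
    with * \<open>n \<ge> 0\<close> show False by (simp add: c_def)
  qed
  have h: "h holomorphic_on S"
    by (rule holomorphic_on_subset[OF H(3)]) (auto simp: S_def)
  have \<kappa>: "\<kappa> holomorphic_on S - pts"
    unfolding \<kappa>_def by (intro holomorphic_intros kern holomorphic_on_subset[OF h]) auto
  have pts_box: "c m \<in> box a1 a3" if "m < M" for m
  proof -
    have "real m \<le> real M - 1" using that by linarith
    then have "a * real m \<le> a * (real M - 1)" using a by (intro mult_left_mono) auto
    then have "a * real m < a * (real M - 1 / 2)" using a by (simp add: algebra_simps)
    moreover have "0 \<le> a * real m" using a by simp
    ultimately show ?thesis
      using a1 a3 by (auto simp: c_def in_box_complex_iff)
  qed
  have "contour_integral (rectpath a1 a3) \<kappa> = 2 * pi * \<i> * (\<Sum>p\<in>pts. winding_number (rectpath a1 a3) p * residue \<kappa> p)"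
  proof (rule Residue_theorem[OF S(1) convex_connected[OF S(2)] _ \<kappa>])
    show "finite pts" by (simp add: pts_def)
    have "path_image (rectpath a1 a3) \<subseteq> cbox a1 a3"
      using a1 a3 M by (intro path_image_rectpath_subset_cbox) auto
    moreover have "path_image (rectpath a1 a3) \<inter> box a1 a3 = {}"
      using a1 a3 M by (intro path_image_rectpath_inter_box) auto
    ultimately show "path_image (rectpath a1 a3) \<subseteq> S - pts"
      using pts_box box_S by (auto simp: pts_def)
    show "\<forall>z. z \<notin> S \<longrightarrow> winding_number (rectpath a1 a3) z = 0"
      using a1 a3 M box_S by (auto intro!: winding_number_rectpath_outside)
  qed auto
  also have "(\<Sum>p\<in>pts. winding_number (rectpath a1 a3) p * residue \<kappa> p) = (\<Sum>m<M. residue \<kappa> (c m))"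
    unfolding pts_def by (subst sum.reindex[OF inj]) (simp add: winding_number_rectpath pts_box)
  also have "\<dots> = (\<Sum>m<M. - of_real a / (2 * of_real pi * \<i>) * (cis (2 * pi * \<theta>) ^ m * h (c m)))"
  proof (rule sum.cong)
    fix m assume m: "m \<in> {..<M}"
    define S' where "S' = S - (pts - {c m})"
    have S': "open S'" "c m \<in> S'" "S' - {c m} = S - pts"
      using S(1) pts_box[of m] m box_S box_subset_cbox[of a1 a3]
      by (auto simp: S'_def pts_def intro!: open_Diff finite_imp_closed)
    show "residue \<kappa> (c m) = - of_real a / (2 * of_real pi * \<i>) * (cis (2 * pi * \<theta>) ^ m * h (c m))"
      unfolding \<kappa>_def c_def
    proof (rule residue_lattice_kernel[OF S'(1)])
      show "h holomorphic_on S'"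
        by (rule holomorphic_on_subset[OF h]) (auto simp: S'_def)
      show "(\<lambda>u. h u * lattice_kernel \<theta> a \<rho> u) holomorphic_on S' - {of_real (\<rho> + a * real m)}"
        using \<kappa> unfolding \<kappa>_def S'(3)[unfolded c_def] .
    qed (use S'(2) a in \<open>auto simp: c_def\<close>)
  qed simp
  also have "\<dots> = - of_real a / (2 * of_real pi * \<i>) * (\<Sum>m<M. cis (2 * pi * \<theta>) ^ m * h (c m))"
    by (simp add: sum_distrib_left)
  finally show ?thesis
    by (simp add: \<kappa>_def c_def)
qed

text \<open>The integrand has a primitive \<open>P\<close> above the axis and a primitive
  \<open>Q\<close> below it, so the horizontal sides of a thin rectangle are differences of
  primitives, and these can be moved to the rays along vertical segments. The decay of h at 0 and at
  infinity makes all vertical contributions vanish.\<close>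

lemma lattice_sum_eq_ray_integrals:
  fixes h :: "complex \<Rightarrow> complex" and T T' :: real
  assumes H: "open H" "convex H" "h holomorphic_on H"
    and wedge: "\<And>u. Re u > 0 \<Longrightarrow> - T' * Re u \<le> Im u \<Longrightarrow> Im u \<le> T * Re u \<Longrightarrow> u \<in> H"
    and bound: "\<And>u. Re u > 0 \<Longrightarrow> - T' * Re u \<le> Im u \<Longrightarrow> Im u \<le> T * Re u \<Longrightarrow>
       norm (h u) \<le> K * exp (- e * (norm u + 1 / norm u))"
    and T: "T > 0" "T' > 0" and e: "e > 0" and \<theta>: "0 \<le> \<theta>" "\<theta> \<le> 1"
    and a: "a > 0" "0 < \<rho>" "\<rho> \<le> a"
  shows "(\<lambda>m. of_real a * (cis (2 * pi * \<theta>) ^ m * h (of_real (\<rho> + a * real m)))) sums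
    (ray_integral (Complex 1 T) (\<lambda>u. h u * lattice_kernel \<theta> a \<rho> u)
     - ray_integral (Complex 1 (- T')) (\<lambda>u. h u * lattice_kernel \<theta> a \<rho> u))"
proof -
  define \<kappa> where "\<kappa> u = h u * lattice_kernel \<theta> a \<rho> u" for u
  define p q where "p = Complex 1 T" and "q = Complex 1 (- T')"
  define W where "W = {u. Re u > 0 \<and> - T' * Re u \<le> Im u \<and> Im u \<le> T * Re u}"
  have W_H: "W \<subseteq> H" using wedge by (auto simp: W_def)
  have K: "K \<ge> 0"
    using order_trans[OF norm_ge_zero bound[of 1]] T by (simp add: zero_le_mult_iff)
  have p_ray: "ray p v = Complex (exp v) (T * exp v)" and q_ray: "ray q v = Complex (exp v) (- (T' * exp v))" for v
    by (auto simp: ray_def p_def q_def complex_eq_iff)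
  have ray_W: "ray p v \<in> W" "ray q v \<in> W" for v
  proof -
    have "- T' * exp v \<le> T * exp v" using T by (intro mult_right_mono) auto
    then show "ray p v \<in> W" "ray q v \<in> W"
      by (auto simp: W_def p_ray q_ray)
  qed
  have \<kappa>_holo: "\<kappa> holomorphic_on H \<inter> S" if "\<And>u. u \<in> S \<Longrightarrow> Im u \<noteq> 0" for S
    unfolding \<kappa>_def using that a
    by (intro holomorphic_intros holomorphic_on_subset[OF H(3)] lattice_kernel_holomorphic_nonreal) auto
  define Hp where "Hp = H \<inter> {u. Im u > 0}"
  define Hm where "Hm = H \<inter> {u. Im u < 0}"
  have HpHm: "open Hp" "convex Hp" "open Hm" "convex Hm"
    unfolding Hp_def Hm_def using H
    by (auto intro!: open_Int convex_Int open_halfspace_Im_gt open_halfspace_Im_lt convex_halfspace_Im_gt convex_halfspace_Im_lt)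
  have "\<kappa> holomorphic_on Hp" "\<kappa> holomorphic_on Hm"
    unfolding Hp_def Hm_def by (auto intro!: \<kappa>_holo)
  note \<kappa>_pm = this
  obtain P where P: "\<And>u. u \<in> Hp \<Longrightarrow> (P has_field_derivative \<kappa> u) (at u)"
    using holomorphic_convex_primitive'[OF HpHm(2,1) \<kappa>_pm(1)] HpHm(1) by (metis at_within_open)
  obtain Q where Q: "\<And>u. u \<in> Hm \<Longrightarrow> (Q has_field_derivative \<kappa> u) (at u)"
    using holomorphic_convex_primitive'[OF HpHm(4,3) \<kappa>_pm(2)] HpHm(3) by (metis at_within_open)
  have ray_H: "ray p v \<in> Hp" "ray q v \<in> Hm" for v
    using ray_W W_H T by (auto simp: Hp_def Hm_def p_ray q_ray)

  define L where "L = 1 + T + T'"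
  have L: "L > 0" using T by (simp add: L_def)
  have W_norm: "Re u \<le> norm u" "norm u \<le> L * Re u" "norm u > 0" if "u \<in> W" for u
  proof -
    have u: "Re u > 0" "- T' * Re u \<le> Im u" "Im u \<le> T * Re u"
      using that by (auto simp: W_def)
    show "Re u \<le> norm u" by (rule complex_Re_le_cmod)
    with u show "norm u > 0" by linarith
    have "0 \<le> T * Re u" "0 \<le> T' * Re u"
      using u T by auto
    with u have "\<bar>Im u\<bar> \<le> (T + T') * Re u"
      by (simp add: abs_le_iff ring_distribs)
    then show "norm u \<le> L * Re u"
      using cmod_le[of u] u by (simp add: L_def algebra_simps)
  qed
  \<comment> \<open>A majorant of |h| on the vertical section of the wedge at abscissa x: there x
    \<le> |u| \<le> L x.\<close>
  define V where "V x = K * exp (- e * (x + 1 / (L * x)))" for x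
  have h_V: "norm (h u) \<le> V (Re u)" if "u \<in> W" for u
  proof -
    have u: "Re u > 0" using that by (auto simp: W_def)
    have "norm (h u) \<le> K * exp (- e * (norm u + 1 / norm u))"
      using that by (intro bound) (auto simp: W_def)
    also have "\<dots> \<le> V (Re u)"
      unfolding V_def using W_norm[OF that] u L e K
      by (intro mult_left_mono) (auto intro!: mult_left_mono add_mono frac_le)
    finally show ?thesis .
  qed
  define s where "s x = \<bar>sin (pi * (x - \<rho>) / a)\<bar>" for x
  have \<kappa>_V: "norm (\<kappa> u) \<le> V (Re u) / s (Re u)" if "u \<in> W" "s (Re u) > 0" for u
  proof -
    have "norm (lattice_kernel \<theta> a \<rho> u) * s (Re u) \<le> 1"
      unfolding s_def using \<theta> a by (intro norm_lattice_kernel_sin_le) auto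
    then have "norm (lattice_kernel \<theta> a \<rho> u) \<le> 1 / s (Re u)"
      using that by (simp add: pos_le_divide_eq)
    then have "norm (\<kappa> u) \<le> V (Re u) * (1 / s (Re u))"
      unfolding \<kappa>_def norm_mult using h_V[OF that(1)]
      by (intro mult_mono) (auto simp: V_def K)
    then show ?thesis by simp
  qed
  have cont_W: "continuous_on X \<kappa>" if "X \<subseteq> W" "\<And>u. u \<in> X \<Longrightarrow> s (Re u) > 0" for X
  proof -
    have "of_real (\<rho> + a * of_int n) \<notin> X" for n :: int
    proof
      assume "complex_of_real (\<rho> + a * of_int n) \<in> X"
      then have "sin (pi * ((\<rho> + a * of_int n) - \<rho>) / a) \<noteq> 0"
        using that(2) by (fastforce simp: s_def)
      then show False using a by (simp add: sin_times_pi_eq_0 mult.commute)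
    qed
    then have "\<kappa> holomorphic_on X"
      unfolding \<kappa>_def using that(1) W_H a
      by (intro holomorphic_intros holomorphic_on_subset[OF H(3)] lattice_kernel_holomorphic) auto
    then show ?thesis by (rule holomorphic_on_imp_continuous_on)
  qed

  \<comment> \<open>Both primitives are taken at the points of the rays with abscissa x, so
    \<open>D y - D x\<close> tends to the difference of the ray integrals as x tends to 0 and y to
    infinity.\<close>
  define D where "D x = P (ray p (ln x)) - Q (ray q (ln x))" for x
  define S where "S M = (\<Sum>m<M. of_real a * (cis (2 * pi * \<theta>) ^ m * h (of_real (\<rho> + a * real m))))" for M
  have main: "norm (D y - D x - S M) \<le> x * V x / s x * (T + T') + y * V y / s y * (T + T')"
    if x: "0 < x" "x < \<rho>" "x < y" "s x > 0" and y: "y = \<rho> + a * (real M - 1 / 2)" "s y > 0" for x y M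
  proof -
    \<comment> \<open>Half the height of the rectangle. The wedge is narrowest at the left side x,
      so this height keeps the whole rectangle inside it.\<close>
    define w0 where "w0 = x * min T T'"
    have w0: "w0 > 0" "w0 \<le> x * T" "w0 \<le> x * T'" "w0 \<le> y * T" "w0 \<le> y * T'"
    proof -
      show "w0 > 0" using x T by (simp add: w0_def)
      show 1: "w0 \<le> x * T" "w0 \<le> x * T'"
        using x by (auto simp: w0_def)
      have "x * T \<le> y * T" "x * T' \<le> y * T'"
        using x T by (auto intro!: mult_right_mono)
      with 1 show "w0 \<le> y * T" "w0 \<le> y * T'"
        by linarith+
    qed
    define a1 a2 a3 a4 where "a1 = Complex x (- w0)" and "a2 = Complex y (- w0)"
      and "a3 = Complex y w0" and "a4 = Complex x w0"
    have strip: "u \<in> W" if "x \<le> Re u" "\<bar>Im u\<bar> \<le> w0" for u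
    proof -
      have "x * T \<le> Re u * T" "x * T' \<le> Re u * T'"
        using that T by (auto intro!: mult_right_mono)
      then show ?thesis using that w0 x by (auto simp: W_def mult.commute)
    qed
    have vert: "norm (\<kappa> u) \<le> V t / s t \<and> u \<in> W"
      if "u \<in> closed_segment (Complex t b) (Complex t c)" "t \<in> {x, y}"
        "- T' * t \<le> b" "b \<le> T * t" "- T' * t \<le> c" "c \<le> T * t" for u t b c
    proof -
      have "Re u = t" "Im u \<in> closed_segment b c"
        using that(1) by (auto simp: closed_segment_same_Re)
      then have "u \<in> W"
        using that x by (auto simp: W_def closed_segment_eq_real_ivl split: if_splits)
      with \<open>Re u = t\<close> show ?thesis using \<kappa>_V[of u] that(2) x y by auto
    qed
    have Vs: "V t / s t \<ge> 0" for t
      using K by (simp add: V_def s_def)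
    have vint: "\<exists>i. (\<kappa> has_contour_integral i) (linepath (Complex t b) (Complex t c)) \<and>
        norm i \<le> V t / s t * \<bar>c - b\<bar>"
      if t: "t \<in> {x, y}" "- T' * t \<le> b" "b \<le> T * t" "- T' * t \<le> c" "c \<le> T * t" for t b c
    proof -
      have sub: "closed_segment (Complex t b) (Complex t c) \<subseteq> W"
        using vert t by blast
      have "continuous_on (closed_segment (Complex t b) (Complex t c)) \<kappa>"
        using t x y by (intro cont_W sub) (auto simp: closed_segment_same_Re)
      then have i: "(\<kappa> has_contour_integral contour_integral (linepath (Complex t b) (Complex t c)) \<kappa>)
          (linepath (Complex t b) (Complex t c))"
        by (intro has_contour_integral_integral contour_integrable_continuous_linepath)
      moreover have "norm (contour_integral (linepath (Complex t b) (Complex t c)) \<kappa>)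
          \<le> V t / s t * norm (Complex t c - Complex t b)"
        using vert t by (intro has_contour_integral_bound_linepath[OF i Vs]) blast
      moreover have "norm (Complex t c - Complex t b) = \<bar>c - b\<bar>"
        by (simp add: cmod_def)
      ultimately show ?thesis by auto
    qed
    have range: "- T' * t \<le> - w0" "- w0 \<le> T * t" "- T' * t \<le> w0" "w0 \<le> T * t" if "t \<in> {x, y}" for t
      using that w0 by (auto simp: mult.commute intro: order_trans)
    obtain ir where ir: "(\<kappa> has_contour_integral ir) (linepath a2 a3)" "norm ir \<le> V y / s y * (2 * w0)"
      using vint[of y "- w0" w0] range w0 by (auto simp: a2_def a3_def)
    obtain il where il: "(\<kappa> has_contour_integral il) (linepath a4 a1)" "norm il \<le> V x / s x * (2 * w0)"
      using vint[of x w0 "- w0"] range w0 by (auto simp: a4_def a1_def)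
    have ib: "(\<kappa> has_contour_integral (Q a2 - Q a1)) (linepath a1 a2)"
    proof -
      have "closed_segment a1 a2 \<subseteq> Hm"
        using strip W_H w0 x by (auto simp: Hm_def a1_def a2_def closed_segment_same_Im closed_segment_eq_real_ivl)
      then show ?thesis
        using contour_integral_primitive[of Hm Q \<kappa> "linepath a1 a2"] Q
        by (auto intro: has_field_derivative_at_within)
    qed
    have it: "(\<kappa> has_contour_integral (P a4 - P a3)) (linepath a3 a4)"
    proof -
      have "closed_segment a3 a4 \<subseteq> Hp"
        using strip W_H w0 x by (auto simp: Hp_def a3_def a4_def closed_segment_same_Im closed_segment_eq_real_ivl)
      then show ?thesis
        using contour_integral_primitive[of Hp P \<kappa> "linepath a3 a4"] P
        by (auto intro: has_field_derivative_at_within)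
    qed
    have "(\<kappa> has_contour_integral ((Q a2 - Q a1) + (ir + ((P a4 - P a3) + il)))) (rectpath a1 a3)"
      unfolding rectpath_def Let_def
      using has_contour_integral_join[OF ib has_contour_integral_join[OF ir(1) has_contour_integral_join[OF it il(1)]]]
      by (simp add: a1_def a2_def a3_def a4_def)
    then have "contour_integral (rectpath a1 a3) \<kappa> = (Q a2 - Q a1) + (ir + ((P a4 - P a3) + il))"
      by (rule contour_integral_unique)
    moreover have "contour_integral (rectpath a1 a3) \<kappa> = - S M"
    proof -
      have "cbox a1 a3 \<subseteq> W"
      proof
        fix u assume "u \<in> cbox a1 a3"
        then have "x \<le> Re u" "- w0 \<le> Im u" "Im u \<le> w0"
          by (simp_all add: a1_def a3_def in_cbox_complex_iff)
        then show "u \<in> W" by (intro strip) simp_all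
      qed
      then have "cbox a1 a3 \<subseteq> H"
        using W_H by (rule subset_trans)
      then show ?thesis
        unfolding \<kappa>_def S_def sum_distrib_left[symmetric] using x y w0 a H
        by (subst lattice_sum_rect[where H = H]) (auto simp: a1_def a3_def)
    qed
    ultimately have SM: "S M = (P a3 - P a4) - (Q a2 - Q a1) - ir - il"
      by (simp add: algebra_simps)
    have vP: "norm (P (ray p (ln t)) - P (Complex t w0)) \<le> V t / s t * (T * t - w0)" if "t \<in> {x, y}" for t
    proof -
      have t: "t > 0" "w0 \<le> T * t" "- T' * t \<le> T * t" using that x range[OF that] by auto
      have ray: "ray p (ln t) = Complex t (T * t)" using t by (simp add: p_ray)
      have "norm (P (Complex t (T * t)) - P (Complex t w0)) \<le> V t / s t * norm (Complex t (T * t) - Complex t w0)"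
      proof (rule norm_primitive_diff_le)
        fix u assume u: "u \<in> closed_segment (Complex t (T * t)) (Complex t w0)"
        with vert[OF u that] t range[OF that] show "norm (\<kappa> u) \<le> V t / s t" by auto
        have "u \<in> W" using vert[OF u that] t range[OF that] by auto
        moreover have "Im u > 0"
          using u w0 t by (auto simp: closed_segment_same_Re closed_segment_eq_real_ivl split: if_splits)
        ultimately show "(P has_field_derivative \<kappa> u) (at u)" using W_H by (intro P) (auto simp: Hp_def)
      qed
      also have "norm (Complex t (T * t) - Complex t w0) = T * t - w0"
        using t by (simp add: cmod_def)
      finally show ?thesis by (simp add: ray)
    qed
    have vQ: "norm (Q (ray q (ln t)) - Q (Complex t (- w0))) \<le> V t / s t * (T' * t - w0)" if "t \<in> {x, y}" for t
    proof -
      have t: "t > 0" "w0 \<le> T' * t" "- T' * t \<le> T * t" using that x range[OF that] by auto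
      have ray: "ray q (ln t) = Complex t (- T' * t)" using t by (simp add: q_ray)
      have "norm (Q (Complex t (- T' * t)) - Q (Complex t (- w0))) \<le> V t / s t * norm (Complex t (- T' * t) - Complex t (- w0))"
      proof (rule norm_primitive_diff_le)
        fix u assume u: "u \<in> closed_segment (Complex t (- T' * t)) (Complex t (- w0))"
        with vert[OF u that] t range[OF that] show "norm (\<kappa> u) \<le> V t / s t" by auto
        have "u \<in> W" using vert[OF u that] t range[OF that] by auto
        moreover have "Im u < 0"
          using u w0 t by (auto simp: closed_segment_same_Re closed_segment_eq_real_ivl split: if_splits)
        ultimately show "(Q has_field_derivative \<kappa> u) (at u)" using W_H by (intro Q) (auto simp: Hm_def)
      qed
      also have "norm (Complex t (- T' * t) - Complex t (- w0)) = T' * t - w0"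
        using t by (simp add: cmod_def)
      finally show ?thesis by (simp add: ray)
    qed
    \<comment> \<open>At each of the abscissae x and y, the rectangle side and the two segments
      joining it to the rays make up the full section of the wedge, of length (T + T') times the
      abscissa.\<close>
    have "D y - D x - S M = (P (ray p (ln y)) - P a3) - (P (ray p (ln x)) - P a4)
        - (Q (ray q (ln y)) - Q a2) + (Q (ray q (ln x)) - Q a1) + ir + il"
      unfolding SM D_def by (simp add: algebra_simps)
    also have "norm \<dots> \<le> norm (P (ray p (ln y)) - P a3) + norm (P (ray p (ln x)) - P a4)
        + norm (Q (ray q (ln y)) - Q a2) + norm (Q (ray q (ln x)) - Q a1) + norm ir + norm il"
      by (intro order_trans[OF norm_triangle_ineq] order_trans[OF norm_triangle_ineq4] add_mono order_refl)
    also have "\<dots> \<le> V y / s y * (T * y - w0) + V x / s x * (T * x - w0) + V y / s y * (T' * y - w0)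
        + V x / s x * (T' * x - w0) + V y / s y * (2 * w0) + V x / s x * (2 * w0)"
      using vP[of y] vP[of x] vQ[of y] vQ[of x]
      by (intro add_mono ir(2) il(2)) (auto simp: a1_def a2_def a3_def a4_def)
    also have "\<dots> = x * V x / s x * (T + T') + y * V y / s y * (T + T')"
    proof -
      have alg: "B * (T * y - w0) + A * (T * x - w0) + B * (T' * y - w0) + A * (T' * x - w0) + B * (2 * w0) + A * (2 * w0)
          = x * A * (T + T') + y * B * (T + T')" for A B
        by (simp add: algebra_simps)
      show ?thesis unfolding alg by simp
    qed
    finally show ?thesis .
  qed

  \<comment> \<open>These abscissae lie midway between poles, where the sine in \<open>s\<close> has
    modulus 1.\<close>
  define yy where "yy n = \<rho> + a * (real n - 1 / 2)" for n :: nat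
  define xx where "xx n = exp (- real n)" for n :: nat
  have s_yy: "s (yy n) = 1" for n
  proof -
    have "pi * (yy n - \<rho>) / a = real n * pi - pi / 2"
      using a by (simp add: yy_def field_simps)
    then show ?thesis by (simp add: s_def sin_diff)
  qed
  \<comment> \<open>For \<rho> = a the origin itself is a pole of the kernel, so \<open>s\<close>
    may vanish linearly at 0. The loss of 1 / x is harmless because V tends to 0 and the section has
    length proportional to x.\<close>
  have s_xx: "2 * x / a \<le> s x" if "0 < x" "x \<le> \<rho> / 2" for x
  proof -
    define sv where "sv = sin (pi * ((\<rho> - x) / a))"
    define m where "m = min ((\<rho> - x) / a) (1 - (\<rho> - x) / a)"
    have "2 * m \<le> sv"
      unfolding sv_def m_def using that a by (intro sin_pi_ge) (auto simp: field_simps)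
    moreover have "x / a \<le> m"
      unfolding m_def using that a by (auto simp: field_simps)
    moreover have "s x = \<bar>sv\<bar>"
      unfolding s_def sv_def abs_minus_cancel[of "sin (pi * (x - \<rho>) / a)", symmetric]
      by (metis minus_diff_eq minus_divide_left mult_minus_right sin_minus times_divide_eq_right)
    moreover from \<open>x / a \<le> m\<close> have "2 * x / a \<le> 2 * m"
      by simp
    ultimately show ?thesis
      by linarith
  qed
  have xx_lim: "xx \<longlonglongrightarrow> 0"
    unfolding xx_def by real_asymp
  have ev_xx: "eventually (\<lambda>n. xx n \<le> \<rho> / 2) sequentially"
    using order_tendstoD(2)[OF xx_lim, of "\<rho> / 2"] a by (auto elim: eventually_mono)
  have yy_lim: "filterlim yy at_top sequentially"
    unfolding yy_def using a by real_asymp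
  have ev_yy: "eventually (\<lambda>n. yy n \<ge> \<rho>) sequentially"
    using yy_lim by (auto simp: filterlim_at_top)
  have err: "(\<lambda>n. D (yy n) - D (xx n) - S n) \<longlonglongrightarrow> 0"
  proof (rule Lim_null_comparison)
    show "eventually (\<lambda>n. norm (D (yy n) - D (xx n) - S n) \<le> a / 2 * V (xx n) * (T + T') + yy n * V (yy n) * (T + T')) sequentially"
      using ev_xx ev_yy
    proof eventually_elim
      case (elim n)
      have x0: "xx n > 0" by (simp add: xx_def)
      have sx: "s (xx n) > 0"
        using s_xx[OF x0 elim(1)] x0 a by (auto intro: less_le_trans[rotated])
      have "xx n * V (xx n) / s (xx n) \<le> xx n * V (xx n) / (2 * xx n / a)"
        using s_xx[OF x0 elim(1)] x0 a K sx by (intro divide_left_mono mult_pos_pos divide_pos_pos) (auto simp: V_def)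
      also have "\<dots> = a / 2 * V (xx n)"
        using x0 by simp
      finally have "xx n * V (xx n) / s (xx n) * (T + T') \<le> a / 2 * V (xx n) * (T + T')"
        using T by (intro mult_right_mono) auto
      moreover have "norm (D (yy n) - D (xx n) - S n) \<le> xx n * V (xx n) / s (xx n) * (T + T') + yy n * V (yy n) / s (yy n) * (T + T')"
        using elim x0 sx a s_yy[of n] by (intro main) (auto simp: yy_def)
      ultimately show ?case unfolding s_yy div_by_1 by linarith
    qed
    have "((\<lambda>x. V x) \<longlongrightarrow> 0) (at_right 0)" "((\<lambda>y. y * V y) \<longlongrightarrow> 0) at_top"
      unfolding V_def using L e by real_asymp+
    moreover have "filterlim xx (at_right 0) sequentially"
      unfolding xx_def by real_asymp
    ultimately have "(\<lambda>n. V (xx n)) \<longlonglongrightarrow> 0" "(\<lambda>n. yy n * V (yy n)) \<longlonglongrightarrow> 0"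
      using yy_lim by (auto elim: filterlim_compose)
    from tendsto_add[OF tendsto_mult_left[OF this(1), of "a / 2 * (T + T')"] tendsto_mult_right[OF this(2), of "T + T'"]]
    show "(\<lambda>n. a / 2 * V (xx n) * (T + T') + yy n * V (yy n) * (T + T')) \<longlonglongrightarrow> 0"
      by (simp add: mult_ac)
  qed
  have ln_lims: "filterlim (\<lambda>n. ln (xx n)) at_bot sequentially" "filterlim (\<lambda>n. ln (yy n)) at_top sequentially"
    unfolding xx_def using filterlim_compose[OF ln_at_top yy_lim] by (real_asymp, simp)

  have int: "integrable lborel (\<lambda>v. \<kappa> (ray w v) * ray w v)" "continuous_on UNIV (\<lambda>v. \<kappa> (ray w v))"
    if w: "w = p \<or> w = q" for w
  proof -
    have W: "ray w v \<in> W" for v using ray_W w by auto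
    have Im_w: "Im (ray w v) = exp v * Im w" for v by (simp add: ray_def)
    have Im0: "Im w \<noteq> 0" "norm w > 0" using w T by (auto simp: p_def q_def complex_eq_iff)
    show cont: "continuous_on UNIV (\<lambda>v. \<kappa> (ray w v))"
    proof (rule continuous_on_compose2[OF holomorphic_on_imp_continuous_on[OF \<kappa>_holo[of "{u. Im u \<noteq> 0}"]] continuous_on_ray])
      show "ray w ` UNIV \<subseteq> H \<inter> {u. Im u \<noteq> 0}"
        using W W_H Im0 by (auto simp: Im_w)
    qed auto
    define B where "B = a / (2 * pi * \<bar>Im w\<bar>)"
    have B: "B \<ge> 0" using a by (simp add: B_def)
    have kb: "norm (lattice_kernel \<theta> a \<rho> (ray w v)) \<le> (1 + B) * exp \<bar>v\<bar>" for v
    proof -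
      have "norm (lattice_kernel \<theta> a \<rho> (ray w v)) \<le> 1 * (1 + a / (2 * pi * \<bar>Im (ray w v)\<bar>))"
      proof (cases "Im w > 0")
        case True
        then have *: "Im (ray w v) > 0" by (simp add: Im_w)
        show ?thesis
          by (rule order_trans[OF norm_lattice_kernel_upper_le[OF * a(1)]])
             (intro mult_mono; use * a \<theta> in simp)
      next
        case False
        then have *: "Im (ray w v) < 0" using Im0 by (simp add: Im_w mult_pos_neg)
        have "exp (2 * pi * (1 - \<theta>) * Im (ray w v) / a) \<le> 1"
          using * a \<theta> by (auto simp: divide_le_0_iff mult_le_0_iff)
        moreover have "a / (2 * pi * Im (ray w v)) \<le> 0"
          using * a by (intro divide_nonneg_nonpos mult_nonneg_nonpos) auto
        ultimately have "exp (2 * pi * (1 - \<theta>) * Im (ray w v) / a) * (1 - a / (2 * pi * Im (ray w v)))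
            \<le> 1 * (1 - a / (2 * pi * Im (ray w v)))"
          by (intro mult_right_mono) auto
        with norm_lattice_kernel_lower_le[OF * a(1), of \<theta> \<rho>] show ?thesis
          using * by simp
      qed
      also have "a / (2 * pi * \<bar>Im (ray w v)\<bar>) = B * exp (- v)"
        by (simp add: Im_w B_def abs_mult exp_minus field_simps)
      also have "1 * (1 + B * exp (- v)) \<le> exp \<bar>v\<bar> + B * exp \<bar>v\<bar>"
        using B by (simp add: add_mono mult_left_mono)
      finally show ?thesis by (simp add: algebra_simps)
    qed
    show "integrable lborel (\<lambda>v. \<kappa> (ray w v) * ray w v)"
    proof (rule integrable_ray[OF cont _ e Im0(2), where K = "K * (1 + B)" and m = 1])
      fix v
      have "norm (\<kappa> (ray w v)) \<le> (K * exp (- e * (norm (ray w v) + 1 / norm (ray w v)))) * ((1 + B) * exp \<bar>v\<bar>)"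
        unfolding \<kappa>_def norm_mult using W[of v] kb[of v] K
        by (intro mult_mono bound) (auto simp: W_def)
      then show "norm (\<kappa> (ray w v)) \<le> K * (1 + B) * (exp (1 * \<bar>v\<bar>) * exp (- e * (exp v * norm w + 1 / (exp v * norm w))))"
        by (simp add: mult_ac)
    qed
  qed
  have "(\<lambda>n. P (ray p (ln (yy n))) - P (ray p (ln (xx n)))) \<longlonglongrightarrow> ray_integral p \<kappa>"
    by (rule ray_tendsto_primitive[OF P[OF ray_H(1)] int(2,1) ln_lims]) auto
  moreover have "(\<lambda>n. Q (ray q (ln (yy n))) - Q (ray q (ln (xx n)))) \<longlonglongrightarrow> ray_integral q \<kappa>"
    by (rule ray_tendsto_primitive[OF Q[OF ray_H(2)] int(2,1) ln_lims]) auto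
  ultimately have "(\<lambda>n. (P (ray p (ln (yy n))) - P (ray p (ln (xx n)))) - (Q (ray q (ln (yy n))) - Q (ray q (ln (xx n))))
      - (D (yy n) - D (xx n) - S n)) \<longlonglongrightarrow> ray_integral p \<kappa> - ray_integral q \<kappa> - 0"
    by (intro tendsto_diff err)
  then have "S \<longlonglongrightarrow> ray_integral p \<kappa> - ray_integral q \<kappa>"
    by (simp add: D_def algebra_simps)
  then show ?thesis
    unfolding sums_def S_def \<kappa>_def p_def q_def .
qed

section \<open>The summation formula in the variable t of \<open>damped_Phi\<close>\<close>

lemma ray_integral_scale:
  assumes "r > 0"
  shows "ray_integral (of_real r * p) f = ray_integral p f"
proof -
  have "ray (of_real r * p) v = ray p (ln r + 1 * v)" for v
    using assms by (simp add: ray_def exp_add mult_ac)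
  then show ?thesis
    using lborel_integral_real_affine[of 1 "\<lambda>v. f (ray p v) * ray p v" "ln r"]
    by (simp add: ray_integral_def)
qed

text \<open>After the substitution t = u \<epsilon>, only the kernel depends on \<epsilon>;
  \<open>p\<close> is the direction of t.\<close>

definition lattice_ray_integral :: "nat \<Rightarrow> real \<Rightarrow> real \<Rightarrow> real \<Rightarrow> complex \<Rightarrow> complex \<Rightarrow> complex" where
  "lattice_ray_integral k \<theta> a \<rho> \<epsilon> p =
     ray_integral p (\<lambda>t. damped_Phi k t * lattice_kernel \<theta> a \<rho> (t / \<epsilon>))"

lemma ray_integral_eq_lattice_ray_integral:
  assumes "\<epsilon> \<noteq> 0"
  shows "\<epsilon> * ray_integral (p / \<epsilon>) (\<lambda>u. damped_Phi k (u * \<epsilon>) * lattice_kernel \<theta> a \<rho> u)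
    = lattice_ray_integral k \<theta> a \<rho> \<epsilon> p"
proof -
  have r: "ray (p / \<epsilon>) v = ray p v / \<epsilon>" for v
    by (simp add: ray_def)
  show ?thesis
    unfolding lattice_ray_integral_def ray_integral_def r integral_mult_right_zero[symmetric]
    using assms by (intro Bochner_Integration.integral_cong) (auto simp: field_simps)
qed

text \<open>In the u-plane the rays have angles \<delta> and - (pi / 2 - 2 \<delta>), one on each
  side of the lattice. Multiplication by \<epsilon> rotates them to pi / 2 - \<delta> and 0, so the
  wedge between them stays in a sector where \<open>damped_Phi\<close> decays at both ends.\<close>

lemma lattice_sum_damped_Phi:
  fixes \<delta> \<kappa> a \<rho> \<theta> :: real
  defines "\<epsilon> \<equiv> of_real \<kappa> * cis (pi / 2 - 2 * \<delta>)"
  assumes \<delta>: "0 < \<delta>" "\<delta> < pi / 4" and \<kappa>: "\<kappa> > 0" and k: "k \<ge> 1"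
    and \<theta>: "0 \<le> \<theta>" "\<theta> \<le> 1" and a: "a > 0" "0 < \<rho>" "\<rho> \<le> a"
  shows "(\<lambda>m. of_real a * \<epsilon> * (cis (2 * pi * \<theta>) ^ m * damped_Phi k (of_real (\<rho> + a * real m) * \<epsilon>))) sums
    (lattice_ray_integral k \<theta> a \<rho> \<epsilon> (cis (pi / 2 - \<delta>)) - lattice_ray_integral k \<theta> a \<rho> \<epsilon> 1)"
proof -
  define \<alpha> where "\<alpha> = pi / 2 - 2 * \<delta>"
  have \<alpha>: "0 < \<alpha>" "\<alpha> < pi / 2" using \<delta> by (auto simp: \<alpha>_def)
  have \<delta>2: "\<delta> < pi / 2" using \<delta> pi_gt_zero by linarith
  have pos: "sin \<delta> > 0" "cos \<delta> > 0" "sin \<alpha> > 0" "cos \<alpha> > 0"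
    using \<alpha> \<delta> \<delta>2 pi_gt_zero by (auto intro!: sin_gt_zero cos_gt_zero)
  define T T' where "T = tan \<delta>" and "T' = tan \<alpha>"
  have T: "T > 0" "T' > 0" using pos by (auto simp: T_def T'_def tan_def)
  have \<epsilon>: "\<epsilon> \<noteq> 0" "norm \<epsilon> = \<kappa>" using \<kappa> by (auto simp: \<epsilon>_def norm_mult)
  define H where "H = {u. Re (u * \<epsilon>) > 0}"
  have H_eq: "H = {u. 0 < inner (cnj \<epsilon>) u}"
    by (auto simp: H_def inner_complex_def mult.commute)
  define s where "s = sin \<delta> / cos \<delta>"
  have s: "s > 0" using pos by (simp add: s_def)
  define c where "c = s / (1 + T + T')"
  have c: "c > 0" using s T by (simp add: c_def)
  have wedge: "u \<noteq> 0 \<and> Re (u * \<epsilon>) \<ge> c * norm (u * \<epsilon>)" if u: "Re u > 0" "- T' * Re u \<le> Im u" "Im u \<le> T * Re u" for u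
  proof -
    \<comment> \<open>On the upper edge, where u is a multiple of 1 + i tan \<delta>, the point u
      \<epsilon> has angle pi / 2 - \<delta>. Its real part is then \<kappa> tan \<delta> Re u, the
      smallest value for given Re u in the wedge.\<close>
    have "\<kappa> * (s * Re u) = \<kappa> * (Re u * cos \<alpha> - T * Re u * sin \<alpha>)"
    proof -
      have "sin \<delta> = s * cos \<delta>"
        using pos by (simp add: s_def)
      then have "cos \<alpha> = s * (2 * cos \<delta> ^ 2)"
        by (simp add: \<alpha>_def cos_diff sin_double power2_eq_square)
      moreover have "sin \<alpha> = 2 * cos \<delta> ^ 2 - 1"
        by (simp add: \<alpha>_def sin_diff cos_double_cos)
      ultimately have "cos \<alpha> - T * sin \<alpha> = s"
        unfolding T_def tan_def s_def[symmetric] by (simp only:) (simp add: algebra_simps)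
      then have "s * Re u = Re u * cos \<alpha> - T * Re u * sin \<alpha>"
        by (simp add: algebra_simps)
      then show ?thesis by simp
    qed
    also have "\<dots> \<le> \<kappa> * (Re u * cos \<alpha> - Im u * sin \<alpha>)"
      using u \<kappa> pos by (intro mult_left_mono diff_left_mono mult_right_mono) auto
    also have "\<dots> = Re (u * \<epsilon>)"
      unfolding \<epsilon>_def \<alpha>_def[symmetric] by (simp add: algebra_simps)
    finally have 1: "\<kappa> * (s * Re u) \<le> Re (u * \<epsilon>)" .
    have "0 \<le> T * Re u" "0 \<le> T' * Re u"
      using u T by auto
    with u have "\<bar>Im u\<bar> \<le> (T + T') * Re u"
      by (simp add: abs_le_iff ring_distribs)
    then have "norm u \<le> (1 + T + T') * Re u"
      using cmod_le[of u] u by (simp add: algebra_simps)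
    then have "c * norm u \<le> c * ((1 + T + T') * Re u)"
      using c by (intro mult_left_mono) auto
    also have "\<dots> = s * Re u"
      using T by (simp add: c_def)
    finally have "\<kappa> * (c * norm u) \<le> \<kappa> * (s * Re u)"
      using \<kappa> by (intro mult_left_mono) auto
    with 1 have "c * norm (u * \<epsilon>) \<le> Re (u * \<epsilon>)"
      by (simp add: norm_mult \<epsilon> mult_ac)
    then show ?thesis using u by auto
  qed
  obtain K e where Ke: "K > 0" "e > 0"
    "\<And>t. t \<noteq> 0 \<Longrightarrow> Re t \<ge> c * norm t \<Longrightarrow> norm (damped_Phi k t) \<le> K * exp (- e * (norm t + 1 / norm t))"
    using damped_Phi_sector_bound[OF c k] by blast
  \<comment> \<open>Since |u \<epsilon>| = \<kappa> |u|, the decay at infinity is rescaled by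
    \<kappa> and the decay at 0 by 1 / \<kappa>; the smaller factor serves both.\<close>
  define e' where "e' = e * min \<kappa> (1 / \<kappa>)"
  have e': "e' > 0" using Ke \<kappa> by (simp add: e'_def)
  let ?f = "\<lambda>u. damped_Phi k (u * \<epsilon>) * lattice_kernel \<theta> a \<rho> u"
  have "(\<lambda>m. of_real a * (cis (2 * pi * \<theta>) ^ m * damped_Phi k (of_real (\<rho> + a * real m) * \<epsilon>))) sums
    (ray_integral (Complex 1 T) ?f - ray_integral (Complex 1 (- T')) ?f)"
  proof (rule lattice_sum_eq_ray_integrals[where K = K and e = e' and H = H, OF _ _ _ _ _ T e' \<theta> a])
    show "open H" "convex H"
      unfolding H_eq by (auto intro: open_halfspace_gt convex_halfspace_gt)
    have "(damped_Phi k \<circ> (\<lambda>u. u * \<epsilon>)) holomorphic_on H"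
      by (rule holomorphic_on_compose_gen[OF _ holomorphic_damped_Phi]) (auto intro!: holomorphic_intros simp: H_def)
    then show "(\<lambda>u. damped_Phi k (u * \<epsilon>)) holomorphic_on H"
      by (simp add: o_def)
    fix u assume u: "Re u > 0" "- T' * Re u \<le> Im u" "Im u \<le> T * Re u"
    have u0: "u \<noteq> 0" "u * \<epsilon> \<noteq> 0" "Re (u * \<epsilon>) \<ge> c * norm (u * \<epsilon>)"
      using wedge[OF u] \<epsilon> by auto
    have "0 < c * norm (u * \<epsilon>)" using u0 c by simp
    then show "u \<in> H"
      using u0 by (simp add: H_def del: norm_mult)
    have "norm (damped_Phi k (u * \<epsilon>)) \<le> K * exp (- e * (norm (u * \<epsilon>) + 1 / norm (u * \<epsilon>)))"
      using u0 by (intro Ke) auto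
    also have "\<dots> \<le> K * exp (- e' * (norm u + 1 / norm u))"
    proof -
      have "min \<kappa> (1 / \<kappa>) * (norm u + 1 / norm u) \<le> \<kappa> * norm u + (1 / \<kappa>) * (1 / norm u)"
        unfolding distrib_left by (intro add_mono mult_right_mono) auto
      then have "e * (min \<kappa> (1 / \<kappa>) * (norm u + 1 / norm u)) \<le> e * (\<kappa> * norm u + (1 / \<kappa>) * (1 / norm u))"
        using Ke by (intro mult_left_mono) auto
      then show ?thesis
        using Ke(1) by (simp add: e'_def norm_mult \<epsilon> mult_ac)
    qed
    finally show "norm (damped_Phi k (u * \<epsilon>)) \<le> K * exp (- e' * (norm u + 1 / norm u))" .
  qed
  then have "(\<lambda>m. \<epsilon> * (of_real a * (cis (2 * pi * \<theta>) ^ m * damped_Phi k (of_real (\<rho> + a * real m) * \<epsilon>)))) sums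
    (\<epsilon> * (ray_integral (Complex 1 T) ?f - ray_integral (Complex 1 (- T')) ?f))"
    by (rule sums_mult)
  moreover have "\<epsilon> * ray_integral (Complex 1 T) ?f = lattice_ray_integral k \<theta> a \<rho> \<epsilon> (cis (pi / 2 - \<delta>))"
  proof -
    have "Complex 1 T = of_real (\<kappa> / cos \<delta>) * (cis (pi / 2 - \<delta>) / \<epsilon>)"
    proof -
      have "cis (pi / 2 - \<delta>) / cis \<alpha> = cis (pi / 2 - \<delta> - \<alpha>)"
        by (rule cis_divide)
      also have "pi / 2 - \<delta> - \<alpha> = \<delta>" by (simp add: \<alpha>_def)
      finally have eq: "cis (pi / 2 - \<delta>) / \<epsilon> = cis \<delta> / of_real \<kappa>"
        unfolding \<epsilon>_def \<alpha>_def[symmetric] by (simp add: field_simps)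
      show ?thesis
        unfolding eq using \<kappa> pos by (simp add: T_def tan_def complex_eq_iff)
    qed
    then show ?thesis
      using ray_integral_scale[of "\<kappa> / cos \<delta>" "cis (pi / 2 - \<delta>) / \<epsilon>" ?f] \<kappa> pos
        ray_integral_eq_lattice_ray_integral[OF \<epsilon>(1)] by simp
  qed
  moreover have "\<epsilon> * ray_integral (Complex 1 (- T')) ?f = lattice_ray_integral k \<theta> a \<rho> \<epsilon> 1"
  proof -
    have "Complex 1 (- T') = of_real (\<kappa> / cos \<alpha>) * (1 / \<epsilon>)"
    proof -
      have eq: "1 / \<epsilon> = cis (- \<alpha>) / of_real \<kappa>"
        unfolding \<epsilon>_def \<alpha>_def[symmetric] cis_inverse[symmetric] by (simp add: divide_inverse)
      show ?thesis
        unfolding eq using \<kappa> pos by (simp add: T'_def tan_def complex_eq_iff)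
    qed
    then show ?thesis
      using ray_integral_scale[of "\<kappa> / cos \<alpha>" "1 / \<epsilon>" ?f] \<kappa> pos
        ray_integral_eq_lattice_ray_integral[OF \<epsilon>(1)] by simp
  qed
  ultimately show ?thesis
    by (simp add: right_diff_distrib mult_ac)
qed

text \<open>Multiplied by cis (\<psi> / 2), the integral is that of exp (- s^2) along a rotated
  line, and rotating the line back to the real axis makes it a positive Gaussian integral.\<close>

lemma complex_Gaussian_nonzero:
  assumes "\<bar>\<psi>\<bar> < pi / 2"
  shows "(\<integral>y. exp (- (cis \<psi> * of_real (y ^ 2))) \<partial>lborel) \<noteq> (0 :: complex)"
proof -
  define w where "w = cis (\<psi> / 2)"
  have w2: "w ^ 2 = cis \<psi>"
    by (simp add: w_def Complex.DeMoivre)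
  define c where "c = cos \<psi>"
  have c: "c > 0" "c \<le> 1" using assms by (auto simp: c_def intro: cos_gt_zero_pi)
  define C S where "C = cos (\<psi> / 2)" and "S = sin (\<psi> / 2)"
  have CS: "C ^ 2 - S ^ 2 = c" "C ^ 2 + S ^ 2 = 1"
    using cos_double[of "\<psi> / 2"] by (auto simp: C_def S_def c_def)
  have C0: "C > 0" unfolding C_def using assms by (intro cos_gt_zero_pi) auto
  have "C \<ge> c"
  proof -
    have "C ^ 2 \<le> C * 1" unfolding power2_eq_square using C0 by (intro mult_left_mono) (auto simp: C_def)
    then show ?thesis using CS by (auto simp: power2_eq_square) (smt (verit) zero_le_square)
  qed
  have "\<exists>P. \<forall>s::complex. (P has_field_derivative exp (- (s ^ 2))) (at s)"
  proof (rule holomorphic_convex_primitive'[OF convex_UNIV open_UNIV, of "\<lambda>s. exp (- (s ^ 2))"])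
    show "(\<lambda>s::complex. exp (- (s ^ 2))) holomorphic_on UNIV"
      by (intro holomorphic_intros)
    fix g :: "complex \<Rightarrow> complex"
    assume "\<And>x. x \<in> UNIV \<Longrightarrow> (g has_field_derivative exp (- (x ^ 2))) (at x)"
    then show "\<exists>P. \<forall>s::complex. (P has_field_derivative exp (- (s ^ 2))) (at s)"
      by (intro exI[of _ g]) simp
  qed
  then obtain P where P: "\<And>s::complex. (P has_field_derivative exp (- (s ^ 2))) (at s)"
    by metis
  define f where "f v y = exp (- (v ^ 2 * of_real (y ^ 2))) * v" for v :: complex and y :: real
  have norm_f: "norm (f v y) = norm v * exp (- Re (v ^ 2) * y ^ 2)" for v y
    by (simp add: f_def norm_mult)
  have int_f: "integrable lborel (f v)" if "Re (v ^ 2) > 0" for v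
  proof (rule Bochner_Integration.integrable_bound)
    show "integrable lborel (\<lambda>y. norm v * exp (0 * \<bar>y\<bar> - Re (v ^ 2) * y ^ 2))"
      by (intro integrable_mult_right integrable_exp_abs_square that)
    show "f v \<in> borel_measurable lborel" unfolding f_def by measurable
  qed (simp add: norm_f)
  have conv: "(\<lambda>n. P (of_real (real n) * v) - P (of_real (- real n) * v)) \<longlonglongrightarrow> (\<integral>y. f v y \<partial>lborel)"
    if v: "Re (v ^ 2) > 0" for v
  proof -
    have "(\<lambda>n. \<integral>y. indicator {- real n..real n} y *\<^sub>R f v y \<partial>lborel) \<longlonglongrightarrow> (\<integral>y. f v y \<partial>lborel)"
    proof (rule integral_dominated_convergence[where w = "\<lambda>y. norm (f v y)"])
      show "AE y in lborel. (\<lambda>n. indicator {- real n..real n} y *\<^sub>R f v y) \<longlonglongrightarrow> f v y"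
      proof (intro AE_I2 tendsto_eventually)
        fix y
        have "eventually (\<lambda>n. \<bar>y\<bar> \<le> real n) sequentially"
          using filterlim_real_sequentially by (auto simp: filterlim_at_top)
        then show "eventually (\<lambda>n. indicator {- real n..real n} y *\<^sub>R f v y = f v y) sequentially"
          by eventually_elim (simp add: abs_le_iff)
      qed
    qed (use int_f[OF v] in \<open>auto simp: indicator_def\<close>)
    moreover have "(\<integral>y. indicator {- real n..real n} y *\<^sub>R f v y \<partial>lborel) = P (of_real (real n) * v) - P (of_real (- real n) * v)" for n
    proof (rule integral_FTC_Icc)
      show "((\<lambda>y. P (of_real y * v)) has_vector_derivative f v y) (at y within {- real n..real n})" for y
      proof -
        have "((\<lambda>z. P (z * v)) has_field_derivative f v y) (at (of_real y))"
          using DERIV_chain2[OF P, of "\<lambda>z. z * v" v "of_real y"]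
          by (simp add: f_def power_mult_distrib mult_ac DERIV_cmult_right[OF DERIV_ident, simplified])
        from has_vector_derivative_real_field[OF this]
        show ?thesis by (simp add: o_def)
      qed
      show "continuous_on {- real n..real n} (f v)"
        unfolding f_def by (intro continuous_intros)
    qed simp
    ultimately show ?thesis by simp
  qed
  have seg: "norm (P (of_real R * w) - P (of_real R)) \<le> exp (- c * R ^ 2) * (2 * \<bar>R\<bar>)" for R
  proof -
    have "norm (P (of_real R * w) - P (of_real R)) \<le> exp (- c * R ^ 2) * norm (of_real R * w - of_real R)"
    proof (rule norm_primitive_diff_le[OF P])
      fix s assume "s \<in> closed_segment (of_real R * w) (of_real R)"
      then obtain u where u: "0 \<le> u" "u \<le> 1" "s = (1 - u) *\<^sub>R (of_real R * w) + u *\<^sub>R of_real R"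
        unfolding in_segment by blast
      have "s = of_real R * Complex ((1 - u) * C + u) ((1 - u) * S)"
        by (simp add: u(3) w_def C_def S_def complex_eq_iff algebra_simps)
      then have "Re (s ^ 2) = R ^ 2 * (((1 - u) * C + u) ^ 2 - ((1 - u) * S) ^ 2)"
        by (simp add: power_mult_distrib Re_power2 flip: of_real_power)
      also have "((1 - u) * C + u) ^ 2 - ((1 - u) * S) ^ 2 = (1 - u) ^ 2 * (C ^ 2 - S ^ 2) + 2 * u * (1 - u) * C + u ^ 2"
        by (simp add: power2_eq_square algebra_simps)
      \<comment> \<open>The weights (1 - u)^2, 2 u (1 - u) and u^2 add up to 1 and multiply c, C and
        1, each at least c. Hence exp (- s^2) is small on the whole chord that closes the
        contour.\<close>
      also have "R ^ 2 * \<dots> \<ge> R ^ 2 * ((1 - u) ^ 2 * c + 2 * u * (1 - u) * c + u ^ 2 * c)"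
        unfolding CS(1) using u c \<open>C \<ge> c\<close>
        by (intro mult_left_mono add_mono mult_left_le) (auto simp: mult_left_le)
      also have "(1 - u) ^ 2 * c + 2 * u * (1 - u) * c + u ^ 2 * c = c"
        by (simp add: power2_eq_square algebra_simps)
      finally have "c * R ^ 2 \<le> Re (s ^ 2)" by (simp add: mult.commute)
      then show "norm (exp (- (s ^ 2))) \<le> exp (- c * R ^ 2)" by simp
    qed
    also have "norm (of_real R * w - of_real R) \<le> 2 * \<bar>R\<bar>"
      using norm_triangle_ineq4[of "of_real R * w" "of_real R"] by (simp add: norm_mult w_def)
    finally show ?thesis by (simp add: mult_left_mono)
  qed
  have lim0: "(\<lambda>n. exp (- c * R n ^ 2) * (2 * \<bar>R n\<bar>)) \<longlonglongrightarrow> 0" if "R = real \<or> R = (\<lambda>n. - real n)" for R :: "nat \<Rightarrow> real"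
  proof -
    have "(\<lambda>n. exp (- c * real n ^ 2) * (2 * real n)) \<longlonglongrightarrow> 0"
      using c by real_asymp
    then show ?thesis using that by auto
  qed
  have "(\<lambda>n. P (of_real (R n) * w) - P (of_real (R n))) \<longlonglongrightarrow> 0"
    if "R = real \<or> R = (\<lambda>n. - real n)" for R :: "nat \<Rightarrow> real"
    by (rule Lim_null_comparison[OF always_eventually lim0[OF that]]) (use seg in blast)
  note this[of real] this[of "\<lambda>n. - real n"]
  then have "(\<lambda>n. P (of_real (real n) * w) - P (of_real (real n))) \<longlonglongrightarrow> 0"
       "(\<lambda>n. P (of_real (- real n) * w) - P (of_real (- real n))) \<longlonglongrightarrow> 0"
    by simp_all
  from tendsto_diff[OF this] have "(\<lambda>n. (P (of_real (real n) * w) - P (of_real (- real n) * w))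
      - (P (of_real (real n) * 1) - P (of_real (- real n) * 1))) \<longlonglongrightarrow> 0"
    by (simp add: algebra_simps)
  moreover have "(\<lambda>n. (P (of_real (real n) * w) - P (of_real (- real n) * w))
      - (P (of_real (real n) * 1) - P (of_real (- real n) * 1))) \<longlonglongrightarrow> (\<integral>y. f w y \<partial>lborel) - (\<integral>y. f 1 y \<partial>lborel)"
    using c by (intro tendsto_diff conv) (auto simp: w2 c_def)
  ultimately have "(\<integral>y. f w y \<partial>lborel) = (\<integral>y. f 1 y \<partial>lborel)"
    using LIMSEQ_unique by fastforce
  also have "f 1 = (\<lambda>y. of_real (exp (- (y ^ 2))))"
    by (simp add: f_def fun_eq_iff exp_of_real [symmetric])
  also have "(\<integral>y. of_real (exp (- (y ^ 2))) \<partial>lborel) = (of_real (\<integral>y. exp (- (y ^ 2)) \<partial>lborel) :: complex)"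
    by (rule integral_complex_of_real)
  finally have "(\<integral>y. f w y \<partial>lborel) = of_real (\<integral>y. exp (- (y ^ 2)) \<partial>lborel)" .
  moreover have "(\<integral>y. exp (- (y ^ 2)) \<partial>lborel) > (0::real)"
  proof -
    have "integrable lborel (\<lambda>y::real. exp (- (y ^ 2)))"
      using integrable_exp_abs_square[of 1 0] by simp
    then show ?thesis
      by (rule lborel_integral_pos) simp
  qed
  ultimately have "(\<integral>y. f w y \<partial>lborel) \<noteq> 0"
    by (metis less_irrefl of_real_eq_0_iff)
  then show ?thesis
    by (auto simp: f_def w2)
qed

section \<open>Asymptotics of the ray integrals\<close>

lemma ray_cis_divide:
  assumes "\<kappa> > 0"
  shows "ray (cis \<psi>) v / (of_real \<kappa> * cis \<alpha>) = of_real (exp v / \<kappa>) * cis (\<psi> - \<alpha>)"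
  using assms by (simp add: ray_def cis_divide[symmetric])

lemma continuous_on_damped_Phi_ray:
  assumes "Re p > 0"
  shows "continuous_on UNIV (\<lambda>v. damped_Phi k (ray p v))"
  by (rule continuous_on_compose2[OF holomorphic_on_imp_continuous_on[OF holomorphic_damped_Phi] continuous_on_ray])
     (use assms in \<open>auto simp: ray_def\<close>)

lemma continuous_on_lattice_kernel_ray:
  assumes "a > 0" "Im (p / \<epsilon>) \<noteq> 0" "\<epsilon> \<noteq> 0"
  shows "continuous_on UNIV (\<lambda>v. lattice_kernel \<theta> a \<rho> (ray p v / \<epsilon>))"
proof (rule continuous_on_compose2[OF holomorphic_on_imp_continuous_on[OF lattice_kernel_holomorphic_nonreal[of a "{u. Im u \<noteq> 0}"]]])
  have "ray p v / \<epsilon> = of_real (exp v) * (p / \<epsilon>)" for v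
    by (simp add: ray_def)
  then have "Im (ray p v / \<epsilon>) = exp v * Im (p / \<epsilon>)" for v
    by (metis Im_complex_of_real Re_complex_of_real add.right_neutral mult_zero_left times_complex.sel(2))
  then show "(\<lambda>v. ray p v / \<epsilon>) ` UNIV \<subseteq> {u. Im u \<noteq> 0}"
    using assms(2) by (simp add: image_subset_iff)
qed (use assms in \<open>auto intro!: continuous_intros\<close>)

lemma lattice_kernel_tendsto:
  assumes "filterlim (\<lambda>n. Im (u n)) at_top F" "a > 0"
  shows "((\<lambda>n. 1 / (1 - exp (2 * of_real pi * \<i> * (u n - of_real \<rho>) / of_real a))) \<longlongrightarrow> 1) F"
proof -
  have exp_lim: "((\<lambda>n. exp (- (2 * pi / a * Im (u n)))) \<longlongrightarrow> 0) F"
  proof (rule filterlim_compose[OF exp_at_bot])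
    show "filterlim (\<lambda>n. - (2 * pi / a * Im (u n))) at_bot F"
      unfolding filterlim_uminus_at_top[symmetric]
      using assms by (intro filterlim_tendsto_pos_mult_at_top[OF tendsto_const]) auto
  qed
  have eq: "norm (exp (2 * of_real pi * \<i> * (u n - of_real \<rho>) / of_real a)) = exp (- (2 * pi / a * Im (u n)))" for n
    by simp
  have "((\<lambda>n. exp (2 * of_real pi * \<i> * (u n - of_real \<rho>) / of_real a)) \<longlongrightarrow> 0) F"
    by (rule tendsto_norm_zero_cancel) (simp only: eq exp_lim)
  then have "((\<lambda>n. 1 / (1 - exp (2 * of_real pi * \<i> * (u n - of_real \<rho>) / of_real a))) \<longlongrightarrow> 1 / (1 - 0)) F"
    by (intro tendsto_intros) auto
  then show ?thesis by simp
qed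

text \<open>For \<theta> = 0 the kernel tends to 1 pointwise on the upper ray, so the lattice sum
  behaves like a Riemann sum and the limit requires no normalisation. The decay of
  \<open>damped_Phi\<close> dominates the growth of the kernel near t = 0.\<close>

lemma upper_ray_integral_tendsto:
  fixes \<kappa> :: "nat \<Rightarrow> real"
  assumes \<delta>: "0 < \<delta>" "\<delta> < pi / 4" and k: "k \<ge> 1" and a: "a > 0"
    and \<kappa>: "\<And>n. 0 < \<kappa> n" "\<And>n. \<kappa> n \<le> 1" "\<kappa> \<longlonglongrightarrow> 0"
  shows "(\<lambda>n. lattice_ray_integral k 0 a \<rho> (of_real (\<kappa> n) * cis (pi / 2 - 2 * \<delta>)) (cis (pi / 2 - \<delta>)))
    \<longlonglongrightarrow> ray_integral (cis (pi / 2 - \<delta>)) (damped_Phi k)"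
proof -
  define p where "p = cis (pi / 2 - \<delta>)"
  define \<epsilon> where "\<epsilon> n = of_real (\<kappa> n) * cis (pi / 2 - 2 * \<delta>)" for n
  have pos: "sin \<delta> > 0" using \<delta> pi_gt_zero by (intro sin_gt_zero) linarith+
  have p: "norm p = 1" "Re p \<ge> sin \<delta>" "Re p > 0"
    using pos by (auto simp: p_def cos_diff)
  have \<epsilon>: "\<epsilon> n \<noteq> 0" for n using \<kappa>(1)[of n] by (auto simp: \<epsilon>_def)
  have u: "ray p v / \<epsilon> n = of_real (exp v / \<kappa> n) * cis \<delta>" for v n
    unfolding p_def \<epsilon>_def using ray_cis_divide[OF \<kappa>(1)] by simp
  have Im_u: "Im (ray p v / \<epsilon> n) = exp v / \<kappa> n * sin \<delta>" for v n
    unfolding u by simp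
  have Im_p: "Im (p / \<epsilon> n) \<noteq> 0" for n
    using Im_u[of 0 n] pos \<kappa>(1)[of n] by (auto simp: ray_def)
  obtain K e where Ke: "K > 0" "e > 0"
    "\<And>t. t \<noteq> 0 \<Longrightarrow> Re t \<ge> sin \<delta> * norm t \<Longrightarrow> norm (damped_Phi k t) \<le> K * exp (- e * (norm t + 1 / norm t))"
    using damped_Phi_sector_bound[OF pos k] by blast
  define B where "B = a / (2 * pi * sin \<delta>)"
  have B: "B > 0" using a pos by (simp add: B_def)
  have gK: "norm (damped_Phi k (ray p v)) \<le> K * exp (- e * v ^ 2)" for v
  proof -
    have "norm (damped_Phi k (ray p v)) \<le> K * exp (- e * (norm (ray p v) + 1 / norm (ray p v)))"
    proof (rule Ke(3))
      show "ray p v \<noteq> 0" using p by (auto simp: ray_def)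
      show "sin \<delta> * norm (ray p v) \<le> Re (ray p v)"
        using p by (simp add: ray_def norm_mult mult.commute)
    qed
    also have "\<dots> \<le> K * exp (- e * v ^ 2)"
    proof (intro mult_left_mono)
      have "v ^ 2 \<le> exp v + 1 / exp v"
        using exp_plus_inverse_ge[of v] by linarith
      then show "exp (- e * (norm (ray p v) + 1 / norm (ray p v))) \<le> exp (- e * v ^ 2)"
        using p Ke by simp
    qed (use Ke in auto)
    finally show ?thesis .
  qed
  have kb: "norm (lattice_kernel 0 a \<rho> (ray p v / \<epsilon> n)) \<le> (1 + B) * exp \<bar>v\<bar>" for v n
  proof -
    have i: "Im (ray p v / \<epsilon> n) > 0"
      unfolding Im_u using pos \<kappa>(1)[of n] by simp
    have "norm (lattice_kernel 0 a \<rho> (ray p v / \<epsilon> n)) \<le> 1 + a / (2 * pi * Im (ray p v / \<epsilon> n))"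
      using norm_lattice_kernel_upper_le[OF i a, of 0] by simp
    also have "a / (2 * pi * Im (ray p v / \<epsilon> n)) = B * (\<kappa> n * exp (- v))"
      unfolding Im_u B_def by (simp add: exp_minus field_simps)
    also have "1 + B * (\<kappa> n * exp (- v)) \<le> exp \<bar>v\<bar> + B * (1 * exp \<bar>v\<bar>)"
      using B \<kappa>(1,2)[of n] by (intro add_mono mult_left_mono mult_mono) (auto simp: less_imp_le)
    finally show ?thesis by (simp add: algebra_simps)
  qed
  let ?J = "\<lambda>n v. damped_Phi k (ray p v) * lattice_kernel 0 a \<rho> (ray p v / \<epsilon> n) * ray p v"
  have "(\<lambda>n. \<integral>v. ?J n v \<partial>lborel)
    \<longlonglongrightarrow> (\<integral>v. damped_Phi k (ray p v) * ray p v \<partial>lborel)"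
  proof (rule integral_dominated_convergence[where w = "\<lambda>v. K * (1 + B) * exp (2 * \<bar>v\<bar> - e * v ^ 2)"])
    show "integrable lborel (\<lambda>v. K * (1 + B) * exp (2 * \<bar>v\<bar> - e * v ^ 2))"
      using Ke by (intro integrable_mult_right integrable_exp_abs_square)
    show "(\<lambda>v. damped_Phi k (ray p v) * ray p v) \<in> borel_measurable lborel"
      using p by (simp add: borel_measurable_continuous_onI continuous_intros continuous_on_damped_Phi_ray)
    show "(\<lambda>v. ?J n v) \<in> borel_measurable lborel" for n
      using p a Im_p \<epsilon> by (simp add: borel_measurable_continuous_onI continuous_intros continuous_on_damped_Phi_ray continuous_on_lattice_kernel_ray)
    show "AE v in lborel. (\<lambda>n. ?J n v)
       \<longlonglongrightarrow> damped_Phi k (ray p v) * ray p v"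
    proof (intro AE_I2)
      fix v
      have "filterlim \<kappa> (at_right 0) sequentially"
        using \<kappa> by (intro tendsto_imp_filterlim_at_right) auto
      then have "filterlim (\<lambda>n. exp v * sin \<delta> * inverse (\<kappa> n)) at_top sequentially"
        using pos by (intro filterlim_tendsto_pos_mult_at_top[OF tendsto_const] filterlim_compose[OF filterlim_inverse_at_top_right]) auto
      then have "filterlim (\<lambda>n. Im (ray p v / \<epsilon> n)) at_top sequentially"
        unfolding Im_u by (simp add: field_simps)
      from lattice_kernel_tendsto[OF this a, of \<rho>]
      have "(\<lambda>n. lattice_kernel 0 a \<rho> (ray p v / \<epsilon> n)) \<longlonglongrightarrow> 1"
        by (simp add: lattice_kernel_def)
      from tendsto_mult[OF tendsto_mult[OF tendsto_const this] tendsto_const]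
      show "(\<lambda>n. ?J n v)
        \<longlonglongrightarrow> damped_Phi k (ray p v) * ray p v" by fastforce
    qed
    show "AE v in lborel. norm (?J n v)
      \<le> K * (1 + B) * exp (2 * \<bar>v\<bar> - e * v ^ 2)" for n
    proof (intro AE_I2)
      fix v
      have "norm (?J n v)
        \<le> (K * exp (- e * v ^ 2)) * ((1 + B) * exp \<bar>v\<bar>) * exp \<bar>v\<bar>"
        unfolding norm_mult[of _ "ray p v"] norm_mult[of "damped_Phi k (ray p v)"]
        using gK[of v] kb[of v n] Ke B p by (intro mult_mono) auto
      also have "\<dots> = K * (1 + B) * exp (2 * \<bar>v\<bar> - e * v ^ 2)"
        by (simp add: mult_exp_exp mult_ac)
      finally show "norm (?J n v)
        \<le> K * (1 + B) * exp (2 * \<bar>v\<bar> - e * v ^ 2)" .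
    qed
  qed
  then show ?thesis
    unfolding lattice_ray_integral_def ray_integral_def p_def \<epsilon>_def .
qed

text \<open>A quarter of x + 1 / x absorbs the logarithm in the remainder. As A \<ge> 1, this leaves
  three quarters of A / x, an explicit share that the estimate of the lower ray then divides
  up.\<close>

lemma damped_Phi_real_bound:
  assumes k: "k \<ge> 1"
  defines "A \<equiv> real k * pi ^ 2 / 6"
  obtains K where "K > 0"
    "\<And>x. x > 0 \<Longrightarrow> norm (damped_Phi k (of_real x)) \<le> K * exp (- x / 2 - 3 / 4 * A / x)"
proof -
  obtain C where C: "C \<ge> 0"
    "\<And>t. t \<noteq> 0 \<Longrightarrow> Re t \<ge> 1 * norm t \<Longrightarrow> norm (log_Phi_rem t) \<le> C * (1 + \<bar>ln (norm t)\<bar>)"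
    using log_Phi_rem_sector_bound[of 1] by auto
  obtain M where M: "M \<ge> 0" "\<And>r. r > 0 \<Longrightarrow> real k * C * \<bar>ln r\<bar> \<le> M + 1 / 4 * (r + 1 / r)"
    using abs_ln_le[of "real k * C" "1 / 4"] C by auto
  have A: "A \<ge> 1"
    unfolding A_def by (rule damped_Phi_exponent_ge_1[OF k])
  show thesis
  proof (rule that[of "exp (real k * C + M)"])
    fix x :: real assume x: "x > 0"
    have "real k * Re (log_Phi_rem (of_real x)) \<le> real k * (C * (1 + \<bar>ln x\<bar>))"
      using C(2)[of "of_real x"] x complex_Re_le_cmod[of "log_Phi_rem (of_real x)"] by (intro mult_left_mono) auto
    also have "\<dots> \<le> real k * C + M + 1 / 4 * (x + 1 / x)"
      using M(2)[OF x] by (simp add: algebra_simps)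
    finally have B: "real k * Re (log_Phi_rem (of_real x)) \<le> real k * C + M + 1 / 4 * (x + 1 / x)" .
    have "norm (damped_Phi k (of_real x)) = exp (- x - A / x + real k * Re (log_Phi_rem (of_real x)))"
      using x by (subst damped_Phi_eq) (simp_all add: A_def)
    also have "\<dots> \<le> exp (real k * C + M + (- x / 2 - 3 / 4 * A / x))"
    proof -
      have "A / x \<ge> 1 / x" using A x by (intro divide_right_mono) auto
      moreover have "3 / 4 * A / x = 3 / 4 * (A / x)" by simp
      ultimately have "- x - A / x + real k * Re (log_Phi_rem (of_real x)) \<le> real k * C + M + (- x / 2 - 3 / 4 * A / x)"
        using B x by (simp add: distrib_left)
      then show ?thesis by simp
    qed
    finally show "norm (damped_Phi k (of_real x)) \<le> exp (real k * C + M) * exp (- x / 2 - 3 / 4 * A / x)"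
      by (simp add: exp_add)
  qed simp
qed

text \<open>On the positive axis the modulus is governed by exp (- A / x - b x), where b is the
  decay rate of the kernel there; the rate in the bound comes from balancing these two
  terms.\<close>

lemma lower_ray_integral_bound:
  assumes \<delta>: "0 < \<delta>" "\<delta> < pi / 4" and k: "k \<ge> 1" and a: "a > 0" and \<theta>: "0 \<le> \<theta>" "\<theta> \<le> 1"
  defines "A \<equiv> real k * pi ^ 2 / 6"
  obtains C where "C \<ge> 0"
    "\<And>\<kappa>. 0 < \<kappa> \<Longrightarrow> \<kappa> \<le> 1 \<Longrightarrow>
       norm (lattice_ray_integral k \<theta> a \<rho> (of_real \<kappa> * cis (pi / 2 - 2 * \<delta>)) 1)
       \<le> C * exp (- sqrt (4 * pi * A * (1 - \<theta>) * cos (2 * \<delta>) / (a * \<kappa>)))"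
proof -
  define \<alpha> where "\<alpha> = pi / 2 - 2 * \<delta>"
  have sin_\<alpha>: "sin \<alpha> = cos (2 * \<delta>)" by (simp add: \<alpha>_def sin_diff)
  have pos: "cos (2 * \<delta>) > 0" using \<delta> by (intro cos_gt_zero) auto
  obtain K where K: "K > 0" "\<And>x. x > 0 \<Longrightarrow> norm (damped_Phi k (of_real x)) \<le> K * exp (- x / 2 - 3 / 4 * A / x)"
    using damped_Phi_real_bound[OF k] unfolding A_def by blast
  have A: "A \<ge> 1"
    unfolding A_def by (rule damped_Phi_exponent_ge_1[OF k])
  define B where "B = a / (2 * pi * cos (2 * \<delta>))"
  have B: "B > 0" using a pos by (simp add: B_def)
  define w where "w v = K * (1 + B) * exp (2 * \<bar>v\<bar> - 1 / 4 * v ^ 2)" for v :: real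
  have w_int: "integrable lborel w"
    unfolding w_def by (intro integrable_mult_right integrable_exp_abs_square) auto
  show thesis
  proof (rule that[of "\<integral>v. w v \<partial>lborel"])
    show "(\<integral>v. w v \<partial>lborel) \<ge> 0"
      using K B by (intro integral_nonneg_AE) (auto simp: w_def)
    fix \<kappa> :: real assume \<kappa>: "0 < \<kappa>" "\<kappa> \<le> 1"
    define \<epsilon> where "\<epsilon> = of_real \<kappa> * cis \<alpha>"
    define b where "b = 2 * pi * (1 - \<theta>) * cos (2 * \<delta>) / (a * \<kappa>)"
    have b: "b \<ge> 0" using \<theta> pos a \<kappa> by (simp add: b_def)
    define R where "R = sqrt (2 * A * b)"
    have Im_u: "Im (ray 1 v / \<epsilon>) = - (exp v / \<kappa> * cos (2 * \<delta>))" for v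
      using ray_cis_divide[OF \<kappa>(1), of 0 v \<alpha>] by (simp add: \<epsilon>_def sin_\<alpha>)
    let ?J = "\<lambda>v. damped_Phi k (ray 1 v) * lattice_kernel \<theta> a \<rho> (ray 1 v / \<epsilon>) * ray 1 v"
    have bound: "norm (?J v) \<le> exp (- R) * w v" for v
    proof -
      have i: "Im (ray 1 v / \<epsilon>) < 0"
        unfolding Im_u using pos \<kappa> by simp
      have alg: "(K * exp x) * (exp y * ((1 + B) * exp z)) * exp z = K * (1 + B) * exp (2 * z + (x + y))" for x y z
        by (simp add: exp_add exp_double power2_eq_square)
      have g: "norm (damped_Phi k (ray 1 v)) \<le> K * exp (- exp v / 2 - 3 / 4 * A / exp v)"
        using K(2)[of "exp v"] by (simp add: ray_def)
      have "norm (lattice_kernel \<theta> a \<rho> (ray 1 v / \<epsilon>)) \<le>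
          exp (2 * pi * (1 - \<theta>) * Im (ray 1 v / \<epsilon>) / a) * (1 - a / (2 * pi * Im (ray 1 v / \<epsilon>)))"
        by (rule norm_lattice_kernel_lower_le[OF i a])
      also have "2 * pi * (1 - \<theta>) * Im (ray 1 v / \<epsilon>) / a = - b * exp v"
        unfolding Im_u b_def by (simp add: mult_ac)
      also have "1 - a / (2 * pi * Im (ray 1 v / \<epsilon>)) = 1 + B * (\<kappa> * exp (- v))"
        unfolding Im_u B_def using pos by (simp add: exp_minus field_simps)
      also have "exp (- b * exp v) * (1 + B * (\<kappa> * exp (- v))) \<le> exp (- b * exp v) * (exp \<bar>v\<bar> + B * (1 * exp \<bar>v\<bar>))"
        using B \<kappa> by (intro mult_left_mono add_mono mult_mono) (auto simp: less_imp_le)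
      finally have kb: "norm (lattice_kernel \<theta> a \<rho> (ray 1 v / \<epsilon>)) \<le> exp (- b * exp v) * ((1 + B) * exp \<bar>v\<bar>)"
        by (simp add: algebra_simps)
      have "norm (?J v)
        \<le> (K * exp (- exp v / 2 - 3 / 4 * A / exp v)) * (exp (- b * exp v) * ((1 + B) * exp \<bar>v\<bar>)) * exp \<bar>v\<bar>"
        unfolding norm_mult[of _ "ray 1 v"] norm_mult[of "damped_Phi k (ray 1 v)"]
        using g kb K B by (intro mult_mono) auto
      also have "\<dots> = K * (1 + B) * exp (2 * \<bar>v\<bar> + (- exp v / 2 - 3 / 4 * A / exp v + - b * exp v))"
        by (rule alg)
      also have "\<dots> \<le> K * (1 + B) * exp (2 * \<bar>v\<bar> - 1 / 4 * v ^ 2 - R)"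
      proof -
        \<comment> \<open>Of the share 3/4 A / x, the part A / (2 x) is balanced against b x by the
          arithmetic-geometric mean, giving sqrt (2 A b); the part A / (4 x), together with x / 2,
          provides the integrable majorant.\<close>
        have "R \<le> A / 2 / exp v + b * exp v"
        proof -
          have "R = 2 * sqrt ((A / 2 / exp v) * (b * exp v))"
            using real_sqrt_mult[of 4 "(A / 2 / exp v) * (b * exp v)"] by (simp add: R_def mult.assoc)
          also have "\<dots> \<le> A / 2 / exp v + b * exp v"
            using arith_geo_mean_sqrt[of "A / 2 / exp v" "b * exp v"] A b by simp
          finally show ?thesis .
        qed
        moreover have "1 / 4 * v ^ 2 \<le> exp v / 2 + A / 4 / exp v"
        proof -
          have "1 / exp v \<le> A / exp v" using A by (intro divide_right_mono) auto
          then have "1 / 4 * v ^ 2 \<le> exp v / 4 + A / 4 / exp v"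
            using exp_plus_inverse_ge[of v] by simp
          also have "exp v / 4 \<le> exp v / 2" by simp
          finally show ?thesis by simp
        qed
        moreover have "3 / 4 * A / exp v = A / 2 / exp v + A / 4 / exp v" by simp
        ultimately have "2 * \<bar>v\<bar> + (- exp v / 2 - 3 / 4 * A / exp v + - b * exp v) \<le> 2 * \<bar>v\<bar> - 1 / 4 * v ^ 2 - R"
          by linarith
        then show ?thesis using K B by (intro mult_left_mono) auto
      qed
      also have "\<dots> = exp (- R) * w v"
        unfolding w_def diff_conv_add_uminus[of _ R] exp_add by simp
      finally show ?thesis .
    qed
    have "norm (lattice_ray_integral k \<theta> a \<rho> \<epsilon> 1) \<le> (\<integral>v. exp (- R) * w v \<partial>lborel)"
      unfolding lattice_ray_integral_def ray_integral_def
    proof (rule Bochner_Integration.integral_norm_bound_integral)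
      show int: "integrable lborel (\<lambda>v. exp (- R) * w v)"
        by (intro integrable_mult_right w_int)
      show "integrable lborel (\<lambda>v. ?J v)"
      proof (rule Bochner_Integration.integrable_bound[OF int])
        have "\<epsilon> \<noteq> 0" "Im (1 / \<epsilon>) \<noteq> 0"
          using \<kappa> Im_u[of 0] pos by (auto simp: \<epsilon>_def ray_def)
        then show "(\<lambda>v. ?J v) \<in> borel_measurable lborel"
          using a by (simp add: borel_measurable_continuous_onI continuous_intros continuous_on_damped_Phi_ray continuous_on_lattice_kernel_ray)
        show "AE v in lborel. norm (?J v)
            \<le> norm (exp (- R) * w v)"
          by (intro AE_I2 order_trans[OF bound]) simp
      qed
    qed (rule bound)
    also have "\<dots> = (\<integral>v. w v \<partial>lborel) * exp (- R)"
      by simp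
    also have "R = sqrt (4 * pi * A * (1 - \<theta>) * cos (2 * \<delta>) / (a * \<kappa>))"
      unfolding R_def b_def by (rule arg_cong[of _ _ sqrt]) simp
    finally show "norm (lattice_ray_integral k \<theta> a \<rho> (of_real \<kappa> * cis (pi / 2 - 2 * \<delta>)) 1)
       \<le> (\<integral>v. w v \<partial>lborel) * exp (- sqrt (4 * pi * A * (1 - \<theta>) * cos (2 * \<delta>) / (a * \<kappa>)))"
      by (simp only: \<epsilon>_def \<alpha>_def)
  qed
qed

section \<open>The saddle point on the upper ray\<close>

lemma exp_plus_inverse_tendsto:
  "((\<lambda>X. X * (exp (y / sqrt X) + 1 / exp (y / sqrt X) - 2)) \<longlongrightarrow> y ^ 2) at_top" for y :: real
  by real_asymp (simp add: power2_eq_square)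

text \<open>This is the width 1 / sqrt X times the value at the saddle t = (A / X) cis (pi / 2 -
  \<delta>) of t, of the remainder factor and of the two balanced exponentials. The parameter \<rho>
  does not occur, so numerator and denominator of the quotient share this scale.\<close>

definition saddle_scale :: "nat \<Rightarrow> real \<Rightarrow> real \<Rightarrow> real \<Rightarrow> complex" where
  "saddle_scale k \<delta> A X = of_real (A / X / sqrt X) * cis (pi / 2 - \<delta>) *
     exp (of_nat k * log_Phi_rem (of_real (A / X) * cis (pi / 2 - \<delta>))) *
     exp (- 2 * of_real X * cis (- (pi / 2 - \<delta>)))"

text \<open>
  The saddle point of \<open>exp (- A / t - b t)\<close> is at modulus \<open>A / X\<close>, where \<open>X = sqrt (A b)\<close>, and has width
  \<open>1 / sqrt X\<close> in the logarithmic coordinate; the direction of the ray makes both terms have the same phase.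
\<close>

lemma upper_ray_integral_asymptotic:
  fixes r :: "nat \<Rightarrow> real"
  assumes \<delta>: "0 < \<delta>" "\<delta> < pi / 4" and k: "k \<ge> 1" and a: "a > 0" and \<theta>: "0 < \<theta>" "\<theta> \<le> 1"
    and r: "filterlim r at_top sequentially" "\<And>n. sqrt \<theta> * r n \<ge> 1"
  defines "A \<equiv> real k * pi ^ 2 / 6"
  shows "(\<lambda>n. lattice_ray_integral k \<theta> a \<rho> (of_real (2 * pi * A / (a * r n ^ 2)) * cis (pi / 2 - 2 * \<delta>)) (cis (pi / 2 - \<delta>))
      / saddle_scale k \<delta> A (sqrt \<theta> * r n))
    \<longlonglongrightarrow> exp (- (2 * of_real pi * \<i> * of_real \<theta> * of_real \<rho> / of_real a)) *
      (\<integral>y. exp (- (cis (- (pi / 2 - \<delta>)) * of_real (y ^ 2))) \<partial>lborel)"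
proof -
  define \<psi> where "\<psi> = pi / 2 - \<delta>"
  define p where "p = cis \<psi>"
  define \<kappa> where "\<kappa> n = 2 * pi * A / (a * r n ^ 2)" for n
  define \<epsilon> where "\<epsilon> n = of_real (\<kappa> n) * cis (pi / 2 - 2 * \<delta>)" for n
  \<comment> \<open>With b = 2 pi \<theta> / (a \<kappa>), the choice \<kappa> = 2 pi A / (a r^2)
    gives A b = \<theta> r^2, so X = sqrt (A b). One sequence r thus serves all values of
    \<theta>.\<close>
  define X where "X n = sqrt \<theta> * r n" for n
  define c where "c = sin \<delta>"
  have c: "c > 0" unfolding c_def using \<delta> pi_gt_zero by (intro sin_gt_zero) linarith+
  have cos_\<psi>: "cos \<psi> = c" by (simp add: \<psi>_def c_def cos_diff)
  have p: "norm p = 1" "Re p = c" "Re p > 0"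
    using c by (auto simp: p_def cos_\<psi>)
  have A: "A > 0" using k by (simp add: A_def)
  have X: "X n \<ge> 1" "X n > 0" for n using r(2)[of n] by (auto simp: X_def)
  have r_pos: "r n > 0" for n using X(2)[of n] \<theta> by (simp add: X_def zero_less_mult_iff)
  have X_lim: "filterlim X at_top sequentially"
    unfolding X_def using \<theta> by (intro filterlim_tendsto_pos_mult_at_top[OF tendsto_const _ r(1)]) auto
  have \<kappa>: "\<kappa> n > 0" for n using A a r_pos[of n] by (simp add: \<kappa>_def)
  have \<epsilon>: "\<epsilon> n \<noteq> 0" for n using \<kappa>[of n] by (auto simp: \<epsilon>_def)
  define x0 where "x0 n = A / X n" for n
  have x0: "x0 n > 0" for n using A X by (simp add: x0_def)
  have ratio: "x0 n / \<kappa> n = a * X n / (2 * pi * \<theta>)" for n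
  proof -
    have "X n ^ 2 = \<theta> * r n ^ 2" using \<theta> by (simp add: X_def power_mult_distrib)
    then have "r n ^ 2 = X n ^ 2 / \<theta>" using \<theta> by simp
    then show ?thesis
      using A a X(2)[of n] \<theta> by (simp add: x0_def \<kappa>_def power2_eq_square field_simps)
  qed
  \<comment> \<open>The new variable y is centred at the saddle and rescaled by its width; the
    Jacobian 1 / sqrt X goes into the scale.\<close>
  define s where "s n y = y / sqrt (X n)" for n y
  define t where "t n y = ray p (ln (x0 n) + s n y)" for n y
  have t_eq: "t n y = of_real (x0 n * exp (s n y)) * p" for n y
    using x0[of n] by (simp add: t_def ray_def exp_add)
  have t_Re: "Re (t n y) > 0" for n y
    unfolding t_eq using x0[of n] p by simp
  have u_eq: "t n y / \<epsilon> n = of_real (a * X n / (2 * pi * \<theta>) * exp (s n y)) * cis \<delta>" for n y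
  proof -
    have "t n y / \<epsilon> n = of_real (exp (ln (x0 n) + s n y) / \<kappa> n) * cis \<delta>"
      unfolding t_def p_def \<epsilon>_def ray_cis_divide[OF \<kappa>] by (simp add: \<psi>_def)
    also have "exp (ln (x0 n) + s n y) / \<kappa> n = x0 n / \<kappa> n * exp (s n y)"
      using x0[of n] by (simp add: exp_add)
    finally show ?thesis unfolding ratio .
  qed
  have u_Im: "Im (t n y / \<epsilon> n) = a * X n / (2 * pi * \<theta>) * exp (s n y) * c" for n y
    unfolding u_eq by (simp add: c_def)
  have u_Im_pos: "Im (t n y / \<epsilon> n) > 0" for n y
    unfolding u_Im using a X(2)[of n] \<theta> c by simp
  define M where "M n y = 1 / (1 - exp (2 * of_real pi * \<i> * (t n y / \<epsilon> n - of_real \<rho>) / of_real a))" for n y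
  define z where "z = exp (- (2 * of_real pi * \<i> * of_real \<theta> * of_real \<rho> / of_real a))"
  let ?Q = "\<lambda>n y. X n * (exp (s n y) + 1 / exp (s n y) - 2)" and ?D = "\<lambda>n y. log_Phi_rem (t n y) - log_Phi_rem (of_real (x0 n) * p)"
  define I where "I n y = exp (- t n y) * exp (of_nat k * (?D n y)) *
     exp (- (cis (- \<psi>) * of_real (?Q n y))) * of_real (exp (s n y)) * M n y" for n y
  define N where "N n = saddle_scale k \<delta> A (X n)" for n
  have N0: "N n \<noteq> 0" for n
    using A X(2)[of n] by (simp add: N_def saddle_scale_def)
  have integrand: "damped_Phi k (t n y) * lattice_kernel \<theta> a \<rho> (t n y / \<epsilon> n) * t n y
     = of_real (sqrt (X n)) * N n * z * I n y" for n y
  proof -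
    have e1: "of_real A / t n y = of_real (X n / exp (s n y)) * cis (- \<psi>)"
      using A X(2)[of n] by (simp add: t_eq x0_def p_def divide_simps cis_mult flip: cis_inverse)
    have e2: "2 * of_real pi * \<i> * of_real \<theta> * (t n y / \<epsilon> n - of_real \<rho>) / of_real a
       = - (of_real (X n * exp (s n y)) * cis (- \<psi>)) - 2 * of_real pi * \<i> * of_real \<theta> * of_real \<rho> / of_real a"
    proof -
      \<comment> \<open>The angle pi / 2 - 2 \<delta> of \<epsilon> is chosen for this identity: the
        exponent of the kernel gets the direction of - 1 / t.\<close>
      have "\<i> * cis \<delta> = - cis (- \<psi>)"
        by (simp add: complex_eq_iff \<psi>_def cos_diff sin_diff)
      moreover have "2 * of_real pi * \<i> * of_real \<theta> * (of_real (a * X n / (2 * pi * \<theta>) * exp (s n y)) * cis \<delta>) / of_real a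
         = of_real (X n * exp (s n y)) * (\<i> * cis \<delta>)"
        using \<theta> a by (simp add: field_simps)
      ultimately have "2 * of_real pi * \<i> * of_real \<theta> * (of_real (a * X n / (2 * pi * \<theta>) * exp (s n y)) * cis \<delta>) / of_real a
         = - (of_real (X n * exp (s n y)) * cis (- \<psi>))"
        by simp
      then show ?thesis
        unfolding u_eq right_diff_distrib diff_divide_distrib by simp
    qed
    have "damped_Phi k (t n y) * lattice_kernel \<theta> a \<rho> (t n y / \<epsilon> n) * t n y =
       exp (- t n y - of_real (X n / exp (s n y)) * cis (- \<psi>) + of_nat k * log_Phi_rem (t n y)) *
       exp (- (of_real (X n * exp (s n y)) * cis (- \<psi>)) - 2 * of_real pi * \<i> * of_real \<theta> * of_real \<rho> / of_real a) * M n y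
       * (of_real (x0 n * exp (s n y)) * p)"
      unfolding damped_Phi_eq[OF t_Re] A_def[symmetric] e1 lattice_kernel_def e2 M_def
      by (simp add: t_eq)
    also have "exp (- t n y - of_real (X n / exp (s n y)) * cis (- \<psi>) + of_nat k * log_Phi_rem (t n y)) *
       exp (- (of_real (X n * exp (s n y)) * cis (- \<psi>)) - 2 * of_real pi * \<i> * of_real \<theta> * of_real \<rho> / of_real a)
       = exp (of_nat k * log_Phi_rem (of_real (x0 n) * p)) * exp (- 2 * of_real (X n) * cis (- \<psi>)) * z *
         (exp (- t n y) * exp (of_nat k * (?D n y)) *
         exp (- (cis (- \<psi>) * of_real (?Q n y))))"
      unfolding z_def mult_exp_exp
      by (rule arg_cong[of _ _ exp]) (simp add: algebra_simps)
    finally have *: "damped_Phi k (t n y) * lattice_kernel \<theta> a \<rho> (t n y / \<epsilon> n) * t n y =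
       (exp (of_nat k * log_Phi_rem (of_real (x0 n) * p)) * exp (- 2 * of_real (X n) * cis (- \<psi>))) * z *
         (exp (- t n y) * exp (of_nat k * (?D n y)) *
         exp (- (cis (- \<psi>) * of_real (?Q n y)))) * M n y
       * (of_real (x0 n * exp (s n y)) * p)" .
    have "of_real (sqrt (X n)) * N n = of_real (x0 n) * p *
       (exp (of_nat k * log_Phi_rem (of_real (x0 n) * p)) * exp (- 2 * of_real (X n) * cis (- \<psi>)))"
      unfolding N_def saddle_scale_def \<psi>_def[symmetric] p_def[symmetric] x0_def[symmetric]
      using X(2)[of n] by (simp add: field_simps)
    then show ?thesis
      unfolding * I_def by (simp add: mult_ac)
  qed
  have affine: "lattice_ray_integral k \<theta> a \<rho> (\<epsilon> n) p = N n * z * (\<integral>y. I n y \<partial>lborel)" for n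
  proof -
    have "lattice_ray_integral k \<theta> a \<rho> (\<epsilon> n) p = \<bar>1 / sqrt (X n)\<bar> *\<^sub>R
      (\<integral>y. damped_Phi k (t n y) * lattice_kernel \<theta> a \<rho> (t n y / \<epsilon> n) * t n y \<partial>lborel)"
      unfolding lattice_ray_integral_def ray_integral_def t_def s_def
      using lborel_integral_real_affine[of "1 / sqrt (X n)"
        "\<lambda>v. damped_Phi k (ray p v) * lattice_kernel \<theta> a \<rho> (ray p v / \<epsilon> n) * ray p v" "ln (x0 n)"] X(2)[of n]
      by simp
    also have "\<dots> = (1 / sqrt (X n)) *\<^sub>R (of_real (sqrt (X n)) * N n * z * (\<integral>y. I n y \<partial>lborel))"
      unfolding integrand using X(2)[of n] by simp
    also have "\<dots> = N n * z * (\<integral>y. I n y \<partial>lborel)"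
      using X(2)[of n] by (simp add: scaleR_conv_of_real)
    finally show ?thesis .
  qed
  obtain C where C: "C \<ge> 0"
    "\<And>w x y. norm w = 1 \<Longrightarrow> Re w \<ge> c \<Longrightarrow>
       norm (log_Phi_rem (exp (of_real x) * w) - log_Phi_rem (exp (of_real y) * w)) \<le> C * \<bar>x - y\<bar>"
    using log_Phi_rem_slowly_varying[OF c] by blast
  \<comment> \<open>Moving by s in the logarithmic coordinate changes the remainder by at most C
    |s|, which tends to 0 for fixed y. So the remainder may be frozen at the saddle.\<close>
  have rem_diff: "norm (?D n y) \<le> C * \<bar>s n y\<bar>" for n y
  proof -
    have eq1: "t n y = exp (of_real (ln (x0 n) + s n y)) * p"
      unfolding t_def ray_def by (simp only: exp_of_real)
    have eq2: "of_real (x0 n) * p = exp (of_real (ln (x0 n))) * p"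
      using x0[of n] by (simp add: exp_of_real)
    show ?thesis
      using C(2)[of p "ln (x0 n) + s n y" "ln (x0 n)", OF p(1)] p(2)
      by (simp only: eq1 eq2 add_diff_cancel_left' order_refl simp_thms)
  qed
  have s_abs: "\<bar>s n y\<bar> \<le> \<bar>y\<bar>" for n y
  proof -
    have "\<bar>y\<bar> / sqrt (X n) \<le> \<bar>y\<bar> / 1"
      using X[of n] by (intro divide_left_mono) auto
    then show ?thesis using X(2)[of n] by (simp add: s_def abs_divide)
  qed
  have s_lim: "(\<lambda>n. s n y) \<longlonglongrightarrow> 0" for y
    unfolding s_def
    by (intro tendsto_divide_0[OF tendsto_const] filterlim_at_top_imp_at_infinity
          filterlim_compose[OF sqrt_at_top X_lim])
  have x0_lim: "x0 \<longlonglongrightarrow> 0"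
    unfolding x0_def by (intro tendsto_divide_0[OF tendsto_const] filterlim_at_top_imp_at_infinity X_lim)
  have M_le: "norm (M n y) \<le> (1 + 1 / c) * exp \<bar>s n y\<bar>" for n y
  proof -
    have "norm (M n y) \<le> 1 + a / (2 * pi * Im (t n y / \<epsilon> n))"
      using norm_lattice_kernel_upper_le[OF u_Im_pos a, of 0] by (simp add: M_def lattice_kernel_def)
    also have "a / (2 * pi * Im (t n y / \<epsilon> n)) = \<theta> / X n * (1 / c * exp (- s n y))"
      unfolding u_Im using a \<theta> X(2)[of n] c by (simp add: exp_minus field_simps)
    also have "1 + \<theta> / X n * (1 / c * exp (- s n y)) \<le> exp \<bar>s n y\<bar> + 1 * (1 / c * exp \<bar>s n y\<bar>)"
      using \<theta> X[of n] c by (intro add_mono mult_mono) (auto simp: divide_simps)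
    finally show ?thesis by (simp add: algebra_simps)
  qed
  define w where "w y = (1 + 1 / c) * exp ((real k * C + 2) * \<bar>y\<bar> - c * y ^ 2)" for y
  have I_le: "norm (I n y) \<le> w y" for n y
  proof -
    have 1: "norm (exp (- t n y)) \<le> 1"
      using t_Re[of n y] by simp
    have 2: "norm (exp (of_nat k * (?D n y))) \<le> exp (real k * C * \<bar>y\<bar>)"
    proof -
      have "norm (of_nat k * (?D n y)) \<le> real k * (C * \<bar>s n y\<bar>)"
        unfolding norm_mult using rem_diff[of n y] by (intro mult_mono) auto
      also have "\<dots> \<le> real k * (C * \<bar>y\<bar>)"
        using s_abs C(1) by (intro mult_left_mono) auto
      finally show ?thesis
        by (intro order_trans[OF norm_exp]) (simp add: mult_ac)
    qed
    have 3: "norm (exp (- (cis (- \<psi>) * of_real (?Q n y)))) \<le> exp (- c * y ^ 2)"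
    proof -
      have "y ^ 2 = X n * s n y ^ 2"
        using X(2)[of n] by (simp add: s_def power_divide)
      also have "\<dots> \<le> ?Q n y"
        using exp_plus_inverse_ge[of "s n y"] X(2)[of n] by (intro mult_left_mono) auto
      finally have "c * y ^ 2 \<le> c * (?Q n y)"
        using c by (intro mult_left_mono) auto
      then show ?thesis
        unfolding norm_exp_eq_Re by (simp add: cos_\<psi> del: of_real_mult of_real_diff of_real_add)
    qed
    have 4: "norm (of_real (exp (s n y)) :: complex) \<le> exp \<bar>y\<bar>"
      using s_abs[of n y] by simp
    have 5: "norm (M n y) \<le> (1 + 1 / c) * exp \<bar>y\<bar>"
      using M_le[of n y] s_abs[of n y] c by (elim order_trans) (intro mult_left_mono, auto)
    have "norm (I n y) \<le> 1 * exp (real k * C * \<bar>y\<bar>) * exp (- c * y ^ 2) * exp \<bar>y\<bar> * ((1 + 1 / c) * exp \<bar>y\<bar>)"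
      unfolding I_def norm_mult[of _ "M n y"] norm_mult[of _ "of_real (exp (s n y))"]
        norm_mult[of _ "exp (- (cis (- \<psi>) * of_real (?Q n y)))"]
        norm_mult[of "exp (- t n y)"]
      by (intro mult_mono 1 2 3 4 5) auto
    also have "\<dots> = w y"
      unfolding w_def by (simp add: mult_exp_exp algebra_simps)
    finally show ?thesis .
  qed
  have I_lim: "(\<lambda>n. I n y) \<longlonglongrightarrow> exp (- (cis (- \<psi>) * of_real (y ^ 2)))" for y
  proof -
    have "(\<lambda>n. of_real (x0 n * exp (s n y)) * p) \<longlonglongrightarrow> of_real (0 * exp 0) * p"
      by (intro tendsto_intros x0_lim s_lim)
    then have 1: "(\<lambda>n. exp (- t n y)) \<longlonglongrightarrow> exp (- 0)"
      unfolding t_eq by (intro tendsto_exp tendsto_minus) simp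
    have "(\<lambda>n. C * \<bar>s n y\<bar>) \<longlonglongrightarrow> C * \<bar>0\<bar>"
      by (intro tendsto_intros s_lim)
    then have s0: "(\<lambda>n. C * \<bar>s n y\<bar>) \<longlonglongrightarrow> 0"
      by simp
    have "(\<lambda>n. ?D n y) \<longlonglongrightarrow> 0"
      by (rule Lim_null_comparison[OF _ s0]) (simp add: rem_diff)
    then have 2: "(\<lambda>n. exp (of_nat k * (?D n y))) \<longlonglongrightarrow> exp (of_nat k * 0)"
      by (intro tendsto_exp tendsto_mult tendsto_const)
    have "(\<lambda>n. ?Q n y) \<longlonglongrightarrow> y ^ 2"
      unfolding s_def by (rule filterlim_compose[OF exp_plus_inverse_tendsto X_lim])
    then have 3: "(\<lambda>n. exp (- (cis (- \<psi>) * of_real (?Q n y))))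
       \<longlonglongrightarrow> exp (- (cis (- \<psi>) * of_real (y ^ 2)))"
      by (rule tendsto_exp[OF tendsto_minus[OF tendsto_mult[OF tendsto_const tendsto_of_real]]])
    have 4: "(\<lambda>n. of_real (exp (s n y)) :: complex) \<longlonglongrightarrow> of_real (exp 0)"
      by (intro tendsto_intros s_lim)
    have "filterlim (\<lambda>n. (a / (2 * pi * \<theta>) * c * exp (s n y)) * X n) at_top sequentially"
      by (rule filterlim_tendsto_pos_mult_at_top[OF tendsto_mult[OF tendsto_const tendsto_exp[OF s_lim]] _ X_lim])
         (use a \<theta> c in auto)
    then have "filterlim (\<lambda>n. Im (t n y / \<epsilon> n)) at_top sequentially"
      unfolding u_Im by (simp add: mult_ac)
    then have 5: "(\<lambda>n. M n y) \<longlonglongrightarrow> 1"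
      unfolding M_def by (rule lattice_kernel_tendsto) (rule a)
    show ?thesis
      using tendsto_mult[OF tendsto_mult[OF tendsto_mult[OF tendsto_mult[OF 1 2] 3] 4] 5]
      unfolding I_def by simp
  qed
  have I_cont: "continuous_on UNIV (I n)" for n
  proof -
    have "I n = (\<lambda>y. damped_Phi k (t n y) * lattice_kernel \<theta> a \<rho> (t n y / \<epsilon> n) * t n y / (of_real (sqrt (X n)) * N n * z))"
      unfolding integrand using X(2)[of n] N0[of n] by (simp add: z_def fun_eq_iff)
    moreover have "continuous_on UNIV (\<lambda>y. damped_Phi k (t n y) * lattice_kernel \<theta> a \<rho> (t n y / \<epsilon> n) * t n y / (of_real (sqrt (X n)) * N n * z))"
    proof -
      have lin: "continuous_on UNIV (\<lambda>y. ln (x0 n) + s n y)"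
        unfolding s_def using X(2)[of n] by (intro continuous_intros) auto
      have "Im (p / \<epsilon> n) \<noteq> 0"
      proof -
        have "p / \<epsilon> n = of_real (1 / \<kappa> n) * cis \<delta>"
          using ray_cis_divide[OF \<kappa>[of n], of \<psi> 0 "pi / 2 - 2 * \<delta>"] by (simp add: ray_def p_def \<epsilon>_def \<psi>_def)
        then show ?thesis using \<kappa>[of n] c by (simp add: c_def)
      qed
      then show ?thesis
        unfolding t_def using p a \<epsilon> X(2)[of n] N0[of n]
        by (intro continuous_intros continuous_on_compose2[OF continuous_on_damped_Phi_ray lin]
              continuous_on_compose2[OF continuous_on_lattice_kernel_ray lin]
              continuous_on_compose2[OF continuous_on_ray lin]) (auto simp: z_def)
    qed
    ultimately show ?thesis by simp
  qed
  have "(\<lambda>n. \<integral>y. I n y \<partial>lborel) \<longlonglongrightarrow> (\<integral>y. exp (- (cis (- \<psi>) * of_real (y ^ 2))) \<partial>lborel)"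
  proof (rule integral_dominated_convergence[where w = w])
    show "integrable lborel w"
      unfolding w_def using c by (intro integrable_mult_right integrable_exp_abs_square)
    show "(\<lambda>y. exp (- (cis (- \<psi>) * of_real (y ^ 2)))) \<in> borel_measurable lborel"
      by measurable
    show "I n \<in> borel_measurable lborel" for n
      using I_cont[of n] by (simp add: borel_measurable_continuous_onI)
    show "AE y in lborel. (\<lambda>n. I n y) \<longlonglongrightarrow> exp (- (cis (- \<psi>) * of_real (y ^ 2)))"
      by (intro AE_I2 I_lim)
    show "AE y in lborel. norm (I n y) \<le> w y" for n
      by (intro AE_I2 I_le)
  qed
  from tendsto_mult[OF tendsto_const[of z] this]
  have "(\<lambda>n. lattice_ray_integral k \<theta> a \<rho> (\<epsilon> n) p / N n) \<longlonglongrightarrow> z * (\<integral>y. exp (- (cis (- \<psi>) * of_real (y ^ 2))) \<partial>lborel)"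
    unfolding affine using N0 by (simp add: field_simps)
  then show ?thesis
    unfolding \<epsilon>_def \<kappa>_def p_def z_def N_def X_def \<psi>_def .
qed

text \<open>The rate 2 sin \<delta> is the real part of 2 cis (- (pi / 2 - \<delta>)). The remainder
  contributes at most logarithmic terms to the exponent, which the arbitrarily small \<eta>
  absorbs.\<close>

lemma saddle_scale_inverse_bound:
  assumes \<delta>: "0 < \<delta>" "\<delta> < pi / 4" and A: "A > 0" and \<eta>: "\<eta> > 0"
  obtains D where "D \<ge> 0"
    "\<And>X. X \<ge> 1 \<Longrightarrow> 1 / norm (saddle_scale k \<delta> A X) \<le> D * (X * sqrt X) * exp ((2 * sin \<delta> + \<eta>) * X)"
proof -
  define p where "p = cis (pi / 2 - \<delta>)"
  define c where "c = sin \<delta>"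
  have c: "c > 0" unfolding c_def using \<delta> pi_gt_zero by (intro sin_gt_zero) linarith+
  have p: "norm p = 1" "Re p = c" by (auto simp: p_def c_def cos_diff)
  obtain C where C: "C \<ge> 0"
    "\<And>t. t \<noteq> 0 \<Longrightarrow> Re t \<ge> c * norm t \<Longrightarrow> norm (log_Phi_rem t) \<le> C * (1 + \<bar>ln (norm t)\<bar>)"
    using log_Phi_rem_sector_bound[OF c] by blast
  \<comment> \<open>The coefficient A \<eta> is chosen because 1 / x0 = X / A, so that A \<eta> / x0
    is exactly \<eta> X.\<close>
  obtain M where M: "M \<ge> 0" "\<And>r. r > 0 \<Longrightarrow> real k * C * \<bar>ln r\<bar> \<le> M + A * \<eta> * (r + 1 / r)"
    using abs_ln_le[of "real k * C" "A * \<eta>"] C A \<eta> by auto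
  define D where "D = 1 / A * exp (real k * C + M + A * \<eta> * A)"
  show thesis
  proof (rule that[of D])
    show "D \<ge> 0" using A by (simp add: D_def)
    fix X :: real assume X: "X \<ge> 1"
    define x0 where "x0 = A / X"
    have x0: "x0 > 0" using A X by (simp add: x0_def)
    have "p \<noteq> 0" using p(1) by auto
    then have "real k * norm (log_Phi_rem (of_real x0 * p)) \<le> real k * (C * (1 + \<bar>ln x0\<bar>))"
      using C(2)[of "of_real x0 * p"] x0 p by (intro mult_left_mono) (auto simp: norm_mult)
    also have "\<dots> \<le> real k * C + M + A * \<eta> * (x0 + 1 / x0)"
      using M(2)[OF x0] by (simp add: algebra_simps)
    also have "A * \<eta> * (x0 + 1 / x0) \<le> A * \<eta> * A + \<eta> * X"
    proof -
      have "x0 \<le> A" using A X mult_left_mono[of 1 X A] by (simp add: x0_def divide_le_eq)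
      then have "A * \<eta> * x0 \<le> A * \<eta> * A" using A \<eta> by (intro mult_left_mono) auto
      moreover have "A * \<eta> * (1 / x0) = \<eta> * X" using A X by (simp add: x0_def)
      ultimately show ?thesis by (simp add: distrib_left)
    qed
    finally have fin: "real k * norm (log_Phi_rem (of_real x0 * p)) \<le> real k * C + M + (A * \<eta> * A + \<eta> * X)"
      by simp
    have "- Re (of_nat k * log_Phi_rem (of_real x0 * p)) \<le> norm (of_nat k * log_Phi_rem (of_real x0 * p))"
      by (rule order_trans[OF abs_ge_minus_self abs_Re_le_cmod])
    also have "\<dots> = real k * norm (log_Phi_rem (of_real x0 * p))"
      by (simp only: norm_mult norm_of_nat)
    also note fin
    finally have le: "exp (- Re (of_nat k * log_Phi_rem (of_real x0 * p))) \<le> exp (real k * C + M + (A * \<eta> * A + \<eta> * X))"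
      by (simp only: exp_le_cancel_iff)
    have nrm: "norm (saddle_scale k \<delta> A X) = A / X / sqrt X * exp (Re (of_nat k * log_Phi_rem (of_real x0 * p))) * exp (- 2 * X * c)"
      unfolding saddle_scale_def x0_def[symmetric] p_def[symmetric] norm_mult norm_exp_eq_Re
      using A X by (simp add: p c_def x0_def norm_divide norm_mult cos_diff)
    have "1 / norm (saddle_scale k \<delta> A X) = 1 / A * (X * sqrt X) * exp (2 * c * X) * exp (- Re (of_nat k * log_Phi_rem (of_real x0 * p)))"
      unfolding nrm using A X by (simp add: exp_minus field_simps)
    also have "\<dots> \<le> 1 / A * (X * sqrt X) * exp (2 * c * X) * exp (real k * C + M + (A * \<eta> * A + \<eta> * X))"
      using A X le by (intro mult_left_mono) auto
    also have "\<dots> = D * (X * sqrt X) * exp ((2 * sin \<delta> + \<eta>) * X)"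
      by (simp add: D_def c_def exp_add ring_distribs mult_ac)
    finally show "1 / norm (saddle_scale k \<delta> A X) \<le> D * (X * sqrt X) * exp ((2 * sin \<delta> + \<eta>) * X)" .
  qed
qed

text \<open>In units of X the lower ray decays at rate \<mu> = sqrt (2 (1 - \<theta>) cos (2
  \<delta>)) / sqrt \<theta> and the scale of the upper ray at rate 2 sin \<delta>; the assumption
  \<open>gap\<close> expresses that the former is larger.\<close>

lemma lower_ray_integral_negligible:
  fixes r :: "nat \<Rightarrow> real"
  assumes \<delta>: "0 < \<delta>" "\<delta> < pi / 4" and k: "k \<ge> 1" and a: "a > 0" and \<theta>: "0 < \<theta>" "\<theta> \<le> 1"
    and gap: "2 * sin \<delta> ^ 2 < 1 - \<theta>"
    and r: "filterlim r at_top sequentially" "\<And>n. sqrt \<theta> * r n \<ge> 1"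
  defines "A \<equiv> real k * pi ^ 2 / 6"
  assumes \<kappa>1: "\<And>n. 2 * pi * A / (a * r n ^ 2) \<le> 1"
  shows "(\<lambda>n. lattice_ray_integral k \<theta> a \<rho> (of_real (2 * pi * A / (a * r n ^ 2)) * cis (pi / 2 - 2 * \<delta>)) 1
      / saddle_scale k \<delta> A (sqrt \<theta> * r n)) \<longlonglongrightarrow> 0"
proof -
  define c where "c = sin \<delta>"
  have c: "c > 0" unfolding c_def using \<delta> pi_gt_zero by (intro sin_gt_zero) linarith+
  have cos2: "cos (2 * \<delta>) = 1 - 2 * c ^ 2" unfolding c_def by (rule cos_double_sin)
  have A: "A > 0" using k by (simp add: A_def)
  define X where "X n = sqrt \<theta> * r n" for n
  have X: "X n \<ge> 1" for n using r(2)[of n] by (simp add: X_def)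
  have r_pos: "r n > 0" for n using X[of n] \<theta> by (simp add: X_def) (smt (verit) mult_nonneg_nonpos real_sqrt_ge_zero)
  have X_lim: "filterlim X at_top sequentially"
    unfolding X_def using \<theta> by (intro filterlim_tendsto_pos_mult_at_top[OF tendsto_const _ r(1)]) auto
  define \<mu> where "\<mu> = sqrt (2 * (1 - \<theta>) * cos (2 * \<delta>)) / sqrt \<theta>"
  have \<mu>: "2 * c < \<mu>"
  proof -
    \<comment> \<open>After inserting cos (2 \<delta>) = 1 - 2 c^2, the terms c^2 \<theta> cancel
      and 2 c^2 < 1 - \<theta> remains, which is \<open>gap\<close>.\<close>
    have "(2 * c) ^ 2 * \<theta> < 2 * (1 - \<theta>) * cos (2 * \<delta>)"
      using gap \<theta> unfolding cos2 c_def[symmetric] by (simp add: power2_eq_square algebra_simps)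
    then have "sqrt ((2 * c) ^ 2 * \<theta>) < sqrt (2 * (1 - \<theta>) * cos (2 * \<delta>))"
      by (rule real_sqrt_less_mono)
    then show ?thesis using c \<theta> by (simp add: \<mu>_def real_sqrt_mult pos_less_divide_eq)
  qed
  \<comment> \<open>Half the difference of the rates is given to the inverse scale, so the quotient
    still decays like exp (- \<eta> X) up to powers of X.\<close>
  define \<eta> where "\<eta> = (\<mu> - 2 * c) / 2"
  have \<eta>: "\<eta> > 0" using \<mu> by (simp add: \<eta>_def)
  obtain D where D: "D \<ge> 0"
    "\<And>X. X \<ge> 1 \<Longrightarrow> 1 / norm (saddle_scale k \<delta> A X) \<le> D * (X * sqrt X) * exp ((2 * sin \<delta> + \<eta>) * X)"
    using saddle_scale_inverse_bound[OF \<delta> A \<eta>] by blast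
  obtain C where C: "C \<ge> 0"
    "\<And>\<kappa>. 0 < \<kappa> \<Longrightarrow> \<kappa> \<le> 1 \<Longrightarrow>
       norm (lattice_ray_integral k \<theta> a \<rho> (of_real \<kappa> * cis (pi / 2 - 2 * \<delta>)) 1)
       \<le> C * exp (- sqrt (4 * pi * A * (1 - \<theta>) * cos (2 * \<delta>) / (a * \<kappa>)))"
    using lower_ray_integral_bound[OF \<delta> k a _ \<theta>(2)] \<theta>(1) unfolding A_def by (metis less_imp_le)
  show ?thesis
  proof (rule Lim_null_comparison)
    show "eventually (\<lambda>n. norm (lattice_ray_integral k \<theta> a \<rho> (of_real (2 * pi * A / (a * r n ^ 2)) * cis (pi / 2 - 2 * \<delta>)) 1
      / saddle_scale k \<delta> A (sqrt \<theta> * r n)) \<le> C * D * (X n * sqrt (X n) * exp (- \<eta> * X n))) sequentially"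
    proof (intro always_eventually allI)
      fix n
      define \<kappa> where "\<kappa> = 2 * pi * A / (a * r n ^ 2)"
      have \<kappa>: "0 < \<kappa>" "\<kappa> \<le> 1" using A a r_pos[of n] \<kappa>1[of n] by (auto simp: \<kappa>_def)
      have "sqrt (4 * pi * A * (1 - \<theta>) * cos (2 * \<delta>) / (a * \<kappa>)) = sqrt (2 * (1 - \<theta>) * cos (2 * \<delta>) * r n ^ 2)"
        using A a r_pos[of n] by (simp add: \<kappa>_def field_simps)
      also have "\<dots> = \<mu> * X n"
        using \<theta> r_pos[of n] by (simp add: \<mu>_def X_def real_sqrt_mult)
      finally have "norm (lattice_ray_integral k \<theta> a \<rho> (of_real \<kappa> * cis (pi / 2 - 2 * \<delta>)) 1) \<le> C * exp (- (\<mu> * X n))"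
        using C(2)[OF \<kappa>] by simp
      moreover have "1 / norm (saddle_scale k \<delta> A (X n)) \<le> D * (X n * sqrt (X n)) * exp ((2 * c + \<eta>) * X n)"
        using D(2)[OF X[of n]] by (simp add: c_def)
      ultimately have "norm (lattice_ray_integral k \<theta> a \<rho> (of_real \<kappa> * cis (pi / 2 - 2 * \<delta>)) 1) * (1 / norm (saddle_scale k \<delta> A (X n)))
        \<le> (C * exp (- (\<mu> * X n))) * (D * (X n * sqrt (X n)) * exp ((2 * c + \<eta>) * X n))"
        using C by (intro mult_mono) auto
      also have "\<dots> = C * D * (X n * sqrt (X n) * (exp (- (\<mu> * X n)) * exp ((2 * c + \<eta>) * X n)))"
        by simp
      also have "exp (- (\<mu> * X n)) * exp ((2 * c + \<eta>) * X n) = exp (- \<eta> * X n)"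
      proof -
        have "\<mu> = 2 * c + 2 * \<eta>" by (simp add: \<eta>_def field_simps)
        then show ?thesis unfolding mult_exp_exp by (intro arg_cong[of _ _ exp]) (simp add: algebra_simps)
      qed
      finally show "norm (lattice_ray_integral k \<theta> a \<rho> (of_real (2 * pi * A / (a * r n ^ 2)) * cis (pi / 2 - 2 * \<delta>)) 1
      / saddle_scale k \<delta> A (sqrt \<theta> * r n)) \<le> C * D * (X n * sqrt (X n) * exp (- \<eta> * X n))"
        unfolding norm_divide \<kappa>_def X_def by simp
    qed
    have "((\<lambda>X. X * sqrt X * exp (- \<eta> * X)) \<longlongrightarrow> 0) at_top"
      using \<eta> by real_asymp
    from tendsto_mult_left[OF filterlim_compose[OF this X_lim], of "C * D"]
    show "(\<lambda>n. C * D * (X n * sqrt (X n) * exp (- \<eta> * X n))) \<longlonglongrightarrow> 0" by simp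
  qed
qed

text \<open>Rotating the ray to the positive axis makes the integrand real and positive, since every
  factor of the Euler product is positive there.\<close>

lemma ray_integral_damped_Phi_nonzero:
  assumes \<delta>: "0 < \<delta>" "\<delta> < pi / 4" and k: "k \<ge> 1"
  shows "ray_integral (cis (pi / 2 - \<delta>)) (damped_Phi k) \<noteq> 0"
proof -
  define c where "c = sin \<delta>"
  have c: "c > 0" unfolding c_def using \<delta> pi_gt_zero by (intro sin_gt_zero) linarith+
  obtain K e where Ke: "K > 0" "e > 0"
    "\<And>t. t \<noteq> 0 \<Longrightarrow> Re t \<ge> c * norm t \<Longrightarrow> norm (damped_Phi k t) \<le> K * exp (- e * (norm t + 1 / norm t))"
    using damped_Phi_sector_bound[OF c k] by blast
  have "ray_integral (cis (pi / 2 - \<delta>)) (damped_Phi k) = ray_integral 1 (damped_Phi k)"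
    by (rule ray_integral_rotate[OF holomorphic_damped_Phi Ke(3) c Ke(2)]) (auto simp: c_def cos_diff)
  also have "\<dots> \<noteq> 0"
  proof -
    define f where "f v = Re (damped_Phi k (of_real (exp v))) * exp v" for v
    have eq: "damped_Phi k (ray 1 v) * ray 1 v = of_real (f v)" for v
      using damped_Phi_pos(1)[of "exp v" k] by (auto simp: f_def ray_def elim!: Reals_cases)
    have "integrable lborel (\<lambda>v. damped_Phi k (ray 1 v) * ray 1 v)"
    proof (rule integrable_ray[where K = K and m = 0 and e = e and c = 1])
      show "continuous_on UNIV (\<lambda>v. damped_Phi k (ray 1 v))"
        by (rule continuous_on_damped_Phi_ray) simp
      fix v
      have "c * exp v \<le> 1 * exp v" unfolding c_def by (intro mult_right_mono) auto
      then have "norm (damped_Phi k (ray 1 v)) \<le> K * exp (- e * (norm (ray 1 v) + 1 / norm (ray 1 v)))"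
        by (intro Ke(3)) (auto simp: ray_def norm_mult)
      then show "norm (damped_Phi k (ray 1 v)) \<le> K * (exp (0 * \<bar>v\<bar>) * exp (- e * (exp v * 1 + 1 / (exp v * 1))))"
        by simp
    qed (use Ke in auto)
    then have "integrable lborel f"
      unfolding eq by (simp only: complex_of_real_integrable_eq)
    then have "(\<integral>v. f v \<partial>lborel) > 0"
      by (rule lborel_integral_pos) (use damped_Phi_pos(2) in \<open>simp add: f_def\<close>)
    then show ?thesis
      unfolding ray_integral_def eq integral_complex_of_real by simp
  qed
  finally show ?thesis .
qed

section \<open>Twisted sums and their quotients\<close>

definition twisted_sum :: "nat \<Rightarrow> complex \<Rightarrow> real \<Rightarrow> real \<Rightarrow> complex \<Rightarrow> complex" where
  "twisted_sum k z a \<rho> t = (\<Sum>m. z ^ m * damped_Phi k (of_real (\<rho> + a * real m) * t))"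

lemma W_eq_twisted_sum:
  "W a d (exp (- t)) k = 1 / of_nat d *
     (\<Sum>z | z ^ d = 1. twisted_sum k z (real a) 1 t / twisted_sum k z (real a) (real a) t)"
proof -
  have 1: "exp (- t) ^ n = exp (- (of_nat n * t))" for n
    by (simp add: exp_of_nat_mult[symmetric])
  show ?thesis
    unfolding W_def twisted_sum_def damped_Phi_def 1 by (simp add: algebra_simps)
qed

lemma lattice_sum_twisted_sum:
  fixes \<delta> \<kappa> a \<rho> \<theta> :: real
  assumes "0 < \<delta>" "\<delta> < pi / 4" "\<kappa> > 0" "k \<ge> 1" "0 \<le> \<theta>" "\<theta> \<le> 1" "a > 0" "0 < \<rho>" "\<rho> \<le> a"
  defines "\<epsilon> \<equiv> of_real \<kappa> * cis (pi / 2 - 2 * \<delta>)"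
  shows "summable (\<lambda>m. cis (2 * pi * \<theta>) ^ m * damped_Phi k (of_real (\<rho> + a * real m) * \<epsilon>))"
    and "of_real a * \<epsilon> * twisted_sum k (cis (2 * pi * \<theta>)) a \<rho> \<epsilon>
      = lattice_ray_integral k \<theta> a \<rho> \<epsilon> (cis (pi / 2 - \<delta>)) - lattice_ray_integral k \<theta> a \<rho> \<epsilon> 1"
proof -
  note s = lattice_sum_damped_Phi[OF assms(1-9), folded \<epsilon>_def]
  have "of_real a * \<epsilon> \<noteq> 0" using assms by (auto simp: \<epsilon>_def)
  with sums_summable[OF s] show sm: "summable (\<lambda>m. cis (2 * pi * \<theta>) ^ m * damped_Phi k (of_real (\<rho> + a * real m) * \<epsilon>))"
    using summable_cmult_iff by blast
  show "of_real a * \<epsilon> * twisted_sum k (cis (2 * pi * \<theta>)) a \<rho> \<epsilon>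
      = lattice_ray_integral k \<theta> a \<rho> \<epsilon> (cis (pi / 2 - \<delta>)) - lattice_ray_integral k \<theta> a \<rho> \<epsilon> 1"
    unfolding twisted_sum_def suminf_mult[OF sm, symmetric] by (rule sums_unique[OF s, symmetric])
qed

text \<open>Numerator and denominator share the factor a \<epsilon> and, for \<theta> > 0, the
  saddle scale and the Gaussian constant. What remains is the quotient of exp (- 2 pi i \<theta>
  \<rho> / a) at \<rho> = 1 and \<rho> = a.\<close>

lemma twisted_sum_ratio_tendsto:
  fixes r :: "nat \<Rightarrow> real"
  assumes \<delta>: "0 < \<delta>" "\<delta> < pi / 4" and k: "k \<ge> 1" and a: "a \<ge> 1" and \<theta>: "0 \<le> \<theta>" "\<theta> < 1"
    and gap: "2 * sin \<delta> ^ 2 < 1 - \<theta>"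
    and r: "filterlim r at_top sequentially" "\<And>n. r n > 0" "\<And>n. \<theta> > 0 \<Longrightarrow> sqrt \<theta> * r n \<ge> 1"
  defines "A \<equiv> real k * pi ^ 2 / 6"
  defines "\<epsilon> \<equiv> (\<lambda>n. of_real (2 * pi * A / (a * r n ^ 2)) * cis (pi / 2 - 2 * \<delta>))"
  assumes \<kappa>1: "\<And>n. 2 * pi * A / (a * r n ^ 2) \<le> 1"
  shows "(\<lambda>n. twisted_sum k (cis (2 * pi * \<theta>)) a 1 (\<epsilon> n) / twisted_sum k (cis (2 * pi * \<theta>)) a a (\<epsilon> n))
    \<longlonglongrightarrow> cis (2 * pi * \<theta> * (a - 1) / a)"
proof -
  define \<kappa> where "\<kappa> n = 2 * pi * A / (a * r n ^ 2)" for n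
  have A: "A > 0" using k by (simp add: A_def)
  have \<kappa>: "\<kappa> n > 0" "\<kappa> n \<le> 1" for n using A a r(2)[of n] \<kappa>1[of n] by (auto simp: \<kappa>_def)
  have \<epsilon>_eq: "\<epsilon> n = of_real (\<kappa> n) * cis (pi / 2 - 2 * \<delta>)" for n by (simp add: \<epsilon>_def \<kappa>_def)
  have \<epsilon>0: "\<epsilon> n \<noteq> 0" for n using \<kappa>[of n] by (auto simp: \<epsilon>_eq)
  define U where "U \<rho> n = lattice_ray_integral k \<theta> a \<rho> (\<epsilon> n) (cis (pi / 2 - \<delta>))" for \<rho> n
  define V where "V \<rho> n = lattice_ray_integral k \<theta> a \<rho> (\<epsilon> n) 1" for \<rho> n
  define S where "S \<rho> n = twisted_sum k (cis (2 * pi * \<theta>)) a \<rho> (\<epsilon> n)" for \<rho> n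
  have S: "of_real a * \<epsilon> n * S \<rho> n = U \<rho> n - V \<rho> n" if "0 < \<rho>" "\<rho> \<le> a" for \<rho> n
    unfolding S_def U_def V_def \<epsilon>_eq using \<delta> \<kappa> k \<theta> a that by (intro lattice_sum_twisted_sum(2)) auto
  \<comment> \<open>The normaliser N is left free: it is 1 for \<theta> = 0 and the saddle scale for
    \<theta> > 0.\<close>
  have ratio: "S 1 n / S a n = ((U 1 n - V 1 n) / N) / ((U a n - V a n) / N)" if "N \<noteq> 0" for n N
  proof -
    have "S 1 n / S a n = (of_real a * \<epsilon> n * S 1 n) / (of_real a * \<epsilon> n * S a n)"
      using \<epsilon>0[of n] a by simp
    also have "\<dots> = (U 1 n - V 1 n) / (U a n - V a n)"
      using a by (subst (1 2) S) auto
    finally show ?thesis using that by simp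
  qed
  have "(\<lambda>n. S 1 n / S a n) \<longlonglongrightarrow> cis (2 * pi * \<theta> * (a - 1) / a)"
  proof (cases "\<theta> = 0")
    case True
    define E where "E = ray_integral (cis (pi / 2 - \<delta>)) (damped_Phi k)"
    have E0: "E \<noteq> 0" unfolding E_def by (rule ray_integral_damped_Phi_nonzero[OF \<delta> k])
    have \<kappa>_lim: "\<kappa> \<longlonglongrightarrow> 0"
    proof -
      have "((\<lambda>x. 2 * pi * A / (a * x ^ 2)) \<longlongrightarrow> 0) at_top" using A a by real_asymp
      from filterlim_compose[OF this r(1)] show ?thesis by (simp add: \<kappa>_def[abs_def])
    qed
    have U: "U \<rho> \<longlonglongrightarrow> E" for \<rho>
      unfolding U_def E_def \<epsilon>_eq True using \<delta> k a \<kappa> \<kappa>_lim by (intro upper_ray_integral_tendsto) auto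
    have V: "V \<rho> \<longlonglongrightarrow> 0" for \<rho>
    proof -
      obtain C where C: "C \<ge> 0"
        "\<And>\<kappa>. 0 < \<kappa> \<Longrightarrow> \<kappa> \<le> 1 \<Longrightarrow>
           norm (lattice_ray_integral k \<theta> a \<rho> (of_real \<kappa> * cis (pi / 2 - 2 * \<delta>)) 1)
           \<le> C * exp (- sqrt (4 * pi * A * (1 - \<theta>) * cos (2 * \<delta>) / (a * \<kappa>)))"
        using lower_ray_integral_bound[OF \<delta> k _ \<theta>(1), of a \<rho>] \<theta>(2) a unfolding A_def by auto
      define B where "B = 4 * pi * A * cos (2 * \<delta>) / a"
      have "cos (2 * \<delta>) > 0" using \<delta> by (intro cos_gt_zero) auto
      then have B: "B > 0" using A a by (simp add: B_def)
      have "((\<lambda>x. C * exp (- sqrt (B / x))) \<longlongrightarrow> 0) (at_right 0)"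
        using B by real_asymp
      moreover have "filterlim \<kappa> (at_right 0) sequentially"
        using \<kappa>_lim \<kappa> by (intro tendsto_imp_filterlim_at_right) auto
      ultimately have "(\<lambda>n. C * exp (- sqrt (B / \<kappa> n))) \<longlonglongrightarrow> 0"
        by (rule filterlim_compose)
      then show ?thesis
        by (rule Lim_null_comparison[rotated])
           (use C(2)[OF \<kappa>] in \<open>auto simp: V_def \<epsilon>_eq True B_def intro!: always_eventually\<close>)
    qed
    have "(\<lambda>n. ((U 1 n - V 1 n) / 1) / ((U a n - V a n) / 1)) \<longlonglongrightarrow> ((E - 0) / 1) / ((E - 0) / 1)"
      using E0 by (intro tendsto_intros U V) auto
    then show ?thesis
      using ratio[of 1] E0 True by simp
  next
    case False
    then have \<theta>0: "\<theta> > 0" using \<theta> by simp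
    define N where "N n = saddle_scale k \<delta> A (sqrt \<theta> * r n)" for n
    have N0: "N n \<noteq> 0" for n
      using A \<theta>0 r(2)[of n] by (simp add: N_def saddle_scale_def)
    define G where "G = (\<integral>y. exp (- (cis (- (pi / 2 - \<delta>)) * of_real (y ^ 2))) \<partial>lborel)"
    have G0: "G \<noteq> 0" unfolding G_def using \<delta> pi_gt_zero by (intro complex_Gaussian_nonzero) (auto simp: abs_if)
    define z where "z \<rho> = exp (- (2 * of_real pi * \<i> * of_real \<theta> * of_real \<rho> / of_real a))" for \<rho> :: real
    have U: "(\<lambda>n. U \<rho> n / N n) \<longlonglongrightarrow> z \<rho> * G" for \<rho>
      unfolding U_def \<epsilon>_def N_def z_def G_def A_def
      using \<delta> k a \<theta>0 \<theta> r by (intro upper_ray_integral_asymptotic) auto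
    have V: "(\<lambda>n. V \<rho> n / N n) \<longlonglongrightarrow> 0" for \<rho>
      unfolding V_def \<epsilon>_def N_def A_def
      using \<delta> k a \<theta>0 \<theta> r gap \<kappa>1 by (intro lower_ray_integral_negligible) (auto simp: A_def)
    have "(\<lambda>n. (U 1 n / N n - V 1 n / N n) / (U a n / N n - V a n / N n)) \<longlonglongrightarrow> (z 1 * G - 0) / (z a * G - 0)"
      using G0 by (intro tendsto_divide tendsto_diff U V) (auto simp: z_def)
    also have "(z 1 * G - 0) / (z a * G - 0) = z 1 / z a"
      using G0 by simp
    also have "z 1 / z a = cis (2 * pi * \<theta> * (a - 1) / a)"
      unfolding z_def exp_diff[symmetric] cis_conv_exp using a
      by (intro arg_cong[of _ _ exp]) (simp add: field_simps)
    finally show ?thesis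
      using ratio[OF N0] by (simp add: diff_divide_distrib)
  qed
  then show ?thesis by (simp add: S_def)
qed

section \<open>Limits of W at the cusp 0\<close>

text \<open>Multiplication by 2 sin (\<phi> / 2) telescopes the sum of sines to 2 sin (d \<phi> / 2)
  sin ((d - 1) \<phi> / 2), and all three angles lie strictly between 0 and pi.\<close>

lemma Im_sum_cis_pos:
  fixes \<phi> :: real
  assumes "0 < \<phi>" "real d * \<phi> < 2 * pi" "d \<ge> 2"
  shows "Im (\<Sum>j<d. cis (real j * \<phi>)) > 0"
proof -
  have tele: "(\<Sum>j<n. sin (real j * \<phi>)) * (2 * sin (\<phi> / 2)) = cos (\<phi> / 2) - cos (real n * \<phi> - \<phi> / 2)" for n
  proof (induction n)
    case (Suc n)
    have "real (Suc n) * \<phi> - \<phi> / 2 = real n * \<phi> + \<phi> / 2"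
      by (simp add: algebra_simps)
    then show ?case
      using Suc by (simp add: distrib_right cos_add cos_diff)
  qed simp
  have "(\<Sum>j<d. sin (real j * \<phi>)) * (2 * sin (\<phi> / 2)) = 2 * sin (real d * \<phi> / 2) * sin ((real d - 1) * \<phi> / 2)"
    unfolding tele cos_diff_cos by (simp add: algebra_simps diff_divide_distrib)
  moreover have "2 * \<phi> \<le> real d * \<phi>"
    using assms by (intro mult_right_mono) auto
  then have "\<phi> < 2 * pi"
    using assms by linarith
  then have "sin (real d * \<phi> / 2) > 0" "sin ((real d - 1) * \<phi> / 2) > 0" "sin (\<phi> / 2) > 0"
    using assms \<open>\<phi> < 2 * pi\<close> by (auto intro!: sin_gt_zero simp: left_diff_distrib)
  ultimately have "0 < (\<Sum>j<d. sin (real j * \<phi>)) * (2 * sin (\<phi> / 2))"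
    by (simp only: mult_pos_pos zero_less_numeral)
  then have "0 < (\<Sum>j<d. sin (real j * \<phi>))"
    using \<open>sin (\<phi> / 2) > 0\<close> by (simp add: zero_less_mult_iff)
  then show ?thesis by simp
qed

lemma damped_Phi_cnj:
  assumes "Re t > 0"
  shows "damped_Phi k (cnj t) = cnj (damped_Phi k t)"
proof -
  have "(\<lambda>n. - 1 / (of_nat (Suc n) * (exp (of_nat (Suc n) * t) - 1))) sums log_Phi t"
    unfolding log_Phi_def by (rule summable_sums[OF summable_log_Phi[OF assms]])
  then have "(\<lambda>n. cnj (- 1 / (of_nat (Suc n) * (exp (of_nat (Suc n) * t) - 1)))) sums cnj (log_Phi t)"
    by (simp only: sums_cnj)
  then have "cnj (log_Phi t) = log_Phi (cnj t)"
    unfolding log_Phi_def by (intro sums_unique) (simp add: exp_cnj)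
  then show ?thesis
    using assms by (simp add: damped_Phi_eq_log_Phi exp_cnj)
qed

text \<open>Summability is assumed because \<open>suminf\<close> of a divergent series is an
  unspecified value, which conjugation need not respect.\<close>

lemma twisted_sum_cnj:
  assumes "Re t > 0" "a > 0" "\<rho> > 0"
    and "summable (\<lambda>m. z ^ m * damped_Phi k (of_real (\<rho> + a * real m) * t))"
  shows "twisted_sum k (cnj z) a \<rho> (cnj t) = cnj (twisted_sum k z a \<rho> t)"
proof -
  have "(\<lambda>m. cnj (z ^ m * damped_Phi k (of_real (\<rho> + a * real m) * t))) sums cnj (twisted_sum k z a \<rho> t)"
    unfolding twisted_sum_def sums_cnj by (rule summable_sums) fact
  moreover have "cnj (z ^ m * damped_Phi k (of_real (\<rho> + a * real m) * t)) =
      cnj z ^ m * damped_Phi k (of_real (\<rho> + a * real m) * cnj t)" for m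
  proof -
    have "0 < \<rho> + a * real m"
      using assms by (intro add_pos_nonneg) auto
    then have "0 < Re (of_real (\<rho> + a * real m) * t)"
      using assms(1) by (simp del: of_real_add of_real_mult)
    from damped_Phi_cnj[OF this] show ?thesis by simp
  qed
  ultimately have "(\<lambda>m. cnj z ^ m * damped_Phi k (of_real (\<rho> + a * real m) * cnj t)) sums cnj (twisted_sum k z a \<rho> t)"
    by (simp only:)
  from sums_unique[OF this] show ?thesis
    unfolding twisted_sum_def[of k "cnj z"] by simp
qed

text \<open>The roots of unity correspond to \<theta> = j / d with j < d. The bound r \<ge> sqrt d
  makes sqrt \<theta> r \<ge> 1 as soon as j > 0, so the saddle-point lemmas apply to all of them
  along the same sequence.\<close>

lemma W_limit_along_rays:
  fixes r :: "nat \<Rightarrow> real" and a d k :: nat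
  assumes a: "a \<ge> 1" and d: "d \<ge> 1" and k: "k \<ge> 1"
    and \<delta>: "0 < \<delta>" "\<delta> < pi / 4" and gap: "2 * sin \<delta> ^ 2 < 1 / real d"
    and r: "filterlim r at_top sequentially" "\<And>n. r n \<ge> sqrt d"
  defines "A \<equiv> real k * pi ^ 2 / 6"
  defines "\<epsilon> \<equiv> (\<lambda>n. of_real (2 * pi * A / (real a * r n ^ 2)) * cis (pi / 2 - 2 * \<delta>))"
  defines "L \<equiv> 1 / of_nat d * (\<Sum>j<d. cis (real j * (2 * pi * (real a - 1) / (real a * real d))))"
  assumes \<kappa>1: "\<And>n. 2 * pi * A / (real a * r n ^ 2) \<le> 1"
  shows "(\<lambda>n. W a d (exp (- \<epsilon> n)) k) \<longlonglongrightarrow> L"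
    and "(\<lambda>n. W a d (exp (- cnj (\<epsilon> n))) k) \<longlonglongrightarrow> cnj L"
proof -
  define f where "f n z = twisted_sum k z (real a) 1 (\<epsilon> n) / twisted_sum k z (real a) (real a) (\<epsilon> n)" for n z
  have r_pos: "r n > 0" for n using r(2)[of n] d by (auto intro: less_le_trans[rotated])
  have A: "A > 0" using k by (simp add: A_def)
  have \<kappa>: "2 * pi * A / (real a * r n ^ 2) > 0" for n using A a r_pos[of n] by simp
  have roots: "bij_betw (\<lambda>j. cis (2 * pi * (real j / real d))) {..<d} {z. z ^ d = 1}"
    using Complex.bij_betw_roots_unity[of d] d by (simp only: times_divide_eq_right)
  have W_eq: "W a d (exp (- \<epsilon> n)) k = 1 / of_nat d * (\<Sum>j<d. f n (cis (2 * pi * (real j / real d))))" for n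
    unfolding W_eq_twisted_sum f_def[symmetric] by (subst sum.reindex_bij_betw[OF roots, symmetric]) simp
  have lim: "(\<lambda>n. f n (cis (2 * pi * (real j / real d)))) \<longlonglongrightarrow> cis (real j * (2 * pi * (real a - 1) / (real a * real d)))"
    if j: "j < d" for j
  proof -
    \<comment> \<open>The worst case j = d - 1 explains the bound 1 / d in
      \<open>gap\<close>.\<close>
    have j': "real j / real d \<le> 1 - 1 / real d"
      using j by (simp add: field_simps)
    have "(\<lambda>n. f n (cis (2 * pi * (real j / real d)))) \<longlonglongrightarrow> cis (2 * pi * (real j / real d) * (real a - 1) / real a)"
      unfolding f_def \<epsilon>_def A_def
    proof (rule twisted_sum_ratio_tendsto[OF \<delta> k _ _ _ _ r(1) r_pos])
      show "2 * (sin \<delta>)\<^sup>2 < 1 - real j / real d" using gap j' by linarith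
      show "1 \<le> sqrt (real j / real d) * r n" if "0 < real j / real d" for n
      proof -
        have "1 / real d \<le> real j / real d"
          using that by (intro divide_right_mono) (auto simp: zero_less_divide_iff)
        then have "sqrt (1 / real d) * sqrt (real d) \<le> sqrt (real j / real d) * r n"
          using r(2)[of n] by (intro mult_mono) auto
        then show ?thesis using d by (simp add: real_sqrt_divide)
      qed
    qed (use a j \<kappa>1 in \<open>auto simp: A_def\<close>)
    also have "2 * pi * (real j / real d) * (real a - 1) / real a = real j * (2 * pi * (real a - 1) / (real a * real d))"
      by (simp add: mult_ac)
    finally show ?thesis .
  qed
  show 1: "(\<lambda>n. W a d (exp (- \<epsilon> n)) k) \<longlonglongrightarrow> L"
    unfolding W_eq L_def by (intro tendsto_mult tendsto_const tendsto_sum lim) auto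
  have "W a d (exp (- cnj (\<epsilon> n))) k = cnj (W a d (exp (- \<epsilon> n)) k)" for n
  proof -
    have Re: "Re (\<epsilon> n) > 0"
    proof -
      have "cos (pi / 2 - 2 * \<delta>) > 0" using \<delta> by (intro cos_gt_zero) auto
      then show ?thesis using mult_pos_pos[OF \<kappa>[of n]] by (simp add: \<epsilon>_def)
    qed
    have cnj: "twisted_sum k (cnj z) (real a) \<rho> (cnj (\<epsilon> n)) = cnj (twisted_sum k z (real a) \<rho> (\<epsilon> n))"
      if z: "z ^ d = 1" and \<rho>: "\<rho> = 1 \<or> \<rho> = real a" for z \<rho>
    proof (rule twisted_sum_cnj[OF Re])
      obtain j where j: "j < d" "z = cis (2 * pi * (real j / real d))"
        using roots z unfolding bij_betw_def by blast
      show "summable (\<lambda>m. z ^ m * damped_Phi k (of_real (\<rho> + real a * real m) * \<epsilon> n))"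
        unfolding j(2) \<epsilon>_def using \<delta> \<kappa> k a j(1) \<rho>
        by (intro lattice_sum_twisted_sum(1)) auto
    qed (use a \<rho> in auto)
    have "(\<Sum>z | z ^ d = 1. twisted_sum k z (real a) 1 (cnj (\<epsilon> n)) / twisted_sum k z (real a) (real a) (cnj (\<epsilon> n)))
       = (\<Sum>z | z ^ d = 1. cnj (f n z))"
    \<comment> \<open>Conjugation permutes the roots of unity, so conjugating \<epsilon> conjugates
      the whole sum although single terms change places.\<close>
    proof (rule sum.reindex_bij_witness[of _ cnj cnj])
      fix z :: complex assume z: "z \<in> {z. z ^ d = 1}"
      then show z': "cnj z \<in> {z. z ^ d = 1}" by (simp flip: complex_cnj_power)
      then show "cnj (f n (cnj z)) = twisted_sum k z (real a) 1 (cnj (\<epsilon> n)) / twisted_sum k z (real a) (real a) (cnj (\<epsilon> n))"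
        using cnj[of "cnj z"] by (simp add: f_def)
    qed (simp_all flip: complex_cnj_power)
    then show ?thesis
      unfolding W_eq_twisted_sum f_def by simp
  qed
  then show "(\<lambda>n. W a d (exp (- cnj (\<epsilon> n))) k) \<longlonglongrightarrow> cnj L"
    using tendsto_cnj[OF 1] by simp
qed

section \<open>The contradiction at the cusp\<close>

lemma not_essential_limits_eq:
  fixes F :: "complex \<Rightarrow> complex"
  assumes "not_essential F 0" "filterlim u (at 0) sequentially" "filterlim v (at 0) sequentially"
    and "(\<lambda>n. F (u n)) \<longlonglongrightarrow> l" "(\<lambda>n. F (v n)) \<longlonglongrightarrow> m"
  shows "l = m"
proof -
  from assms(1) consider x where "F \<midarrow>0\<rightarrow> x" | "is_pole F 0"
    by (auto simp: not_essential_def)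
  then show ?thesis
  proof cases
    case 1
    then show ?thesis
      using filterlim_compose[OF 1 assms(2)] filterlim_compose[OF 1 assms(3)] assms(4,5)
      by (metis LIMSEQ_unique)
  next
    case 2
    then have "filterlim (\<lambda>n. F (u n)) at_infinity sequentially"
      unfolding is_pole_def using assms(2) by (rule filterlim_compose)
    then show ?thesis
      using not_tendsto_and_filterlim_at_infinity[OF _ assms(4)] by simp
  qed
qed

lemma W_not_meromorphic_at_cusps:
  fixes a d k :: nat
  assumes "a \<ge> 2" "d \<ge> 2" "k \<ge> 1"
  shows "\<not> meromorphic_at_cusps (\<lambda>\<tau>. W a d (exp (2 * of_real pi * \<i> * \<tau>)) k)"
proof
  assume cusps: "meromorphic_at_cusps (\<lambda>\<tau>. W a d (exp (2 * of_real pi * \<i> * \<tau>)) k)"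
  define B :: "int ^ 2 ^ 2" where "B = vector [vector [0, - 1], vector [1, 0]]"
  have "B \<in> carrier SL2Z"
    by (simp add: B_def SL2Z_def det_2)
  then obtain N :: nat and F and C :: real where N: "N \<ge> 1" and F: "F meromorphic_on {0}" and C: "C > 0"
    and ev: "\<forall>\<^sub>\<approx>\<tau>\<in>{\<tau>. Im \<tau> > C}.
       W a d (exp (2 * of_real pi * \<i> * moebius_act B \<tau>)) k = F (exp (2 * of_real pi * \<i> * \<tau> / of_nat N))"
    using cusps unfolding meromorphic_at_cusps_def by meson
  have act: "moebius_act B \<tau> = - 1 / \<tau>" for \<tau>
    by (simp add: moebius_act_def B_def)
  define P where "P \<tau> \<longleftrightarrow> W a d (exp (2 * of_real pi * \<i> * (- 1 / \<tau>))) k = F (exp (2 * of_real pi * \<i> * \<tau> / of_nat N))" for \<tau>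
  have P_at: "eventually P (at \<tau>)" if "Im \<tau> > C" for \<tau>
    using ev that unfolding act P_def[abs_def]
    by (subst (asm) eventually_cosparse_open_eq) (auto intro: open_halfspace_Im_gt)
  \<comment> \<open>Then 2 sin^2 \<delta> \<le> 2 \<delta>^2 = 1 / (2 (d + 1)^2), which is below 1 /
    d.\<close>
  define \<delta> where "\<delta> = 1 / (2 * real d + 2)"
  have \<delta>: "0 < \<delta>" "\<delta> \<le> 1 / 6" "\<delta> < pi / 4"
  proof -
    show "0 < \<delta>" by (simp add: \<delta>_def)
    show "\<delta> \<le> 1 / 6" using assms by (simp add: \<delta>_def field_simps)
    then show "\<delta> < pi / 4" using pi_gt3 by linarith
  qed
  have gap: "2 * sin \<delta> ^ 2 < 1 / real d"
  proof -
    have "sin \<delta> \<ge> 0" using \<delta> pi_gt3 by (intro sin_ge_zero) auto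
    then have "2 * sin \<delta> ^ 2 \<le> 2 * \<delta> ^ 2"
      using \<delta> by (intro mult_left_mono power_mono sin_x_le_x) auto
    also have "2 * \<delta> ^ 2 < 1 / real d"
      using assms by (simp add: \<delta>_def power2_eq_square field_simps add_pos_nonneg)
    finally show ?thesis .
  qed
  have s2: "sin (2 * \<delta>) > 0" using \<delta> pi_gt3 by (intro sin_gt_zero) auto
  define A where "A = real k * pi ^ 2 / 6"
  have A: "A > 0" using assms by (simp add: A_def)
  \<comment> \<open>The directions are mirror images in the imaginary axis. With \<tau> = R p the
    value 2 pi i (- 1 / \<tau>) is - \<epsilon> for |\<epsilon>| = 2 pi / R at angle pi / 2 - 2
    \<delta>, and with \<tau> = R q it is minus the conjugate of \<epsilon>.\<close>
  define p q where "p = cis (2 * \<delta>)" and "q = - cnj p"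
  have Im_pq: "Im (of_real R * p) = R * sin (2 * \<delta>)" "Im (of_real R * q) = R * sin (2 * \<delta>)" for R
    by (simp_all add: p_def q_def)
  \<comment> \<open>The three terms ensure that R p and R q lie above height C, that \<kappa> = 2 pi
    / R is at most 1, and that r is at least sqrt d.\<close>
  define R0 where "R0 = max (C / sin (2 * \<delta>)) (max (2 * pi) (real a * real d / A))"
  have R0: "R0 > 0" unfolding R0_def using C s2 by (simp add: less_max_iff_disj)
  \<comment> \<open>The equality with F is known only off a sparse set. It holds in punctured
    neighbourhoods of T p and T q, so some R close to T is good on both rays at once.\<close>
  have "\<exists>R. R0 + real n < R \<and> P (of_real R * p) \<and> P (of_real R * q)" for n
  proof -
    define T where "T = R0 + real n + 1"
    have ev_ray: "eventually (\<lambda>R. P (of_real R * w)) (at T)" if "w \<noteq> 0" "Im (of_real T * w) > C" for w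
    proof -
      have "filterlim (\<lambda>R. of_real R * w) (at (of_real T * w)) (at T)"
        using that(1) by (auto simp: filterlim_at eventually_at_filter intro!: tendsto_intros)
      with P_at[OF that(2)] show ?thesis
        by (rule eventually_compose_filterlim)
    qed
    have TC: "T * sin (2 * \<delta>) > C"
    proof -
      have "C / sin (2 * \<delta>) < T" by (simp add: T_def R0_def)
      then show ?thesis using s2 by (simp add: pos_divide_less_eq)
    qed
    have "eventually (\<lambda>R. P (of_real R * p)) (at T)" "eventually (\<lambda>R. P (of_real R * q)) (at T)"
      using TC Im_pq[of T] by (intro ev_ray; simp add: p_def q_def)+
    moreover have "eventually (\<lambda>R. R0 + real n < R) (at T)"
      by (rule order_tendstoD(1)[OF tendsto_ident_at]) (simp add: T_def)
    ultimately have "eventually (\<lambda>R. R0 + real n < R \<and> P (of_real R * p) \<and> P (of_real R * q)) (at T)"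
      by eventually_elim simp
    then show ?thesis
      using eventually_happens'[OF at_neq_bot] by blast
  qed
  then obtain R where R: "\<And>n. R0 + real n < R n" "\<And>n. P (of_real (R n) * p)" "\<And>n. P (of_real (R n) * q)"
    by metis
  have R_pos: "R n > 0" for n using R(1)[of n] R0 by linarith
  have R_ge: "R n \<ge> 2 * pi" "R n \<ge> real a * real d / A" for n
  proof -
    have "R n \<ge> R0" using R(1)[of n] by linarith
    then show "R n \<ge> 2 * pi" "R n \<ge> real a * real d / A"
      by (auto simp: R0_def)
  qed
  have R_lim: "filterlim R at_top sequentially"
  proof (rule filterlim_at_top_mono[OF filterlim_real_sequentially always_eventually], rule allI)
    show "real n \<le> R n" for n
      using R(1)[of n] R0 by linarith
  qed
  \<comment> \<open>This solves 2 pi A / (a r^2) = 2 pi / R for r.\<close>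
  define r where "r n = sqrt (A * R n / real a)" for n
  have r2: "r n ^ 2 = A * R n / real a" for n
    using A R_pos[of n] by (simp add: r_def)
  have \<kappa>: "2 * pi * A / (real a * r n ^ 2) = 2 * pi / R n" for n
    unfolding r2 using A assms by simp
  define \<epsilon> where "\<epsilon> n = of_real (2 * pi / R n) * cis (pi / 2 - 2 * \<delta>)" for n
  define L where "L = 1 / of_nat d * (\<Sum>j<d. cis (real j * (2 * pi * (real a - 1) / (real a * real d))))"
  have r_lim: "filterlim r at_top sequentially"
    unfolding r_def
  proof (rule filterlim_compose[OF sqrt_at_top])
    have "filterlim (\<lambda>n. A / real a * R n) at_top sequentially"
      using A assms by (intro filterlim_tendsto_pos_mult_at_top[OF tendsto_const _ R_lim]) auto
    then show "filterlim (\<lambda>n. A * R n / real a) at_top sequentially" by simp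
  qed
  have r_ge: "r n \<ge> sqrt (real d)" for n
    unfolding r_def using R_ge(2)[of n] A assms by (intro real_sqrt_le_mono) (simp add: field_simps)
  have "2 * pi * A / (real a * r n ^ 2) \<le> 1" for n
    unfolding \<kappa> using R_ge(1)[of n] R_pos[of n] by simp
  note W_lims = W_limit_along_rays[OF _ _ assms(3) \<delta>(1,3) gap r_lim r_ge this[unfolded A_def], folded A_def, unfolded \<kappa>, folded \<epsilon>_def L_def]
  have lims: "(\<lambda>n. W a d (exp (- \<epsilon> n)) k) \<longlonglongrightarrow> L" "(\<lambda>n. W a d (exp (- cnj (\<epsilon> n))) k) \<longlonglongrightarrow> cnj L"
    using W_lims assms by auto
  define u where "u w n = exp (2 * of_real pi * \<i> * (of_real (R n) * w) / of_nat N)" for w n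
  have eqs: "W a d (exp (- \<epsilon> n)) k = F (u p n)" "W a d (exp (- cnj (\<epsilon> n))) k = F (u q n)" for n
  proof -
    have e: "cis (pi / 2 - 2 * \<delta>) = \<i> * cnj p"
      by (simp add: p_def complex_eq_iff cos_diff sin_diff)
    have pp: "p * cnj p = 1" "p \<noteq> 0"
      by (simp_all add: p_def cis_cnj cis_mult)
    have inv: "1 / p = cnj p" using pp by (simp add: field_simps)
    have "2 * of_real pi * \<i> * (- 1 / (of_real (R n) * p)) = - (of_real (2 * pi / R n) * (\<i> * (1 / p)))"
      by simp
    then have 1: "2 * of_real pi * \<i> * (- 1 / (of_real (R n) * p)) = - \<epsilon> n"
      unfolding inv \<epsilon>_def e .
    have "2 * of_real pi * \<i> * (- 1 / (of_real (R n) * q)) = of_real (2 * pi / R n) * (\<i> * cnj (1 / p))"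
      by (simp add: q_def)
    then have 2: "2 * of_real pi * \<i> * (- 1 / (of_real (R n) * q)) = - cnj (\<epsilon> n)"
      unfolding inv \<epsilon>_def e by simp
    show "W a d (exp (- \<epsilon> n)) k = F (u p n)" "W a d (exp (- cnj (\<epsilon> n))) k = F (u q n)"
      using R(2,3)[of n] unfolding P_def 1 2 u_def by auto
  qed
  have u_lim: "filterlim (u w) (at 0) sequentially" if "Im w > 0" for w
  proof -
    have "((\<lambda>x. exp (- (2 * pi * Im w / real N) * x)) \<longlongrightarrow> 0) at_top"
      using that N by real_asymp
    then have "(\<lambda>n. exp (- (2 * pi * Im w / real N) * R n)) \<longlonglongrightarrow> 0"
      by (rule filterlim_compose[OF _ R_lim])
    moreover have "norm (u w n) = exp (- (2 * pi * Im w / real N) * R n)" for n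
      by (simp add: u_def mult_ac)
    ultimately have "(\<lambda>n. norm (u w n)) \<longlonglongrightarrow> 0" by simp
    then have "u w \<longlonglongrightarrow> 0" by (rule tendsto_norm_zero_cancel)
    then show ?thesis by (auto simp: filterlim_at u_def)
  qed
  have "L = cnj L"
  proof (rule not_essential_limits_eq[OF meromorphic_on_not_essential[OF F]])
    show "filterlim (u p) (at 0) sequentially" "filterlim (u q) (at 0) sequentially"
      using s2 by (auto intro!: u_lim simp: p_def q_def)
    show "(\<lambda>n. F (u p n)) \<longlonglongrightarrow> L" "(\<lambda>n. F (u q n)) \<longlonglongrightarrow> cnj L"
      using lims unfolding eqs .
  qed
  from arg_cong[OF this, of Im] have "Im L = 0"
    by simp
  moreover have "Im L > 0"
  proof -
    \<comment> \<open>The step between consecutive limiting phases. As a \<ge> 2 it is positive, and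
      d \<phi> = 2 pi (a - 1) / a falls short of a full turn, so the phases do not cancel.\<close>
    define \<phi> where "\<phi> = 2 * pi * (real a - 1) / (real a * real d)"
    have "0 < \<phi>" using assms by (simp add: \<phi>_def)
    moreover have "real d * \<phi> < 2 * pi" using assms by (simp add: \<phi>_def field_simps)
    ultimately have "Im (\<Sum>j<d. cis (real j * \<phi>)) > 0"
      using assms by (intro Im_sum_cis_pos)
    moreover have "L = of_real (1 / real d) * (\<Sum>j<d. cis (real j * \<phi>))"
      by (simp add: L_def \<phi>_def)
    then have "Im L = 1 / real d * Im (\<Sum>j<d. cis (real j * \<phi>))"
      by (simp only: Im_complex_of_real Re_complex_of_real times_complex.sel)
    ultimately show ?thesis using assms by simp
  qed
  ultimately show False by simp
qed

theorem corollary4p10: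
  fixes a d k :: nat
  assumes "a \<ge> 2" and "d \<ge> 2" and "even d" and "k \<ge> 1"
  shows "\<not> (\<exists>\<Gamma>. subgroup \<Gamma> SL2Z \<and> finite (rcosets\<^bsub>SL2Z\<^esub> \<Gamma>) \<and>
              meromorphic_modular_function \<Gamma> (\<lambda>\<tau>. W a d (exp (2 * of_real pi * \<i> * \<tau>)) k) \<and>
              meromorphic_at_cusps (\<lambda>\<tau>. W a d (exp (2 * of_real pi * \<i> * \<tau>)) k))"
  using W_not_meromorphic_at_cusps[OF assms(1,2,4)] by blast

end
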